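(* Let $\mathbb{F}$ be a field of characteristic zero and $R$ a subring of $\mathbb{F}$. Let $T$ be a theory in a language $\mathcal{L}$ extending the language of $\mathbb{F}$-vector spaces, such that $T$ expands the theory of $\mathbb{F}$-vector spaces, has quantifier elimination in $\mathcal{L}$, eliminates $\exists^\infty$, and satisfies $\mathrm{dcl}=\mathrm{acl}=\mathrm{span}_{\mathbb{F}}$ in its models. If $T$ is NIP, then $T^{G+}$ is also NIP.
   Context: $\hat R=\mathrm{Frac}(R)\subseteq\mathbb{F}$. $\mathcal{L}_0=\{+,0,(\lambda\cdot)_{\lambda\in\mathbb{F}}\}$, $\mathcal{L}\supseteq\mathcal{L}_0$, and $\mathcal{L}_{R\text{-mod}}=\{+,0,(r\cdot)_{r\in R}\}$. $\mathcal{L}_G$ is the expansion of $\mathcal{L}$ by a new unary predicate $G$ and a new predicate $P_\phi(\vec x)$ for each $\mathcal{L}_{R\text{-mod}}$-formula $\phi(\vec x)$. $T^G$ is the $\mathcal{L}_G$-theory of pairs $(V,G)$ with $V\models T$ satisfying (universal closures of): (A) $G$ is a proper $R$-submodule of $V$, and $P_\phi(\vec a)$ holds iff $\vec a\in G$ and $G\models\phi(\vec a)$ as an $R$-module. (B) If $\lambda_1,\dots,\lambda_n\in\mathbb{F}$ are $\hat R$-linearly independent, then for all $g_1,\dots,g_n\in G$: $\lambda_1g_1+\dots+\lambda_ng_n=0$ implies $g_1=\dots=g_n=0$. (C) (Density) For every $r\in R\setminus\{0\}$ and $\mathcal{L}$-formula $\phi(x,\vec y)$: $\exists^\infty x\,\phi(x,\vec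 y)\to\exists x(\phi(x,\vec y)\wedge x\in rG)$. (D) (Extension/co-density) For all $\mathcal{L}$-formulas $\phi(x,\vec y)$, $\psi(x,\vec y,\vec z)$ and $n\ge1$: $(\exists^\infty x\,\phi(x,\vec y)\wedge\forall\vec z\,\exists^{\le n}x\,\psi(x,\vec y,\vec z))\to\exists x(\phi(x,\vec y)\wedge\forall\vec z(G(\vec z)\to\neg\psi(x,\vec y,\vec z)))$, where $G(\vec z)$ means all coordinates of $\vec z$ lie in $G$. $\mathcal{L}_G^+$ is $\mathcal{L}_G$ together with, for each finite $\hat R$-linearly independent tuple $\vec\lambda=(\lambda_1,\dots,\lambda_n)$ from $\mathbb{F}$, a unary predicate $G_{\vec\lambda}$ and unary function symbols $f_{\vec\lambda,i}$ ($1\le i\le n$). $T^{G+}$ is the expansion by definitions of $T^G$ to $\mathcal{L}_G^+$ given by: $G_{\vec\lambda}(x)\leftrightarrow\exists\vec y\in G\ \sum_i\lambda_iy_i=x$; and $x=f_{\vec\lambda,i}(y)$ iff either $y\in G_{\vec\lambda}$ and there is $\vec x\in G$ with $y=\sum_j\lambda_jx_j$ and $x_i=x$, or $y\notin G_{\vec\lambda}$ and $x=0$. (By (B) the tuple $\vec x$ is unique.) A theory is NIP if in every model of it no formula has the independence property. *)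

theory Defs
  imports Main
begin

section \<open>First-order logic\<close>

text \<open>A language is a pair of partial arity functions on two types of candidate symbols; the
  symbols with arity \<^term>\<open>None\<close> do not belong to the language.\<close>

record ('f, 'p) lang =
  fun_ar :: "'f \<Rightarrow> nat option"
  rel_ar :: "'p \<Rightarrow> nat option"

definition sublang :: "('f, 'p) lang \<Rightarrow> ('f, 'p) lang \<Rightarrow> bool" where
  "sublang L L' \<longleftrightarrow> fun_ar L \<subseteq>\<^sub>m fun_ar L' \<and> rel_ar L \<subseteq>\<^sub>m rel_ar L'"

datatype 'f tm = Var nat | Fn 'f "'f tm list"

datatype ('f, 'p) fm =
    Eq "'f tm" "'f tm"
  | Pred 'p "'f tm list"
  | Neg "('f, 'p) fm"
  | And "('f, 'p) fm" "('f, 'p) fm"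
  | Exi nat "('f, 'p) fm"

fun wf_tm :: "('f, 'p) lang \<Rightarrow> 'f tm \<Rightarrow> bool" where
  "wf_tm L (Var x) \<longleftrightarrow> True"
| "wf_tm L (Fn f ts) \<longleftrightarrow> fun_ar L f = Some (length ts) \<and> (\<forall>t\<in>set ts. wf_tm L t)"

fun wf_fm :: "('f, 'p) lang \<Rightarrow> ('f, 'p) fm \<Rightarrow> bool" where
  "wf_fm L (Eq s t) \<longleftrightarrow> wf_tm L s \<and> wf_tm L t"
| "wf_fm L (Pred p ts) \<longleftrightarrow> rel_ar L p = Some (length ts) \<and> (\<forall>t\<in>set ts. wf_tm L t)"
| "wf_fm L (Neg \<phi>) \<longleftrightarrow> wf_fm L \<phi>"
| "wf_fm L (And \<phi> \<psi>) \<longleftrightarrow> wf_fm L \<phi> \<and> wf_fm L \<psi>"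
| "wf_fm L (Exi x \<phi>) \<longleftrightarrow> wf_fm L \<phi>"

fun fv_tm :: "'f tm \<Rightarrow> nat set" where
  "fv_tm (Var x) = {x}"
| "fv_tm (Fn f ts) = (\<Union>t\<in>set ts. fv_tm t)"

fun fv :: "('f, 'p) fm \<Rightarrow> nat set" where
  "fv (Eq s t) = fv_tm s \<union> fv_tm t"
| "fv (Pred p ts) = (\<Union>t\<in>set ts. fv_tm t)"
| "fv (Neg \<phi>) = fv \<phi>"
| "fv (And \<phi> \<psi>) = fv \<phi> \<union> fv \<psi>"
| "fv (Exi x \<phi>) = fv \<phi> - {x}"

fun qfree :: "('f, 'p) fm \<Rightarrow> bool" where
  "qfree (Eq s t) \<longleftrightarrow> True"
| "qfree (Pred p ts) \<longleftrightarrow> True"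
| "qfree (Neg \<phi>) \<longleftrightarrow> qfree \<phi>"
| "qfree (And \<phi> \<psi>) \<longleftrightarrow> qfree \<phi> \<and> qfree \<psi>"
| "qfree (Exi x \<phi>) \<longleftrightarrow> False"

record ('u, 'f, 'p) struct =
  Dom :: "'u set"
  fn :: "'f \<Rightarrow> 'u list \<Rightarrow> 'u"
  rl :: "'p \<Rightarrow> 'u list \<Rightarrow> bool"

definition is_struct :: "('f, 'p) lang \<Rightarrow> ('u, 'f, 'p) struct \<Rightarrow> bool" where
  "is_struct L M \<longleftrightarrow> Dom M \<noteq> {} \<and>
     (\<forall>f as. fun_ar L f = Some (length as) \<and> set as \<subseteq> Dom M \<longrightarrow> fn M f as \<in> Dom M)"

fun eval_tm :: "('u, 'f, 'p) struct \<Rightarrow> (nat \<Rightarrow> 'u) \<Rightarrow> 'f tm \<Rightarrow> 'u" where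
  "eval_tm M v (Var x) = v x"
| "eval_tm M v (Fn f ts) = fn M f (map (eval_tm M v) ts)"

fun sat :: "('u, 'f, 'p) struct \<Rightarrow> (nat \<Rightarrow> 'u) \<Rightarrow> ('f, 'p) fm \<Rightarrow> bool" where
  "sat M v (Eq s t) \<longleftrightarrow> eval_tm M v s = eval_tm M v t"
| "sat M v (Pred p ts) \<longleftrightarrow> rl M p (map (eval_tm M v) ts)"
| "sat M v (Neg \<phi>) \<longleftrightarrow> \<not> sat M v \<phi>"
| "sat M v (And \<phi> \<psi>) \<longleftrightarrow> sat M v \<phi> \<and> sat M v \<psi>"
| "sat M v (Exi x \<phi>) \<longleftrightarrow> (\<exists>a\<in>Dom M. sat M (v(x := a)) \<phi>)"

definition is_theory :: "('f, 'p) lang \<Rightarrow> ('f, 'p) fm set \<Rightarrow> bool" where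
  "is_theory L T \<longleftrightarrow> (\<forall>\<theta>\<in>T. wf_fm L \<theta> \<and> fv \<theta> = {})"

text \<open>The models of \<open>T\<close> whose elements are taken from the type \<open>'u\<close>.\<close>

definition Models ::
  "'u itself \<Rightarrow> ('f, 'p) lang \<Rightarrow> ('f, 'p) fm set \<Rightarrow> ('u, 'f, 'p) struct set" where
  "Models U L T = {M. is_struct L M \<and> (\<forall>\<theta>\<in>T. \<forall>v. range v \<subseteq> Dom M \<longrightarrow> sat M v \<theta>)}"

text \<open>The set defined by \<open>\<phi>(x, v)\<close>: the free variables other than \<open>x\<close> are parameters
  with values given by \<open>v\<close>.\<close>

definition sols :: "('u, 'f, 'p) struct \<Rightarrow> ('f, 'p) fm \<Rightarrow> nat \<Rightarrow> (nat \<Rightarrow> 'u) \<Rightarrow> 'u set" where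
  "sols M \<phi> x v = {a \<in> Dom M. sat M (v(x := a)) \<phi>}"


section \<open>Properties of theories\<close>

text \<open>In this section a theory is given by its class \<open>K\<close> of models.\<close>

definition has_QE :: "('f, 'p) lang \<Rightarrow> ('u, 'f, 'p) struct set \<Rightarrow> bool" where
  "has_QE L K \<longleftrightarrow>
     (\<forall>\<phi>. wf_fm L \<phi> \<longrightarrow>
        (\<exists>\<psi>. wf_fm L \<psi> \<and> qfree \<psi> \<and> fv \<psi> \<subseteq> fv \<phi> \<and>
             (\<forall>M\<in>K. \<forall>v. range v \<subseteq> Dom M \<longrightarrow> (sat M v \<phi> \<longleftrightarrow> sat M v \<psi>))))"

definition eliminates_ex_inf :: "('f, 'p) lang \<Rightarrow> ('u, 'f, 'p) struct set \<Rightarrow> bool" where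
  "eliminates_ex_inf L K \<longleftrightarrow>
     (\<forall>\<phi> x. wf_fm L \<phi> \<longrightarrow>
        (\<exists>\<psi>. wf_fm L \<psi> \<and> fv \<psi> \<subseteq> fv \<phi> - {x} \<and>
             (\<forall>M\<in>K. \<forall>v. range v \<subseteq> Dom M \<longrightarrow>
                (sat M v \<psi> \<longleftrightarrow> infinite (sols M \<phi> x v)))))"

definition acl :: "('f, 'p) lang \<Rightarrow> ('u, 'f, 'p) struct \<Rightarrow> 'u set \<Rightarrow> 'u set" where
  "acl L M A = {b. \<exists>\<phi> x v. wf_fm L \<phi> \<and> v ` (fv \<phi> - {x}) \<subseteq> A \<and>
                     finite (sols M \<phi> x v) \<and> b \<in> sols M \<phi> x v}"

definition dcl :: "('f, 'p) lang \<Rightarrow> ('u, 'f, 'p) struct \<Rightarrow> 'u set \<Rightarrow> 'u set" where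
  "dcl L M A = {b. \<exists>\<phi> x v. wf_fm L \<phi> \<and> v ` (fv \<phi> - {x}) \<subseteq> A \<and> sols M \<phi> x v = {b}}"

text \<open>A partitioned formula is a formula \<open>\<phi>\<close> with a set \<open>X\<close> of object variables, the remaining
  variables being parameter variables. It has the independence property in \<open>M\<close> if, for every \<open>n\<close>,
  it shatters some \<open>n\<close> tuples of \<open>M\<close>. By compactness, it amounts to the same for all models of a
  theory if one infinite sequence of tuples is asked for instead.\<close>

definition has_IP ::
  "('u, 'f, 'p) struct \<Rightarrow> ('f, 'p) fm \<Rightarrow> nat set \<Rightarrow> bool" where
  "has_IP M \<phi> X \<longleftrightarrow>
     (\<forall>n::nat. \<exists>(a :: nat \<Rightarrow> nat \<Rightarrow> 'u) (b :: nat set \<Rightarrow> nat \<Rightarrow> 'u).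
        (\<forall>i. range (a i) \<subseteq> Dom M) \<and> (\<forall>I. range (b I) \<subseteq> Dom M) \<and>
        (\<forall>i<n. \<forall>I. I \<subseteq> {..<n} \<longrightarrow>
           (sat M (\<lambda>z. if z \<in> X then a i z else b I z) \<phi> \<longleftrightarrow> i \<in> I)))"

definition NIP :: "('f, 'p) lang \<Rightarrow> ('u, 'f, 'p) struct set \<Rightarrow> bool" where
  "NIP L K \<longleftrightarrow> (\<forall>M\<in>K. \<forall>\<phi> X. wf_fm L \<phi> \<longrightarrow> \<not> has_IP M \<phi> X)"


section \<open>Expansions of vector spaces\<close>

text \<open>Function symbols of an expansion of the language of vector spaces over \<open>'k\<close>; \<open>Sym\<close>
  provides the additional ones.\<close>

datatype ('k, 'f) lfun = Add | Zero | Scal 'k | Sym 'f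

text \<open>The language of \<open>S\<close>-modules, for \<open>S\<close> a set of scalars. The language of vector spaces
  over \<open>'k\<close> is the case \<open>S = UNIV\<close>.\<close>

definition mod_lang :: "'k set \<Rightarrow> (('k, 'f) lfun, 'p) lang" where
  "mod_lang S = \<lparr>
     fun_ar = (\<lambda>s. case s of Add \<Rightarrow> Some 2 | Zero \<Rightarrow> Some 0
                   | Scal c \<Rightarrow> (if c \<in> S then Some 1 else None) | Sym f \<Rightarrow> None),
     rel_ar = (\<lambda>p. None)\<rparr>"

abbreviation vadd :: "('u, ('k, 'f) lfun, 'p) struct \<Rightarrow> 'u \<Rightarrow> 'u \<Rightarrow> 'u" where
  "vadd M a b \<equiv> fn M Add [a, b]"

abbreviation vzero :: "('u, ('k, 'f) lfun, 'p) struct \<Rightarrow> 'u" where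
  "vzero M \<equiv> fn M Zero []"

abbreviation smul :: "('u, ('k, 'f) lfun, 'p) struct \<Rightarrow> 'k \<Rightarrow> 'u \<Rightarrow> 'u" where
  "smul M c a \<equiv> fn M (Scal c) [a]"

definition is_vector_space :: "('u, ('k::field, 'f) lfun, 'p) struct \<Rightarrow> bool" where
  "is_vector_space M \<longleftrightarrow>
     is_struct (mod_lang UNIV) M \<and>
     (\<forall>a\<in>Dom M. \<forall>b\<in>Dom M. \<forall>c\<in>Dom M. vadd M (vadd M a b) c = vadd M a (vadd M b c)) \<and>
     (\<forall>a\<in>Dom M. \<forall>b\<in>Dom M. vadd M a b = vadd M b a) \<and>
     (\<forall>a\<in>Dom M. vadd M (vzero M) a = a) \<and>
     (\<forall>a\<in>Dom M. \<exists>b\<in>Dom M. vadd M a b = vzero M) \<and>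
     (\<forall>c. \<forall>a\<in>Dom M. \<forall>b\<in>Dom M. smul M c (vadd M a b) = vadd M (smul M c a) (smul M c b)) \<and>
     (\<forall>c d. \<forall>a\<in>Dom M. smul M (c + d) a = vadd M (smul M c a) (smul M d a)) \<and>
     (\<forall>c d. \<forall>a\<in>Dom M. smul M (c * d) a = smul M c (smul M d a)) \<and>
     (\<forall>a\<in>Dom M. smul M 1 a = a)"

inductive_set vspan :: "('u, ('k, 'f) lfun, 'p) struct \<Rightarrow> 'u set \<Rightarrow> 'u set"
  for M :: "('u, ('k, 'f) lfun, 'p) struct" and A :: "'u set" where
  zero: "vzero M \<in> vspan M A"
| base: "a \<in> A \<Longrightarrow> a \<in> vspan M A"
| add: "a \<in> vspan M A \<Longrightarrow> b \<in> vspan M A \<Longrightarrow> vadd M a b \<in> vspan M A"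
| scale: "a \<in> vspan M A \<Longrightarrow> smul M c a \<in> vspan M A"

definition dcl_acl_span ::
  "(('k, 'f) lfun, 'p) lang \<Rightarrow> ('u, ('k, 'f) lfun, 'p) struct set \<Rightarrow> bool" where
  "dcl_acl_span L K \<longleftrightarrow>
     (\<forall>M\<in>K. \<forall>A. A \<subseteq> Dom M \<longrightarrow> dcl L M A = acl L M A \<and> acl L M A = vspan M A)"

definition is_subring :: "'k::field set \<Rightarrow> bool" where
  "is_subring R \<longleftrightarrow> 1 \<in> R \<and> (\<forall>a\<in>R. \<forall>b\<in>R. a - b \<in> R \<and> a * b \<in> R)"

definition frac_field :: "'k::field set \<Rightarrow> 'k set" where
  "frac_field R = {a / b | a b. a \<in> R \<and> b \<in> R \<and> b \<noteq> 0}"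

definition lin_indep :: "'k::field set \<Rightarrow> 'k list \<Rightarrow> bool" where
  "lin_indep Q ls \<longleftrightarrow>
     (\<forall>qs. length qs = length ls \<and> set qs \<subseteq> Q \<and> (\<Sum>i<length ls. qs ! i * ls ! i) = 0 \<longrightarrow>
           (\<forall>q\<in>set qs. q = 0))"

definition lincomb ::
  "('u, ('k, 'f) lfun, 'p) struct \<Rightarrow> 'k list \<Rightarrow> 'u list \<Rightarrow> 'u" where
  "lincomb M ls as = foldr (\<lambda>(l, a) s. vadd M (smul M l a) s) (zip ls as) (vzero M)"


section \<open>Expansions by a generic submodule\<close>

text \<open>\<open>PMod n \<phi>\<close> is the predicate attached to the formula \<open>\<phi>(x\<^sub>0, \<dots>, x\<^sub>n\<^sub>-\<^sub>1)\<close> of the language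
  of \<open>R\<close>-modules. \<open>GSpan ls\<close> and \<open>Coord ls i\<close> are the symbols attached to the tuple \<open>ls\<close> of
  scalars, with coordinates counted from 0.\<close>

datatype ('k, 'f) gfun = GFun "('k, 'f) lfun" | Coord "'k list" nat

datatype ('k, 'f, 'p) grel =
    GRel 'p
  | InG
  | PMod nat "(('k, 'f) lfun, 'p) fm"
  | GSpan "'k list"

definition lang_G ::
  "(('k, 'f) lfun, 'p) lang \<Rightarrow> 'k set \<Rightarrow> (('k, 'f) gfun, ('k, 'f, 'p) grel) lang" where
  "lang_G L R = \<lparr>
     fun_ar = (\<lambda>s. case s of GFun f \<Rightarrow> fun_ar L f | Coord ls i \<Rightarrow> None),
     rel_ar = (\<lambda>p. case p of
         GRel q \<Rightarrow> rel_ar L q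
       | InG \<Rightarrow> Some 1
       | PMod n \<phi> \<Rightarrow> (if wf_fm (mod_lang R) \<phi> \<and> fv \<phi> \<subseteq> {..<n} then Some n else None)
       | GSpan ls \<Rightarrow> None)\<rparr>"

definition lang_Gplus ::
  "(('k::field, 'f) lfun, 'p) lang \<Rightarrow> 'k set \<Rightarrow> (('k, 'f) gfun, ('k, 'f, 'p) grel) lang" where
  "lang_Gplus L R = \<lparr>
     fun_ar = (\<lambda>s. case s of
         GFun f \<Rightarrow> fun_ar L f
       | Coord ls i \<Rightarrow> (if lin_indep (frac_field R) ls \<and> i < length ls then Some 1 else None)),
     rel_ar = (\<lambda>p. case p of
         GSpan ls \<Rightarrow> (if lin_indep (frac_field R) ls then Some 1 else None)
       | _ \<Rightarrow> rel_ar (lang_G L R) p)\<rparr>"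

definition reduct ::
  "('u, ('k, 'f) gfun, ('k, 'f, 'p) grel) struct \<Rightarrow> ('u, ('k, 'f) lfun, 'p) struct" where
  "reduct M = \<lparr>Dom = Dom M, fn = (\<lambda>f. fn M (GFun f)), rl = (\<lambda>p. rl M (GRel p))\<rparr>"

definition G_of :: "('u, ('k, 'f) gfun, ('k, 'f, 'p) grel) struct \<Rightarrow> 'u set" where
  "G_of M = {a \<in> Dom M. rl M InG [a]}"

definition proper_submodule ::
  "'k set \<Rightarrow> ('u, ('k, 'f) lfun, 'p) struct \<Rightarrow> 'u set \<Rightarrow> bool" where
  "proper_submodule R V G \<longleftrightarrow>
     G \<subset> Dom V \<and> vzero V \<in> G \<and>
     (\<forall>a\<in>G. \<forall>b\<in>G. vadd V a b \<in> G) \<and> (\<forall>r\<in>R. \<forall>a\<in>G. smul V r a \<in> G)"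

text \<open>The structure \<open>(reduct M)\<lparr>Dom := G_of M\<rparr>\<close> is \<open>G\<close> with the operations induced from \<open>V\<close>;
  only formulas of the language of \<open>R\<close>-modules are evaluated in it.\<close>

definition ax_module ::
  "'k set \<Rightarrow> ('u, ('k, 'f) gfun, ('k, 'f, 'p) grel) struct \<Rightarrow> bool" where
  "ax_module R M \<longleftrightarrow>
     proper_submodule R (reduct M) (G_of M) \<and>
     (\<forall>n \<phi> as. wf_fm (mod_lang R) \<phi> \<and> fv \<phi> \<subseteq> {..<n} \<and> length as = n \<and> set as \<subseteq> Dom M \<longrightarrow>
        (rl M (PMod n \<phi>) as \<longleftrightarrow>
           set as \<subseteq> G_of M \<and> sat ((reduct M)\<lparr>Dom := G_of M\<rparr>) (\<lambda>i. as ! i) \<phi>))"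

definition ax_indep ::
  "'k::field set \<Rightarrow> ('u, ('k, 'f) gfun, ('k, 'f, 'p) grel) struct \<Rightarrow> bool" where
  "ax_indep R M \<longleftrightarrow>
     (\<forall>ls gs. lin_indep (frac_field R) ls \<and> length gs = length ls \<and> set gs \<subseteq> G_of M \<and>
        lincomb (reduct M) ls gs = vzero (reduct M) \<longrightarrow>
        (\<forall>g\<in>set gs. g = vzero (reduct M)))"

definition ax_density ::
  "(('k::field, 'f) lfun, 'p) lang \<Rightarrow> 'k set \<Rightarrow>
   ('u, ('k, 'f) gfun, ('k, 'f, 'p) grel) struct \<Rightarrow> bool" where
  "ax_density L R M \<longleftrightarrow>
     (\<forall>r\<in>R - {0}. \<forall>\<phi> x v.
        wf_fm L \<phi> \<and> range v \<subseteq> Dom M \<and> infinite (sols (reduct M) \<phi> x v) \<longrightarrow>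
        (\<exists>a\<in>sols (reduct M) \<phi> x v. a \<in> smul (reduct M) r ` G_of M))"

text \<open>\<open>Z\<close> is the set of the variables \<open>z\<close> of \<open>\<psi>(x, y, z)\<close>; \<open>override_on v w Z\<close> takes their
  values from \<open>w\<close> and all other values from \<open>v\<close>.\<close>

definition ax_extension ::
  "(('k, 'f) lfun, 'p) lang \<Rightarrow> ('u, ('k, 'f) gfun, ('k, 'f, 'p) grel) struct \<Rightarrow> bool" where
  "ax_extension L M \<longleftrightarrow>
     (\<forall>\<phi> \<psi> x Z (n::nat) v.
        wf_fm L \<phi> \<and> wf_fm L \<psi> \<and> finite Z \<and> x \<notin> Z \<and> fv \<phi> \<inter> Z = {} \<and> n \<ge> 1 \<and>
        range v \<subseteq> Dom M \<and> infinite (sols (reduct M) \<phi> x v) \<and>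
        (\<forall>w. w ` Z \<subseteq> Dom M \<longrightarrow>
           finite (sols (reduct M) \<psi> x (override_on v w Z)) \<and>
           card (sols (reduct M) \<psi> x (override_on v w Z)) \<le> n) \<longrightarrow>
        (\<exists>a\<in>sols (reduct M) \<phi> x v.
           \<forall>w. w ` Z \<subseteq> G_of M \<longrightarrow> a \<notin> sols (reduct M) \<psi> x (override_on v w Z)))"

definition TG_models ::
  "'u itself \<Rightarrow> (('k::field, 'f) lfun, 'p) lang \<Rightarrow> (('k, 'f) lfun, 'p) fm set \<Rightarrow> 'k set \<Rightarrow>
   ('u, ('k, 'f) gfun, ('k, 'f, 'p) grel) struct set" where
  "TG_models U L T R =
     {M. is_struct (lang_G L R) M \<and> reduct M \<in> Models U L T \<and>
         ax_module R M \<and> ax_indep R M \<and> ax_density L R M \<and> ax_extension L M}"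

definition G_span ::
  "('u, ('k, 'f) gfun, ('k, 'f, 'p) grel) struct \<Rightarrow> 'k list \<Rightarrow> 'u set" where
  "G_span M ls =
     {lincomb (reduct M) ls ys | ys. length ys = length ls \<and> set ys \<subseteq> G_of M}"

definition TGplus_models ::
  "'u itself \<Rightarrow> (('k::field, 'f) lfun, 'p) lang \<Rightarrow> (('k, 'f) lfun, 'p) fm set \<Rightarrow> 'k set \<Rightarrow>
   ('u, ('k, 'f) gfun, ('k, 'f, 'p) grel) struct set" where
  "TGplus_models U L T R =
     {M \<in> TG_models U L T R.
        is_struct (lang_Gplus L R) M \<and>
        (\<forall>ls. lin_indep (frac_field R) ls \<longrightarrow>
           (\<forall>a\<in>Dom M. rl M (GSpan ls) [a] \<longleftrightarrow> a \<in> G_span M ls) \<and>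
           (\<forall>i<length ls. \<forall>x\<in>Dom M. \<forall>y\<in>Dom M.
              x = fn M (Coord ls i) [y] \<longleftrightarrow>
                (y \<in> G_span M ls \<and>
                   (\<exists>xs. length xs = length ls \<and> set xs \<subseteq> G_of M \<and>
                         y = lincomb (reduct M) ls xs \<and> xs ! i = x)) \<or>
                (y \<notin> G_span M ls \<and> x = vzero (reduct M))))}"

text \<open>A type cannot contain models of every cardinality. The type \<open>univ\<close> contains a copy of an
  arbitrary type \<open>'u\<close> and has at least as many elements as there are formulas. By the
  Loewenheim-Skolem theorem, a formula that is
  valid in all models with elements in this type is valid in all models, so that restricting to
  models in this type is no restriction, for \<open>T\<close> and for its expansion alike.\<close>

type_synonym ('u, 'k, 'f, 'p) univ = "'u + (('k, 'f) lfun, 'p) fm"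

end

theory Submission
  imports Defs Complex_Main "HOL-Library.FuncSet" "HOL-Library.Function_Algebras"
begin

text \<open>A model is coded as a space \<open>V\<close> of functions with a submodule \<open>G\<close>, and a formula as the set of
  valuations that satisfy it. Two families of sets are easy to handle: sets \<open>\<Phi>\<close> definable in the
  reduct to \<open>\<L>\<close>, and primitive positive sets, given by finite systems of linear equations with
  variables quantified over \<open>G\<close>. The latter are groups, and axiom (B) makes a solution set in \<open>G\<close>
  either a point or as large as some \<open>rG\<close>. Every set definable in the expansion is a finite union
  of sets \<open>\<exists>u\<in>G. P(v,u) \<and> B(v,u) \<and> \<Phi>(v,u)\<close>, where \<open>P\<close> is primitive positive and determines \<open>u\<close>
  by \<open>v\<close>, and \<open>B\<close> is a Boolean combination of primitive positive sets. Quantifiers over \<open>G\<close>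
  are eliminated by the Baur-Monk theorem and density, quantifiers over \<open>V\<close> by co-density, and
  infinite and finite fibres of \<open>\<Phi>\<close> are treated separately: the latter consist of linear terms,
  because acl is the span. Such sets are NIP since \<open>u\<close> is an additive function of \<open>v\<close>, so that
  \<open>\<Phi>(v,u)\<close> reduces to a formula of \<open>\<L>\<close>, while a coset structure shatters no two points.\<close>

section \<open>Shattering\<close>

text \<open>Uniqueness of the witness \<open>u\<close> is what closes the normal form under
  complements. The price is paid at each quantifier over \<open>G\<close>: its variable either joins
  the determined ones or has to be separated from them by a linear change of variables. As
  \<open>R\<close> is an arbitrary subring, the fibre groups that occur may have infinite index in
  one another; Neumann's lemma removes those cosets before anything can be counted. That acl is the
  span yields one linear term for each algebraic element, whereas the elimination needs finitely
  many terms that serve all fibres at once. This takes compactness, and the model so obtained must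
  live in the very type for which the hypotheses are assumed; hence a Skolem hull whose elements are
  coded by formulas. The carrier of a model is merely a set, while the abstract argument uses the
  group operations of a type; an embedding into functions with values in the field bridges the gap.
  The new predicates and functions of the expanded language are themselves given by quantifiers over
  \<open>G\<close>, so closure of the normal form under these covers them too.\<close>

definition shatters :: "'a set set \<Rightarrow> 'a set \<Rightarrow> bool" where
  "shatters F Y \<longleftrightarrow> (\<forall>Z\<subseteq>Y. \<exists>A\<in>F. A \<inter> Y = Z)"

lemma shatters_subset:
  assumes "shatters F Y" "Y' \<subseteq> Y"
  shows "shatters F Y'"
  unfolding shatters_def
proof (intro allI impI)
  fix Z assume "Z \<subseteq> Y'"
  then obtain A where "A \<in> F" "A \<inter> Y = Z"
    using assms unfolding shatters_def by blast
  then show "\<exists>A\<in>F. A \<inter> Y' = Z" using assms(2) \<open>Z \<subseteq> Y'\<close> by blast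
qed

text \<open>Pajor's form of the Sauer-Shelah lemma. Split \<open>F\<close> at a new point
  \<open>x\<close> into the members without \<open>x\<close> and the members with \<open>x\<close>,
  stripped of \<open>x\<close>. Whatever one half shatters, \<open>F\<close> shatters; whatever both
  halves shatter, \<open>F\<close> shatters even after \<open>x\<close> is added. The two supplies
  of shattered sets are disjoint and together account for both halves.\<close>

lemma card_le_card_shattered:
  assumes "finite X" "F \<subseteq> Pow X"
  shows "card F \<le> card {Y. Y \<subseteq> X \<and> shatters F Y}"
  using assms
proof (induction X arbitrary: F rule: finite_induct)
  case empty
  show ?case
  proof (cases "F = {}")
    case False
    with empty have "F = {{}}" by auto
    then have "{Y. Y \<subseteq> {} \<and> shatters F Y} = {{}}" by (auto simp: shatters_def)
    with \<open>F = {{}}\<close> show ?thesis by simp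
  qed simp
next
  case (insert x X)
  define F0 where "F0 = {A \<in> F. x \<notin> A}"
  define F1 where "F1 = {A. x \<notin> A \<and> insert x A \<in> F}"
  define s where "s H = {Y. Y \<subseteq> X \<and> shatters H Y}" for H
  have fin: "finite F" "finite F0" "finite F1"
    using insert by (auto simp: F0_def F1_def intro: finite_subset[OF _ finite_Pow_iff[THEN iffD2, OF \<open>finite X\<close>]] finite_subset[of F "Pow (insert x X)"])
  have "F = F0 \<union> insert x ` F1"
  proof
    show "F \<subseteq> F0 \<union> insert x ` F1"
    proof
      fix A assume "A \<in> F"
      show "A \<in> F0 \<union> insert x ` F1"
      proof (cases "x \<in> A")
        case True
        then have "A - {x} \<in> F1" "A = insert x (A - {x})"
          using \<open>A \<in> F\<close> by (auto simp: F1_def insert_absorb)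
        then show ?thesis by blast
      qed (use \<open>A \<in> F\<close> in \<open>auto simp: F0_def\<close>)
    qed
  qed (auto simp: F0_def F1_def)
  moreover have "F0 \<inter> insert x ` F1 = {}" by (auto simp: F0_def)
  moreover have "inj_on (insert x) F1" by (auto simp: F1_def inj_on_def)
  ultimately have "card F = card F0 + card F1"
    using fin by (metis card_Un_disjoint card_image finite_imageI)
  also have "\<dots> \<le> card (s F0) + card (s F1)"
    unfolding s_def using insert
    by (intro add_mono insert.IH) (auto simp: F0_def F1_def)
  also have "\<dots> = card (s F0 \<union> s F1) + card (s F0 \<inter> s F1)"
    by (rule card_Un_Int) (auto simp: s_def intro: finite_subset[OF _ finite_Pow_iff[THEN iffD2, OF \<open>finite X\<close>]])
  also have "\<dots> = card (s F0 \<union> s F1) + card (insert x ` (s F0 \<inter> s F1))"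
    using insert.hyps by (subst card_image) (auto simp: s_def inj_on_def)
  also have "\<dots> = card ((s F0 \<union> s F1) \<union> insert x ` (s F0 \<inter> s F1))"
    using insert.hyps
    by (subst card_Un_disjoint) (auto simp: s_def intro: finite_subset[OF _ finite_Pow_iff[THEN iffD2, OF \<open>finite X\<close>]])
  also have "\<dots> \<le> card {Y. Y \<subseteq> insert x X \<and> shatters F Y}"
  proof (rule card_mono)
    show "finite {Y. Y \<subseteq> insert x X \<and> shatters F Y}" using insert.hyps by simp
    have 0: "Y \<subseteq> X \<Longrightarrow> shatters F0 Y \<Longrightarrow> shatters F Y" for Y
      unfolding shatters_def F0_def by blast
    have 1: "shatters F Y" if Y1: "Y \<subseteq> X" "shatters F1 Y" for Y
      unfolding shatters_def
    proof (intro allI impI)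
      fix Z assume "Z \<subseteq> Y"
      then obtain A where "A \<in> F1" "A \<inter> Y = Z" using Y1 unfolding shatters_def by blast
      then show "\<exists>A\<in>F. A \<inter> Y = Z"
        using Y1 insert.hyps by (intro bexI[of _ "insert x A"]) (auto simp: F1_def)
    qed
    have 2: "shatters F (insert x Y)" if Y1: "Y \<subseteq> X" "shatters F1 Y" "shatters F0 Y" for Y
      unfolding shatters_def
    proof (intro allI impI)
      fix Z assume Z: "Z \<subseteq> insert x Y"
      show "\<exists>A\<in>F. A \<inter> insert x Y = Z"
      proof (cases "x \<in> Z")
        case True
        from Z have "Z - {x} \<subseteq> Y" by blast
        then obtain A where "A \<in> F1" "A \<inter> Y = Z - {x}" using Y1 unfolding shatters_def by blast
        then show ?thesis using True
          by (intro bexI[of _ "insert x A"]) (auto simp: F1_def)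
      next
        case False
        with Z have "Z \<subseteq> Y" by blast
        then obtain A where "A \<in> F0" "A \<inter> Y = Z" using Y1 unfolding shatters_def by blast
        then show ?thesis using False by (intro bexI[of _ A]) (auto simp: F0_def)
      qed
    qed
    show "(s F0 \<union> s F1) \<union> insert x ` (s F0 \<inter> s F1) \<subseteq> {Y. Y \<subseteq> insert x X \<and> shatters F Y}"
      using 0 1 2 by (auto simp: s_def)
  qed
  finally show ?case .
qed

text \<open>Such a set can be written into \<open>m\<close> slots, each holding a point of
  \<open>X\<close> or \<open>None\<close>. This crude count replaces the sum of binomial
  coefficients and is still polynomial in the size of \<open>X\<close>.\<close>

lemma card_small_subsets:
  assumes "finite X"
  shows "card {Y. Y \<subseteq> X \<and> card Y < m} \<le> (card X + 1) ^ m"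
proof -
  define f :: "(nat \<Rightarrow> 'a option) \<Rightarrow> 'a set" where "f g = {y. \<exists>i<m. g i = Some y}" for g
  let ?O = "PiE {..<m} (\<lambda>_. insert None (Some ` X))"
  have fin: "finite ?O" using assms by (intro finite_PiE) auto
  have "{Y. Y \<subseteq> X \<and> card Y < m} \<subseteq> f ` ?O"
  proof
    fix Y assume "Y \<in> {Y. Y \<subseteq> X \<and> card Y < m}"
    then have Y: "Y \<subseteq> X" "card Y < m" by auto
    then have "finite Y" using assms finite_subset by blast
    then obtain h where h: "bij_betw h {..<card Y} Y"
      using ex_bij_betw_nat_finite lessThan_atLeast0 by metis
    define g where "g = (\<lambda>i. if i < m then (if i < card Y then Some (h i) else None) else undefined)"
    have "h i \<in> X" if "i < card Y" for i
      using h Y(1) that by (auto simp: bij_betw_def)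
    then have "g \<in> ?O" by (auto simp: g_def PiE_def extensional_def)
    moreover have "f g = Y"
    proof -
      have "f g = h ` {..<card Y}" using Y by (auto simp: f_def g_def split: if_splits)
      then show ?thesis using h by (simp add: bij_betw_def)
    qed
    ultimately show "Y \<in> f ` ?O" by blast
  qed
  then have "card {Y. Y \<subseteq> X \<and> card Y < m} \<le> card (f ` ?O)"
    using fin by (intro card_mono) auto
  also have "\<dots> \<le> card ?O" using fin by (rule card_image_le)
  also have "\<dots> = (card X + 1) ^ m"
    using assms by (simp add: card_PiE card_image card_insert_if image_iff)
  finally show ?thesis .
qed

text \<open>With \<open>N + 1 = 2 ^ p\<close> the claim becomes \<open>p * k < 2 ^ p - 1\<close>,
  and \<open>p = 2 * q\<close> achieves this because \<open>2 * q \<le> 2 ^ q\<close>.\<close>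

lemma ex_power_lt_two_power: "\<exists>N::nat. (N + 1) ^ k < 2 ^ N"
proof -
  define q where "q = k + 2"
  have two: "2 * n \<le> 2 ^ n" if "n \<ge> 1" for n :: nat
    using that by (induction n rule: dec_induct) auto
  define p where "p = 2 * q"
  have "p * k + 1 < (2 * q) * (2 * q)" by (simp add: p_def q_def algebra_simps)
  also have "\<dots> \<le> 2 ^ q * 2 ^ q" using two[of q] by (intro mult_mono) (auto simp: q_def)
  also have "\<dots> = 2 ^ p" by (simp add: p_def power_add[symmetric] mult_2)
  finally have "p * k + 1 < 2 ^ p" .
  then have "(2::nat) ^ (p * k) < 2 ^ (2 ^ p - 1)" by (intro power_strict_increasing) auto
  then have "((2 ^ p - 1) + 1) ^ k < (2::nat) ^ (2 ^ p - 1)" by (simp add: power_mult)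
  then show ?thesis by blast
qed

section \<open>Traces of sets of valuations and NIP\<close>

definition splice_val :: "nat set \<Rightarrow> (nat \<Rightarrow> 'v) \<Rightarrow> (nat \<Rightarrow> 'v) \<Rightarrow> nat \<Rightarrow> 'v" where
  "splice_val X a b = (\<lambda>z. if z \<in> X then a z else b z)"

definition shatters_val :: "'v set \<Rightarrow> (nat \<Rightarrow> 'v) set \<Rightarrow> nat set \<Rightarrow> nat \<Rightarrow> bool" where
  "shatters_val V S X n \<longleftrightarrow>
     (\<exists>(a :: nat \<Rightarrow> nat \<Rightarrow> 'v) (b :: nat set \<Rightarrow> nat \<Rightarrow> 'v).
        (\<forall>i. range (a i) \<subseteq> V) \<and> (\<forall>I. range (b I) \<subseteq> V) \<and>
        (\<forall>i<n. \<forall>I\<subseteq>{..<n}. splice_val X (a i) (b I) \<in> S \<longleftrightarrow> i \<in> I))"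

lemma shatters_valE:
  assumes "shatters_val V S X n"
  obtains a b where "\<And>i. range (a i) \<subseteq> V" "\<And>I. range (b I) \<subseteq> V"
    "\<And>i I. i < n \<Longrightarrow> I \<subseteq> {..<n} \<Longrightarrow> splice_val X (a i) (b I) \<in> S \<longleftrightarrow> i \<in> I"
proof -
  from assms obtain a b where *: "(\<forall>i. range (a i) \<subseteq> V) \<and> (\<forall>I. range (b I) \<subseteq> V) \<and>
      (\<forall>i<n. \<forall>I\<subseteq>{..<n}. splice_val X (a i) (b I) \<in> S \<longleftrightarrow> i \<in> I)"
    unfolding shatters_val_def by (elim exE)
  show ?thesis by (rule that[of a b]) (simp_all add: *)
qed

text \<open>The negation of \<open>has_IP\<close> with a set of valuations in place of a formula.
  All partitions \<open>X\<close> of the variables are included because the reduction to the reduct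
  changes the partition.\<close>

definition nip_set :: "'v set \<Rightarrow> (nat \<Rightarrow> 'v) set \<Rightarrow> bool" where
  "nip_set V S \<longleftrightarrow> (\<forall>X. \<exists>n. \<not> shatters_val V S X n)"

lemma shatters_valI:
  assumes "\<And>i. range (a i) \<subseteq> V" "\<And>b. b \<in> B \<Longrightarrow> range b \<subseteq> V" "finite Y" "card Y = m" "B \<noteq> {}"
    and "shatters ((\<lambda>b. {i. splice_val X (a i) b \<in> S}) ` B) Y"
  shows "shatters_val V S X m"
proof -
  obtain h where h: "bij_betw h {..<m} Y"
    using ex_bij_betw_nat_finite[OF assms(3)] assms(4) lessThan_atLeast0 by metis
  \<comment> \<open>The family of parameters must be total, so index sets outside
    \<open>{..<m}\<close> receive an arbitrary member of \<open>B\<close>; this is why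
    \<open>B\<close> has to be nonempty.\<close>
  have "\<forall>I. \<exists>b. b \<in> B \<and> (I \<subseteq> {..<m} \<longrightarrow> {i. splice_val X (a i) b \<in> S} \<inter> Y = h ` I)"
  proof
    fix I
    show "\<exists>b. b \<in> B \<and> (I \<subseteq> {..<m} \<longrightarrow> {i. splice_val X (a i) b \<in> S} \<inter> Y = h ` I)"
    proof (cases "I \<subseteq> {..<m}")
      case True
      then have "h ` I \<subseteq> Y" using h by (auto simp: bij_betw_def)
      then show ?thesis using assms(6) unfolding shatters_def by blast
    qed (use assms(5) in auto)
  qed
  then obtain \<beta> where \<beta>: "\<And>I. \<beta> I \<in> B"
    "\<And>I. I \<subseteq> {..<m} \<Longrightarrow> {i. splice_val X (a i) (\<beta> I) \<in> S} \<inter> Y = h ` I"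
    by metis
  show ?thesis
    unfolding shatters_val_def
  proof (intro exI[of _ "\<lambda>i. a (h i)"] exI[of _ \<beta>] conjI allI impI)
    fix i I assume iI: "i < m" "I \<subseteq> {..<m}"
    have "h i \<in> Y" using h iI by (auto simp: bij_betw_def)
    then have "splice_val X (a (h i)) (\<beta> I) \<in> S \<longleftrightarrow> h i \<in> h ` I"
      using \<beta>(2)[OF iI(2)] by blast
    also have "\<dots> \<longleftrightarrow> i \<in> I"
      using h iI by (meson bij_betw_def inj_on_image_mem_iff lessThan_iff)
    finally show "splice_val X (a (h i)) (\<beta> I) \<in> S \<longleftrightarrow> i \<in> I" .
  qed (use assms \<beta> in auto)
qed

text \<open>The traces shatter no \<open>m\<close> of the \<open>N\<close> points, so by
  Sauer-Shelah there are at most as many traces as subsets with fewer than \<open>m\<close>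
  points.\<close>

lemma card_traces_le:
  assumes "\<not> shatters_val V S X m" "\<And>i. range (a i) \<subseteq> V" "\<And>b. b \<in> B \<Longrightarrow> range b \<subseteq> V"
  shows "card ((\<lambda>b. {i. i < N \<and> splice_val X (a i) b \<in> S}) ` B) \<le> (N + 1) ^ m"
proof (cases "B = {}")
  case False
  let ?F = "(\<lambda>b. {i. i < N \<and> splice_val X (a i) b \<in> S}) ` B"
  have "card ?F \<le> card {Y. Y \<subseteq> {..<N} \<and> shatters ?F Y}"
    by (rule card_le_card_shattered) auto
  also have "\<dots> \<le> card {Y. Y \<subseteq> {..<N} \<and> card Y < m}"
  proof (rule card_mono)
    show "{Y. Y \<subseteq> {..<N} \<and> shatters ?F Y} \<subseteq> {Y. Y \<subseteq> {..<N} \<and> card Y < m}"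
    proof clarify
      fix Y assume Y: "Y \<subseteq> {..<N}" "shatters ?F Y"
      show "card Y < m"
      proof (rule ccontr)
        assume "\<not> card Y < m"
        then obtain Y' where Y': "Y' \<subseteq> Y" "card Y' = m" "finite Y'"
          using Y(1) by (metis not_less obtain_subset_with_card_n)
        have "shatters ?F Y'" using Y(2) Y'(1) by (rule shatters_subset)
        then have "shatters ((\<lambda>b. {i. splice_val X (a i) b \<in> S}) ` B) Y'"
          unfolding shatters_def
        proof (intro allI impI)
          fix Z assume *: "\<forall>Z\<subseteq>Y'. \<exists>A\<in>?F. A \<inter> Y' = Z" and "Z \<subseteq> Y'"
          then obtain b where "b \<in> B" "{i. i < N \<and> splice_val X (a i) b \<in> S} \<inter> Y' = Z"
            by blast
          then show "\<exists>A\<in>(\<lambda>b. {i. splice_val X (a i) b \<in> S}) ` B. A \<inter> Y' = Z"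
            using Y(1) Y'(1) by (intro bexI[of _ "{i. splice_val X (a i) b \<in> S}"]) auto
        qed
        then show False
          using shatters_valI[of a V B Y' m X S, OF assms(2,3) Y'(3,2) False] assms(1) by blast
      qed
    qed
  qed simp
  also have "\<dots> \<le> (N + 1) ^ m" using card_small_subsets[of "{..<N}" m] by simp
  finally show ?thesis .
qed simp

text \<open>A trace of the intersection is the intersection of a trace of \<open>S\<close> and a
  trace of \<open>S'\<close>. Polynomially many pairs of traces cannot produce all
  \<open>2 ^ N\<close> subsets of \<open>N\<close> points.\<close>

lemma nip_set_Int:
  assumes "nip_set V S" "nip_set V S'"
  shows "nip_set V (S \<inter> S')"
  unfolding nip_set_def
proof (rule allI, rule ccontr)
  fix X assume "\<nexists>n. \<not> shatters_val V (S \<inter> S') X n"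
  then have all: "shatters_val V (S \<inter> S') X n" for n by blast
  obtain m m' where m: "\<not> shatters_val V S X m" "\<not> shatters_val V S' X m'"
    using assms unfolding nip_set_def by blast
  obtain N :: nat where N: "(N + 1) ^ (m + m') < 2 ^ N" using ex_power_lt_two_power by blast
  obtain a b where ab: "\<And>i. range (a i) \<subseteq> V" "\<And>I. range (b I) \<subseteq> V"
    "\<And>i I. i < N \<Longrightarrow> I \<subseteq> {..<N} \<Longrightarrow> splice_val X (a i) (b I) \<in> S \<inter> S' \<longleftrightarrow> i \<in> I"
    using all[of N] by (rule shatters_valE) (rule that; assumption)
  define tr where "tr Q c = {i. i < N \<and> splice_val X (a i) c \<in> Q}" for Q c
  have le: "card (tr S ` range b) \<le> (N + 1) ^ m" "card (tr S' ` range b) \<le> (N + 1) ^ m'"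
    unfolding tr_def
    by (rule card_traces_le[OF m(1)] card_traces_le[OF m(2)]; use ab(1,2) in blast)+
  have fin: "finite (tr Q ` B)" for Q B
    by (rule finite_subset[of _ "Pow {..<N}"]) (auto simp: tr_def)
  have "Pow {..<N} \<subseteq> (\<lambda>(A, B). A \<inter> B) ` (tr S ` range b \<times> tr S' ` range b)"
  proof
    fix I assume "I \<in> Pow {..<N}"
    then have "I = tr S (b I) \<inter> tr S' (b I)" using ab(3)[of _ I] by (auto simp: tr_def)
    then show "I \<in> (\<lambda>(A, B). A \<inter> B) ` (tr S ` range b \<times> tr S' ` range b)"
      by (intro image_eqI[of _ _ "(tr S (b I), tr S' (b I))"]) auto
  qed
  then have "card (Pow {..<N}) \<le> card (tr S ` range b \<times> tr S' ` range b)"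
    using fin by (meson card_image_le card_mono finite_SigmaI finite_imageI le_trans)
  also have "\<dots> \<le> (N + 1) ^ m * (N + 1) ^ m'"
    unfolding card_cartesian_product using le by (rule mult_mono) auto
  finally show False using N by (simp add: card_Pow power_add)
qed

lemma range_splice_val: "range a \<subseteq> V \<Longrightarrow> range b \<subseteq> V \<Longrightarrow> range (splice_val X a b) \<subseteq> V"
  unfolding splice_val_def by auto

lemma nip_set_Compl:
  assumes "nip_set V S"
  shows "nip_set V ({v. range v \<subseteq> V} - S)"
  unfolding nip_set_def
proof (rule allI)
  fix X
  obtain n where n: "\<not> shatters_val V S X n" using assms unfolding nip_set_def by blast
  have "\<not> shatters_val V ({v. range v \<subseteq> V} - S) X n"
  proof
    assume "shatters_val V ({v. range v \<subseteq> V} - S) X n"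
    then obtain a b where ab: "\<And>i. range (a i) \<subseteq> V" "\<And>I. range (b I) \<subseteq> V"
      "\<And>i I. i < n \<Longrightarrow> I \<subseteq> {..<n} \<Longrightarrow>
         splice_val X (a i) (b I) \<in> {v. range v \<subseteq> V} - S \<longleftrightarrow> i \<in> I"
      by (rule shatters_valE) (rule that; assumption)
    \<comment> \<open>Parameters that cut out an index set by means of the complement cut out the
      complementary index set by means of \<open>S\<close>.\<close>
    have "\<forall>i<n. \<forall>I\<subseteq>{..<n}. splice_val X (a i) (b ({..<n} - I)) \<in> S \<longleftrightarrow> i \<in> I"
    proof (intro allI impI)
      fix i I assume "i < n" "I \<subseteq> {..<n}"
      then show "splice_val X (a i) (b ({..<n} - I)) \<in> S \<longleftrightarrow> i \<in> I"
        using ab(3)[of i "{..<n} - I"]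
          range_splice_val[OF ab(1)[of i] ab(2)[of "{..<n} - I"], of X] by auto
    qed
    then have "shatters_val V S X n"
      unfolding shatters_val_def using ab(1,2)
      by (intro exI[of _ a] exI[of _ "\<lambda>I. b ({..<n} - I)"]) auto
    with n show False by blast
  qed
  then show "\<exists>n. \<not> shatters_val V ({v. range v \<subseteq> V} - S) X n" by blast
qed

section \<open>Coverings by cosets\<close>

definition subgrp :: "'v::ab_group_add set \<Rightarrow> bool" where
  "subgrp H \<longleftrightarrow> 0 \<in> H \<and> (\<forall>a\<in>H. \<forall>b\<in>H. a - b \<in> H)"

definition cst :: "'v::ab_group_add \<Rightarrow> 'v set \<Rightarrow> 'v set" where
  "cst a K = {x. x - a \<in> K}"

text \<open>\<open>K\<close> need not lie in \<open>H\<close>: for subgroups the condition says that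
  \<open>H \<inter> K\<close> has finite index in \<open>H\<close>.\<close>

definition fin_index :: "'v::ab_group_add set \<Rightarrow> 'v set \<Rightarrow> bool" where
  "fin_index H K \<longleftrightarrow> (\<exists>F. finite F \<and> H \<subseteq> (\<Union>f\<in>F. cst f K))"

lemma subgrp_zero: "subgrp H \<Longrightarrow> 0 \<in> H"
  and subgrp_diff: "subgrp H \<Longrightarrow> a \<in> H \<Longrightarrow> b \<in> H \<Longrightarrow> a - b \<in> H"
  by (auto simp: subgrp_def)

lemma subgrp_uminus: "subgrp H \<Longrightarrow> a \<in> H \<Longrightarrow> - a \<in> H"
  using subgrp_diff[of H 0 a] subgrp_zero[of H] by simp

lemma subgrp_add: "subgrp H \<Longrightarrow> a \<in> H \<Longrightarrow> b \<in> H \<Longrightarrow> a + b \<in> H"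
  using subgrp_diff[of H a "- b"] subgrp_uminus[of H b] by simp

lemma subgrp_Int: "subgrp H \<Longrightarrow> subgrp K \<Longrightarrow> subgrp (H \<inter> K)"
  by (auto simp: subgrp_def)

lemma subgrp_INT: "(\<And>i. i \<in> I \<Longrightarrow> subgrp (K i)) \<Longrightarrow> subgrp (\<Inter>i\<in>I. K i)"
  by (auto simp: subgrp_def)

lemma cst_eqI:
  assumes "subgrp K" "x - y \<in> K"
  shows "cst x K = cst y K"
proof -
  have "z - x \<in> K \<longleftrightarrow> z - y \<in> K" for z
    using subgrp_add[OF assms(1), of "z - x" "x - y"] subgrp_diff[OF assms(1), of "z - y" "x - y"]
      assms(2) by auto
  then show ?thesis by (simp add: cst_def)
qed

lemma fin_index_refl: "fin_index H H"
  unfolding fin_index_def by (intro exI[of _ "{0}"]) (auto simp: cst_def)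

lemma fin_index_trans:
  assumes "fin_index H K" "fin_index K L"
  shows "fin_index H L"
proof -
  obtain F E where F: "finite F" "H \<subseteq> (\<Union>f\<in>F. cst f K)"
    and E: "finite E" "K \<subseteq> (\<Union>f\<in>E. cst f L)"
    using assms unfolding fin_index_def by blast
  have "H \<subseteq> (\<Union>f\<in>(\<lambda>(f, e). f + e) ` (F \<times> E). cst f L)"
  proof
    fix h assume "h \<in> H"
    then obtain f where f: "f \<in> F" "h - f \<in> K" using F by (auto simp: cst_def)
    then obtain e where e: "e \<in> E" "h - f - e \<in> L" using E by (auto simp: cst_def)
    then have "h \<in> cst (f + e) L" by (simp add: cst_def algebra_simps)
    with f e show "h \<in> (\<Union>f\<in>(\<lambda>(f, e). f + e) ` (F \<times> E). cst f L)" by auto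
  qed
  with F E show ?thesis unfolding fin_index_def
    by (intro exI[of _ "(\<lambda>(f, e). f + e) ` (F \<times> E)"]) auto
qed

lemma fin_index_Int:
  assumes "fin_index H A" "fin_index H B" "subgrp A" "subgrp B"
  shows "fin_index H (A \<inter> B)"
proof -
  obtain F E where F: "finite F" "H \<subseteq> (\<Union>f\<in>F. cst f A)"
    and E: "finite E" "H \<subseteq> (\<Union>f\<in>E. cst f B)"
    using assms unfolding fin_index_def by blast
  \<comment> \<open>One representative for each nonempty intersection of a coset of \<open>A\<close>
    with a coset of \<open>B\<close>; on empty intersections the arbitrary value does no
    harm.\<close>
  define c where "c p = (SOME x. x \<in> cst (fst p) A \<and> x \<in> cst (snd p) B)" for p
  have "H \<subseteq> (\<Union>f\<in>c ` (F \<times> E). cst f (A \<inter> B))"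
  proof
    fix h assume "h \<in> H"
    then obtain f e where fe: "f \<in> F" "h \<in> cst f A" "e \<in> E" "h \<in> cst e B" using F E by blast
    then have "\<exists>x. x \<in> cst (fst (f, e)) A \<and> x \<in> cst (snd (f, e)) B" by auto
    then have "c (f, e) \<in> cst (fst (f, e)) A \<and> c (f, e) \<in> cst (snd (f, e)) B"
      unfolding c_def by (rule someI_ex)
    then have "h - c (f, e) \<in> A" "h - c (f, e) \<in> B"
      using fe subgrp_diff[OF assms(3), of "h - f" "c (f, e) - f"]
        subgrp_diff[OF assms(4), of "h - e" "c (f, e) - e"] by (auto simp: cst_def)
    then have "h \<in> cst (c (f, e)) (A \<inter> B)" by (simp add: cst_def)
    with fe show "h \<in> (\<Union>f\<in>c ` (F \<times> E). cst f (A \<inter> B))" by blast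
  qed
  with F E show ?thesis unfolding fin_index_def
    by (intro exI[of _ "c ` (F \<times> E)"]) auto
qed

lemma fin_index_INT:
  assumes "finite I" "\<And>i. i \<in> I \<Longrightarrow> subgrp (K i)" "\<And>i. i \<in> I \<Longrightarrow> fin_index H (K i)" "subgrp H"
  shows "fin_index H (H \<inter> (\<Inter>i\<in>I. K i))"
  using assms
proof (induction I rule: finite_induct)
  case (insert i I)
  have "fin_index H ((H \<inter> (\<Inter>i\<in>I. K i)) \<inter> K i)"
    by (rule fin_index_Int) (use insert in \<open>auto intro!: subgrp_Int subgrp_INT\<close>)
  then show ?case by (simp add: Int_ac)
qed (simp add: fin_index_refl)

text \<open>Induction on the number of subgroups in the cover. If \<open>K\<close> has infinite
  index, its finitely many cosets miss some \<open>b\<close> in \<open>H\<close>. The part of the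
  coset of \<open>b\<close> that lies in \<open>H\<close> is then covered by cosets of the other
  subgroups, and translates of these cover the part in \<open>H\<close> of every other coset of
  \<open>K\<close>; so \<open>K\<close> can be eliminated from the cover.\<close>

lemma neumann_fin_index:
  assumes "finite \<K>" "\<And>K. K \<in> \<K> \<Longrightarrow> subgrp K" "subgrp H" "finite C" "snd ` C \<subseteq> \<K>"
    "H \<subseteq> (\<Union>p\<in>C. cst (fst p) (snd p))"
  shows "\<exists>K\<in>\<K>. fin_index H K"
  using assms
proof (induction \<K> arbitrary: C rule: finite_induct)
  case empty
  then show ?case using subgrp_zero[of H] by auto
next
  case (insert K \<K>)
  show ?case
  proof (cases "fin_index H K")
    case False
    define F where "F = fst ` {p \<in> C. snd p = K}"
    define D where "D = {p \<in> C. snd p \<noteq> K}"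
    have "finite F" using insert.prems by (simp add: F_def)
    with False have "\<not> H \<subseteq> (\<Union>f\<in>F. cst f K)" unfolding fin_index_def by blast
    then obtain b where b: "b \<in> H" "\<And>f. f \<in> F \<Longrightarrow> b - f \<notin> K" by (auto simp: cst_def)
    define c where "c f = (SOME x. x \<in> H \<and> x - f \<in> K)" for f
    \<comment> \<open>Translation by \<open>c f - b\<close> carries the coset of \<open>b\<close>
      modulo \<open>K\<close> to the coset of \<open>f\<close>, of which \<open>c f\<close> is a
      representative in \<open>H\<close>.\<close>
    define E where "E = D \<union> (\<lambda>(p, f). (fst p - b + c f, snd p)) ` (D \<times> F)"
    have K: "subgrp K" and H: "subgrp H" using insert.prems by auto
    have split: "(\<exists>f\<in>F. x - f \<in> K) \<or> (\<exists>p\<in>D. x - fst p \<in> snd p)" if "x \<in> H" for x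
    proof -
      from that insert.prems(5) obtain a L where "(a, L) \<in> C" "x - a \<in> L" by (auto simp: cst_def)
      then show ?thesis by (cases "L = K") (auto simp: F_def D_def)
    qed
    have "H \<subseteq> (\<Union>p\<in>E. cst (fst p) (snd p))"
    proof
      fix h assume h: "h \<in> H"
      consider p where "p \<in> D" "h - fst p \<in> snd p" | f where "f \<in> F" "h - f \<in> K"
        using split[OF h] by blast
      then show "h \<in> (\<Union>p\<in>E. cst (fst p) (snd p))"
      proof cases
        case 1
        then show ?thesis by (auto simp: E_def cst_def)
      next
        case (2 f)
        then have "\<exists>x. x \<in> H \<and> x - f \<in> K" using h by blast
        then have c: "c f \<in> H" "c f - f \<in> K" unfolding c_def by (metis (mono_tags, lifting) someI_ex)+
        then have hc: "h - c f \<in> K" using subgrp_diff[OF K, of "h - f" "c f - f"] 2 by simp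
        have in_H: "b + (h - c f) \<in> H" by (intro subgrp_add subgrp_diff H b h c)
        have "b + (h - c f) - g \<notin> K" if "g \<in> F" for g
        proof
          assume "b + (h - c f) - g \<in> K"
          then have "b + (h - c f) - g - (h - c f) \<in> K" using hc K subgrp_diff by blast
          then show False using b(2)[OF that] by (simp add: algebra_simps)
        qed
        then obtain p where p: "p \<in> D" "b + (h - c f) - fst p \<in> snd p" using split[OF in_H] by blast
        then have "h \<in> cst (fst p - b + c f) (snd p)" by (simp add: cst_def algebra_simps)
        moreover have "(fst p - b + c f, snd p) \<in> E"
          using p 2 unfolding E_def by force
        ultimately show ?thesis by force
      qed
    qed
    moreover have "finite E" using insert.prems \<open>finite F\<close> by (simp add: E_def D_def)
    moreover have "snd ` E \<subseteq> \<K>" using insert.prems by (auto simp: E_def D_def)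
    ultimately have "\<exists>K\<in>\<K>. fin_index H K" using insert.prems by (intro insert.IH) auto
    then show ?thesis by blast
  qed blast
qed

text \<open>B. H. Neumann's lemma: in a finite cover of a coset by cosets, those of infinite index can
  be dropped.\<close>

lemma neumann_drop:
  assumes "subgrp H" "finite J" "\<And>i. i \<in> J \<Longrightarrow> subgrp (K i)"
    "\<And>i. i \<in> J \<Longrightarrow> A i = {} \<or> (\<exists>a. A i = cst a (K i))"
    "cst c H \<subseteq> (\<Union>i\<in>J. A i)"
  shows "cst c H \<subseteq> (\<Union>i\<in>{i \<in> J. fin_index H (K i)}. A i)"
proof
  fix x assume x: "x \<in> cst c H"
  define J0 where "J0 = {i \<in> J. fin_index H (K i)}"
  show "x \<in> (\<Union>i\<in>J0. A i)"
  proof (rule ccontr)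
    assume nx: "x \<notin> (\<Union>i\<in>J0. A i)"
    \<comment> \<open>As \<open>x\<close> is in none of the cosets with index in \<open>J0\<close>,
      neither is any point of \<open>x + K0\<close>. All of these are left to the cosets of infinite
      index, and one of the subgroups concerned would have finite index after all.\<close>
    define K0 where "K0 = H \<inter> (\<Inter>i\<in>J0. K i)"
    have K0: "subgrp K0" "fin_index H K0"
      unfolding K0_def using assms by (auto simp: J0_def intro!: subgrp_Int subgrp_INT fin_index_INT)
    define J1 where "J1 = {i \<in> J. i \<notin> J0 \<and> A i \<noteq> {}}"
    define a where "a i = (SOME a. A i = cst a (K i))" for i
    have a: "A i = cst (a i) (K i)" if "i \<in> J" "A i \<noteq> {}" for i
      using that assms(4)[of i] unfolding a_def by (metis (mono_tags, lifting) someI_ex)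
    have "K0 \<subseteq> (\<Union>p\<in>(\<lambda>i. (a i - x, K i)) ` J1. cst (fst p) (snd p))"
    proof
      fix y assume y: "y \<in> K0"
      have "x + y \<in> cst c H" using x y subgrp_add[OF assms(1), of "x - c" y]
        by (auto simp: cst_def K0_def algebra_simps)
      then obtain i where i: "i \<in> J" "x + y \<in> A i" using assms(5) by blast
      then have ai: "A i = cst (a i) (K i)" using a by blast
      have "i \<notin> J0"
      proof
        assume "i \<in> J0"
        then have "y \<in> K i" using y by (auto simp: K0_def)
        then have "x \<in> A i" using i(2) subgrp_diff[OF assms(3)[OF i(1)], of "x + y - a i" y]
          by (auto simp: ai cst_def algebra_simps)
        with nx \<open>i \<in> J0\<close> show False by blast
      qed
      then have "i \<in> J1" using i by (auto simp: J1_def)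
      moreover have "y \<in> cst (a i - x) (K i)" using i by (simp add: ai cst_def algebra_simps)
      ultimately show "y \<in> (\<Union>p\<in>(\<lambda>i. (a i - x, K i)) ` J1. cst (fst p) (snd p))" by auto
    qed
    moreover have "finite J1" "\<And>i. i \<in> J1 \<Longrightarrow> subgrp (K i)" using assms by (auto simp: J1_def)
    ultimately have "\<exists>K'\<in>K ` J1. fin_index K0 K'"
      using K0 by (intro neumann_fin_index[of _ _ "(\<lambda>i. (a i - x, K i)) ` J1"]) auto
    then obtain i where "i \<in> J1" "fin_index K0 (K i)" by blast
    with fin_index_trans[OF K0(2)] show False by (auto simp: J1_def J0_def)
  qed
qed

lemma card_Diff_UN_insert:
  assumes "finite C"
  shows "card (C - (\<Union>i\<in>insert j J. A i)) =
    card (C - (\<Union>i\<in>J. A i)) - card (C \<inter> A j - (\<Union>i\<in>J. A i))"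
proof -
  have "C - (\<Union>i\<in>insert j J. A i) = (C - (\<Union>i\<in>J. A i)) - (C \<inter> A j - (\<Union>i\<in>J. A i))" by auto
  also have "card \<dots> = card (C - (\<Union>i\<in>J. A i)) - card (C \<inter> A j - (\<Union>i\<in>J. A i))"
    using assms by (intro card_Diff_subset) auto
  finally show ?thesis .
qed

text \<open>Inclusion-exclusion without the alternating sum: taking one set \<open>A j\<close> off
  the union leaves two counts of the same kind, one for \<open>C\<close> and one for
  \<open>C \<inter> A j\<close>.\<close>

lemma card_Diff_UN_cong:
  assumes "finite J" "finite C" "finite C'"
    "\<And>I. I \<subseteq> J \<Longrightarrow> card (C \<inter> (\<Inter>i\<in>I. A i)) = card (C' \<inter> (\<Inter>i\<in>I. A' i))"
  shows "card (C - (\<Union>i\<in>J. A i)) = card (C' - (\<Union>i\<in>J. A' i))"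
  using assms
proof (induction J arbitrary: C C' rule: finite_induct)
  case empty
  then show ?case using empty.prems(3)[of "{}"] by simp
next
  case (insert j J)
  have 1: "card (C - (\<Union>i\<in>J. A i)) = card (C' - (\<Union>i\<in>J. A' i))"
    using insert.prems(1,2) insert.prems(3)[OF subset_trans[OF _ subset_insertI]]
    by (intro insert.IH)
  have 2: "card (C \<inter> A j - (\<Union>i\<in>J. A i)) = card (C' \<inter> A' j - (\<Union>i\<in>J. A' i))"
  proof (rule insert.IH)
    fix I assume "I \<subseteq> J"
    then have "insert j I \<subseteq> insert j J" by blast
    then show "card (C \<inter> A j \<inter> (\<Inter>i\<in>I. A i)) = card (C' \<inter> A' j \<inter> (\<Inter>i\<in>I. A' i))"
      using insert.prems(3)[of "insert j I"] by (simp add: Int_ac)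
  qed (use insert.prems in auto)
  show ?case using 1 2 insert.prems by (simp only: card_Diff_UN_insert)
qed

lemma cst_Int_eq:
  assumes "subgrp H" "subgrp K" "x \<in> cst a H \<inter> cst b K"
  shows "cst a H \<inter> cst b K = cst x (H \<inter> K)"
proof -
  have "y - a \<in> H \<longleftrightarrow> y - x \<in> H" if "x - a \<in> H" "subgrp H" for y a and H :: "'a set"
    using subgrp_add[OF that(2), of "y - x" "x - a"] subgrp_diff[OF that(2), of "y - a" "x - a"] that(1)
    by auto
  with assms show ?thesis by (auto simp: cst_def)
qed

lemma cst_INT_eq:
  assumes "finite I" "subgrp H" "\<And>i. i \<in> I \<Longrightarrow> subgrp (K i)"
    "\<And>i. i \<in> I \<Longrightarrow> A i = {} \<or> (\<exists>a. A i = cst a (K i))"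
    "x \<in> cst c H \<inter> (\<Inter>i\<in>I. A i)"
  shows "cst c H \<inter> (\<Inter>i\<in>I. A i) = cst x (H \<inter> (\<Inter>i\<in>I. K i))"
  using assms
proof (induction I rule: finite_induct)
  case empty
  then show ?case using cst_Int_eq[of H H x c c] by simp
next
  case (insert i I)
  have IH: "cst c H \<inter> (\<Inter>i\<in>I. A i) = cst x (H \<inter> (\<Inter>i\<in>I. K i))"
    using insert by (intro insert.IH) auto
  obtain a where a: "A i = cst a (K i)" using insert.prems(3)[of i] insert.prems(4) by auto
  have "cst c H \<inter> (\<Inter>i\<in>insert i I. A i) = cst x (H \<inter> (\<Inter>i\<in>I. K i)) \<inter> cst a (K i)"
    using IH a by auto
  also have "\<dots> = cst x ((H \<inter> (\<Inter>i\<in>I. K i)) \<inter> K i)"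
    using insert.prems IH a by (intro cst_Int_eq subgrp_Int subgrp_INT) auto
  finally show ?case by (simp add: Int_ac)
qed

text \<open>Translation by \<open>d' - d\<close> matches the cosets of \<open>K0\<close> met by the
  two cosets of \<open>L\<close>.\<close>

lemma card_cst_image:
  "card ((\<lambda>a. cst a K0) ` cst d L) = card ((\<lambda>a. cst a K0) ` cst d' L)"
proof -
  have le: "card ((\<lambda>a. cst a K0) ` cst d' L) = card (((`) ((+) (d' - d))) ` (\<lambda>a. cst a K0) ` cst d L)"
    for d d' :: 'a
  proof -
    have tr: "(+) (d' - d) ` cst a K0 = cst (a + (d' - d)) K0" for a
    proof (intro equalityI subsetI)
      fix x assume "x \<in> cst (a + (d' - d)) K0"
      then have "x - (d' - d) \<in> cst a K0" by (simp add: cst_def algebra_simps)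
      then show "x \<in> (+) (d' - d) ` cst a K0" by (intro image_eqI[of _ _ "x - (d' - d)"]) auto
    qed (auto simp: cst_def algebra_simps)
    have "cst d' L = (\<lambda>a. a + (d' - d)) ` cst d L"
    proof (intro equalityI subsetI)
      fix x assume "x \<in> cst d' L"
      then show "x \<in> (\<lambda>a. a + (d' - d)) ` cst d L"
        by (intro image_eqI[of _ _ "x - (d' - d)"]) (auto simp: cst_def)
    qed (auto simp: cst_def algebra_simps)
    then show ?thesis by (simp add: image_image tr)
  qed
  have "inj_on ((`) ((+) (d' - d))) B" for B
    by (rule inj_on_subset[of _ UNIV]) (auto simp: inj_image_eq_iff inj_on_def)
  then show ?thesis using le[of d' d] by (simp add: card_image)
qed

text \<open>After dropping the cosets of infinite index, whether the remaining ones cover can be read off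
  from the numbers of cosets of a common subgroup of finite index in their intersections.\<close>

lemma cover_transfer:
  assumes H: "subgrp H" and J: "finite J" and K: "\<And>i. i \<in> J \<Longrightarrow> subgrp (K i)"
    and A: "\<And>i. i \<in> J \<Longrightarrow> A i = {} \<or> (\<exists>a. A i = cst a (K i))"
    and A': "\<And>i. i \<in> J \<Longrightarrow> A' i = {} \<or> (\<exists>a. A' i = cst a (K i))"
    and pat: "\<And>I. I \<subseteq> J \<Longrightarrow> cst c H \<inter> (\<Inter>i\<in>I. A i) = {} \<longleftrightarrow> cst c' H \<inter> (\<Inter>i\<in>I. A' i) = {}"
    and cov: "cst c H \<subseteq> (\<Union>i\<in>J. A i)"
  shows "cst c' H \<subseteq> (\<Union>i\<in>J. A' i)"
proof -
  define J0 where "J0 = {i \<in> J. fin_index H (K i)}"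
  have J0: "finite J0" "J0 \<subseteq> J" using J by (auto simp: J0_def)
  have cov0: "cst c H \<subseteq> (\<Union>i\<in>J0. A i)"
    unfolding J0_def by (rule neumann_drop[OF H J K A cov])
  \<comment> \<open>Modulo \<open>K0\<close> everything is finite: a coset of \<open>H\<close> has
    finitely many classes, and each \<open>A i\<close> and \<open>A' i\<close> with \<open>i\<close>
    in \<open>J0\<close> is a union of classes.\<close>
  define K0 where "K0 = H \<inter> (\<Inter>i\<in>J0. K i)"
  have K0: "subgrp K0" "fin_index H K0"
    unfolding K0_def using K H J0 by (auto simp: J0_def intro!: subgrp_Int subgrp_INT fin_index_INT)
  define q where "q = (\<lambda>a. cst a K0)"
  have q_eq: "x - y \<in> K0" if "q x = q y" for x y
  proof -
    have "x \<in> q x" using subgrp_zero[OF K0(1)] by (simp add: q_def cst_def)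
    with that show ?thesis by (simp add: q_def cst_def)
  qed
  have q_mem: "x \<in> B" if B: "B = {} \<or> (\<exists>a. B = cst a L)" "subgrp L" "K0 \<subseteq> L" and qx: "q x \<in> q ` B" for x B L
  proof -
    from qx obtain y where y: "y \<in> B" "q x = q y" by blast
    with B obtain a where a: "B = cst a L" by blast
    have "x - y \<in> L" using q_eq y B(3) by blast
    then show ?thesis using subgrp_add[OF B(2), of "x - y" "y - a"] y by (simp add: a cst_def)
  qed
  have K0_le: "K0 \<subseteq> H" "\<And>i. i \<in> J0 \<Longrightarrow> K0 \<subseteq> K i" by (auto simp: K0_def)
  have q_Int: "q ` cst d H \<inter> (\<Inter>i\<in>I. q ` B i) = q ` (cst d H \<inter> (\<Inter>i\<in>I. B i))"
    if I: "I \<subseteq> J0" and B: "\<And>i. i \<in> J \<Longrightarrow> B i = {} \<or> (\<exists>a. B i = cst a (K i))" for d I B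
  proof (intro equalityI subsetI)
    fix y assume y: "y \<in> q ` cst d H \<inter> (\<Inter>i\<in>I. q ` B i)"
    then obtain x where x: "x \<in> cst d H" "y = q x" by blast
    have "x \<in> B i" if "i \<in> I" for i
    proof -
      have i: "i \<in> J0" "i \<in> J" using that I J0(2) by auto
      have "q x \<in> q ` B i" using y x(2) that by simp
      then show ?thesis by (rule q_mem[OF B[OF i(2)] K[OF i(2)] K0_le(2)[OF i(1)]])
    qed
    with x show "y \<in> q ` (cst d H \<inter> (\<Inter>i\<in>I. B i))" by blast
  qed auto
  have fin: "finite (q ` cst d H)" for d
  proof -
    obtain F where F: "finite F" "H \<subseteq> (\<Union>f\<in>F. cst f K0)" using K0(2) unfolding fin_index_def by blast
    have "q ` cst d H \<subseteq> (\<lambda>f. q (f + d)) ` F"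
    proof
      fix y assume "y \<in> q ` cst d H"
      then obtain x where x: "x - d \<in> H" "y = q x" by (auto simp: cst_def)
      then obtain f where f: "f \<in> F" "x - d - f \<in> K0" using F by (auto simp: cst_def)
      then have "x - (f + d) \<in> K0" by (simp add: algebra_simps)
      then have "q x = q (f + d)" unfolding q_def by (rule cst_eqI[OF K0(1)])
      with x f show "y \<in> (\<lambda>f. q (f + d)) ` F" by blast
    qed
    with F(1) show ?thesis by (meson finite_imageI finite_subset)
  qed
  \<comment> \<open>The numbers of uncovered classes on both sides. Corresponding intersections are
    both empty or both cosets of the same subgroup, so they have equally many classes, and
    inclusion-exclusion does the rest.\<close>
  have "card (q ` cst c H - (\<Union>i\<in>J0. q ` A i)) = card (q ` cst c' H - (\<Union>i\<in>J0. q ` A' i))"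
  proof (rule card_Diff_UN_cong[OF J0(1) fin fin])
    fix I assume I: "I \<subseteq> J0"
    then have IJ: "I \<subseteq> J" using J0 by blast
    have finI: "finite I" using IJ J finite_subset by blast
    have "card (q ` (cst c H \<inter> (\<Inter>i\<in>I. A i))) = card (q ` (cst c' H \<inter> (\<Inter>i\<in>I. A' i)))"
    proof (cases "cst c H \<inter> (\<Inter>i\<in>I. A i) = {}")
      case True
      with pat[OF IJ] show ?thesis by simp
    next
      case False
      with pat[OF IJ] obtain x x' where x: "x \<in> cst c H \<inter> (\<Inter>i\<in>I. A i)" "x' \<in> cst c' H \<inter> (\<Inter>i\<in>I. A' i)"
        by blast
      have "cst c H \<inter> (\<Inter>i\<in>I. A i) = cst x (H \<inter> (\<Inter>i\<in>I. K i))"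
        using IJ by (intro cst_INT_eq finI H K A x) auto
      moreover have "cst c' H \<inter> (\<Inter>i\<in>I. A' i) = cst x' (H \<inter> (\<Inter>i\<in>I. K i))"
        using IJ by (intro cst_INT_eq finI H K A' x) auto
      ultimately show ?thesis unfolding q_def using card_cst_image by simp
    qed
    then show "card (q ` cst c H \<inter> (\<Inter>i\<in>I. q ` A i)) = card (q ` cst c' H \<inter> (\<Inter>i\<in>I. q ` A' i))"
      using q_Int[OF I A, of c] q_Int[OF I A', of c'] by simp
  qed
  moreover have "q ` cst c H - (\<Union>i\<in>J0. q ` A i) = {}" using cov0 by blast
  ultimately have "q ` cst c' H \<subseteq> (\<Union>i\<in>J0. q ` A' i)"
    using fin[of c'] by (metis Diff_eq_empty_iff card_0_eq card.empty finite_Diff)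
  then have "x \<in> (\<Union>i\<in>J0. A' i)" if x: "x \<in> cst c' H" for x
  proof -
    from x \<open>q ` cst c' H \<subseteq> _\<close> obtain i where i: "i \<in> J0" "q x \<in> q ` A' i" by blast
    then have iJ: "i \<in> J" using J0 by blast
    have "x \<in> A' i" by (rule q_mem[OF A'[OF iJ] K[OF iJ] K0_le(2)[OF i(1)] i(2)])
    with i show ?thesis by blast
  qed
  with J0 show ?thesis by blast
qed

section \<open>Primitive positive sets\<close>

definition rind :: "('k::field \<Rightarrow> 'v::ab_group_add \<Rightarrow> 'v) \<Rightarrow> 'k set \<Rightarrow> 'v list \<Rightarrow> bool" where
  "rind scl R b \<longleftrightarrow> (\<forall>q. (\<forall>i<length b. q i \<in> R) \<and> (\<Sum>i<length b. scl (q i) (b ! i)) = 0 \<longrightarrow>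
     (\<forall>i<length b. q i = 0))"

lemma
  assumes "is_subring R"
  shows subring_0: "0 \<in> R" and subring_1: "1 \<in> R"
    and subring_mult: "a \<in> R \<Longrightarrow> b \<in> R \<Longrightarrow> a * b \<in> R"
    and subring_uminus: "a \<in> R \<Longrightarrow> - a \<in> R"
proof -
  show 1: "1 \<in> R" and "a \<in> R \<Longrightarrow> b \<in> R \<Longrightarrow> a * b \<in> R"
    using assms by (auto simp: is_subring_def)
  have d: "a - b \<in> R" if "a \<in> R" "b \<in> R" for a b
    using assms that by (auto simp: is_subring_def)
  show 0: "0 \<in> R" using d[OF 1 1] by simp
  show "a \<in> R \<Longrightarrow> - a \<in> R" using d[OF 0, of a] by simp
qed

text \<open>A basis up to denominators of what \<open>b\<close> and \<open>u\<close> span. An entry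
  that is not independent of its predecessors comes with a relation in which its own coefficient is
  nonzero, and this coefficient is multiplied into the common denominator \<open>s\<close>.\<close>

lemma (in vector_space) rind_extend:
  assumes R: "is_subring R" and b: "rind scale R b"
  shows "\<exists>c s. rind scale R (b @ c) \<and> set c \<subseteq> set u \<and> s \<in> R \<and> s \<noteq> 0 \<and>
    (\<forall>y\<in>set u. \<exists>q. (\<forall>i. q i \<in> R) \<and> scale s y = (\<Sum>i<length (b @ c). scale (q i) ((b @ c) ! i)))"
proof (induction u)
  case Nil
  show ?case by (rule exI[of _ "[]"], rule exI[of _ 1]) (use R b in \<open>auto simp: subring_1\<close>)
next
  case (Cons y u)
  then obtain c s where cs: "rind scale R (b @ c)" "set c \<subseteq> set u" "s \<in> R" "s \<noteq> 0"
    and sp: "\<And>z. z \<in> set u \<Longrightarrow>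
      \<exists>q. (\<forall>i. q i \<in> R) \<and> scale s z = (\<Sum>i<length (b @ c). scale (q i) ((b @ c) ! i))"
    by blast
  define d where "d = b @ c"
  define n where "n = length d"
  have snoc: "(\<Sum>i<length (d @ [y]). scale (q i) ((d @ [y]) ! i)) = (\<Sum>i<n. scale (q i) (d ! i)) + scale (q n) y"
    for q by (simp add: n_def nth_append)
  show ?case
  proof (cases "rind scale R (d @ [y])")
    case True
    have "\<exists>q. (\<forall>i. q i \<in> R) \<and> scale s z = (\<Sum>i<length (d @ [y]). scale (q i) ((d @ [y]) ! i))"
      if z: "z \<in> set (y # u)" for z
    proof (cases "z = y")
      case True
      have "scale s z = (\<Sum>i<length (d @ [y]). scale (if i = n then s else 0) ((d @ [y]) ! i))"
        unfolding snoc using True by simp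
      then show ?thesis using cs(3) subring_0[OF R]
        by (intro exI[of _ "\<lambda>i. if i = n then s else 0"]) simp
    next
      case False
      with z sp[of z] obtain q where q: "\<forall>i. q i \<in> R" "scale s z = (\<Sum>i<n. scale (q i) (d ! i))"
        by (auto simp: n_def d_def)
      have "scale s z = (\<Sum>i<length (d @ [y]). scale (if i = n then 0 else q i) ((d @ [y]) ! i))"
        unfolding snoc q(2) by simp
      then show ?thesis using q(1) subring_0[OF R]
        by (intro exI[of _ "\<lambda>i. if i = n then 0 else q i"]) simp
    qed
    then show ?thesis
      using True cs by (intro exI[of _ "c @ [y]"] exI[of _ s]) (auto simp: d_def)
  next
    case False
    then obtain q where q: "\<And>i. i < Suc n \<Longrightarrow> q i \<in> R" "(\<Sum>i<n. scale (q i) (d ! i)) + scale (q n) y = 0"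
      and nz: "\<exists>i<Suc n. q i \<noteq> 0"
      unfolding rind_def snoc by (auto simp: n_def)
    have qn: "q n \<noteq> 0"
    proof
      assume "q n = 0"
      then have "(\<Sum>i<n. scale (q i) (d ! i)) = 0" using q(2) by simp
      then have "\<forall>i<n. q i = 0" using cs(1) q(1) unfolding rind_def d_def[symmetric] n_def by auto
      with nz \<open>q n = 0\<close> show False by (auto simp: less_Suc_eq)
    qed
    have y: "scale (q n) y = (\<Sum>i<n. scale (- q i) (d ! i))"
      using q(2) by (simp add: sum_negf add_eq_0_iff)
    have "\<exists>p. (\<forall>i. p i \<in> R) \<and> scale (s * q n) z = (\<Sum>i<n. scale (p i) (d ! i))"
      if z: "z \<in> set (y # u)" for z
    proof (cases "z = y")
      case True
      have "scale (s * q n) z = scale s (scale (q n) y)" using True by simp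
      also have "\<dots> = (\<Sum>i<n. scale (if i < n then - (s * q i) else 0) (d ! i))"
        unfolding y scale_sum_right by (intro sum.cong) auto
      finally show ?thesis using q(1) cs(3) R
        by (intro exI[of _ "\<lambda>i. if i < n then - (s * q i) else 0"])
          (auto simp: subring_0 subring_mult subring_uminus)
    next
      case False
      with z sp[of z] obtain p where p: "\<forall>i. p i \<in> R" "scale s z = (\<Sum>i<n. scale (p i) (d ! i))"
        by (auto simp: n_def d_def)
      have "scale (s * q n) z = scale (q n) (scale s z)" by (simp add: mult.commute)
      also have "\<dots> = (\<Sum>i<n. scale (q n * p i) (d ! i))" unfolding p(2) scale_sum_right by simp
      finally show ?thesis using q(1) p(1) R
        by (intro exI[of _ "\<lambda>i. q n * p i"]) (auto simp: subring_mult)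
    qed
    then show ?thesis
      using cs qn q(1)[of n] R by (intro exI[of _ c] exI[of _ "s * q n"])
        (auto simp: d_def[symmetric] n_def[symmetric] subring_mult)
  qed
qed

section \<open>Valuations, linear forms and finite supports\<close>

definition vals :: "'v set \<Rightarrow> (nat \<Rightarrow> 'v) set" where
  "vals V = {v. range v \<subseteq> V}"

definition lin :: "('k \<Rightarrow> 'v \<Rightarrow> 'v) \<Rightarrow> ('k \<times> nat) list \<Rightarrow> (nat \<Rightarrow> 'v) \<Rightarrow> 'v::comm_monoid_add" where
  "lin scl t v = (\<Sum>(c, i)\<leftarrow>t. scl c (v i))"

text \<open>Replaces a bound on the free variables: a set of valuations has no syntax, yet fresh
  variables must still be available.\<close>

definition dep :: "'v set \<Rightarrow> (nat \<Rightarrow> 'v) set \<Rightarrow> nat \<Rightarrow> bool" where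
  "dep V S N \<longleftrightarrow> (\<forall>v\<in>vals V. \<forall>w\<in>vals V. (\<forall>i<N. v i = w i) \<longrightarrow> v \<in> S \<longrightarrow> w \<in> S)"

lemma depD:
  assumes "dep V S N" "v \<in> vals V" "w \<in> vals V" "\<And>i. i < N \<Longrightarrow> v i = w i"
  shows "v \<in> S \<longleftrightarrow> w \<in> S"
proof
  show "v \<in> S \<Longrightarrow> w \<in> S"
    by (rule assms(1)[unfolded dep_def, rule_format, OF assms(2-4)])
  show "w \<in> S \<Longrightarrow> v \<in> S"
    by (rule assms(1)[unfolded dep_def, rule_format, OF assms(3,2) assms(4)[symmetric]])
qed

lemma dep_mono:
  assumes "dep V S N" "N \<le> N'"
  shows "dep V S N'"
  unfolding dep_def
proof (intro ballI impI)
  fix v w assume a: "v \<in> vals V" "w \<in> vals V" "\<forall>i<N'. v i = w i" "v \<in> S"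
  have "v i = w i" if "i < N" for i using that assms(2) a(3) by simp
  from depD[OF assms(1) a(1,2) this] a(4) show "w \<in> S" by simp
qed

lemma dep_Int:
  assumes "dep V S N" "dep V S' N'"
  shows "dep V (S \<inter> S') (max N N')"
  unfolding dep_def
proof (intro ballI impI)
  fix v w assume a: "v \<in> vals V" "w \<in> vals V" "\<forall>i<max N N'. v i = w i" "v \<in> S \<inter> S'"
  have "v i = w i" if "i < N" for i using that a(3) by simp
  from depD[OF assms(1) a(1,2) this] have "w \<in> S" using a(4) by simp
  have "v i = w i" if "i < N'" for i using that a(3) by simp
  from depD[OF assms(2) a(1,2) this] have "w \<in> S'" using a(4) by simp
  with \<open>w \<in> S\<close> show "w \<in> S \<inter> S'" by simp
qed

lemma lin_Nil [simp]: "lin scl [] v = 0"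
  and lin_Cons: "lin scl ((c, i) # t) v = scl c (v i) + lin scl t v"
  and lin_append: "lin scl (t @ t') v = lin scl t v + lin scl t' v"
  by (simp_all add: lin_def)

lemma lin_cong: "(\<And>c i. (c, i) \<in> set t \<Longrightarrow> v i = w i) \<Longrightarrow> lin scl t v = lin scl t w"
  by (induction t) (auto simp: lin_Cons, metis)

text \<open>\<open>LD\<close> is the family of the sets of valuations that are definable in the language without \<open>G\<close>,
  of which only the following closure properties matter.\<close>

locale gpair = vector_space scale
  for scale :: "'k::field_char_0 \<Rightarrow> 'v::ab_group_add \<Rightarrow> 'v" (infixr \<open>*s\<close> 75) +
  fixes V G :: "'v set" and R :: "'k set" and LD :: "(nat \<Rightarrow> 'v) set set"
  assumes R: "is_subring R"
    and V_zero: "0 \<in> V" and V_add: "a \<in> V \<Longrightarrow> b \<in> V \<Longrightarrow> a + b \<in> V"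
    and V_scale: "a \<in> V \<Longrightarrow> c *s a \<in> V"
    and G_sub: "G \<subseteq> V" and G_zero: "0 \<in> G" and G_add: "a \<in> G \<Longrightarrow> b \<in> G \<Longrightarrow> a + b \<in> G"
    and G_scale: "r \<in> R \<Longrightarrow> a \<in> G \<Longrightarrow> r *s a \<in> G"
    and indepB: "rind (*) R ls \<Longrightarrow> (\<And>i. i < length ls \<Longrightarrow> gs i \<in> G) \<Longrightarrow>
      (\<Sum>i<length ls. ls ! i *s gs i) = 0 \<Longrightarrow> i < length ls \<Longrightarrow> gs i = 0"
    and LD_sub: "\<Phi> \<in> LD \<Longrightarrow> \<Phi> \<subseteq> vals V"
    and LD_Compl: "\<Phi> \<in> LD \<Longrightarrow> vals V - \<Phi> \<in> LD"
    and LD_Int: "\<Phi> \<in> LD \<Longrightarrow> \<Psi> \<in> LD \<Longrightarrow> \<Phi> \<inter> \<Psi> \<in> LD"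
    and LD_lin: "{v \<in> vals V. lin (*s) t v = 0} \<in> LD"
    and LD_subst: "\<Phi> \<in> LD \<Longrightarrow> {v \<in> vals V. (\<lambda>i. lin (*s) (\<sigma> i) v) \<in> \<Phi>} \<in> LD"
    and LD_dep: "\<Phi> \<in> LD \<Longrightarrow> \<exists>N. dep V \<Phi> N"
    and LD_inf: "\<Phi> \<in> LD \<Longrightarrow> {v \<in> vals V. infinite {a \<in> V. v(x := a) \<in> \<Phi>}} \<in> LD"
    and LD_alg: "\<Phi> \<in> LD \<Longrightarrow> \<exists>T. finite T \<and> (\<forall>t\<in>T. x \<notin> snd ` set t) \<and>
      (\<forall>v\<in>vals V. finite {a \<in> V. v(x := a) \<in> \<Phi>} \<longrightarrow> {a \<in> V. v(x := a) \<in> \<Phi>} \<subseteq> (\<lambda>t. lin (*s) t v) ` T)"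
    and LD_nip: "\<Phi> \<in> LD \<Longrightarrow> nip_set V \<Phi>"
    and dens: "\<Phi> \<in> LD \<Longrightarrow> v \<in> vals V \<Longrightarrow> r \<in> R \<Longrightarrow> r \<noteq> 0 \<Longrightarrow>
      infinite {a \<in> V. v(x := a) \<in> \<Phi>} \<Longrightarrow> \<exists>g\<in>G. v(x := r *s g) \<in> \<Phi>"
    and codens: "\<Phi> \<in> LD \<Longrightarrow> v \<in> vals V \<Longrightarrow> infinite {a \<in> V. v(x := a) \<in> \<Phi>} \<Longrightarrow>
      finite B \<Longrightarrow> fst ` B \<subseteq> V \<Longrightarrow>
      \<exists>a\<in>V. v(x := a) \<in> \<Phi> \<and>
        (\<forall>(b, cs)\<in>B. \<forall>gs. length gs = length cs \<and> set gs \<subseteq> G \<longrightarrow>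
           a \<noteq> b + (\<Sum>i<length cs. cs ! i *s gs ! i))"
begin

abbreviation Val where "Val \<equiv> vals V"
abbreviation lf where "lf \<equiv> lin (*s)"

lemma V_minus: "a \<in> V \<Longrightarrow> b \<in> V \<Longrightarrow> a - b \<in> V"
  using V_add[of a "(- 1) *s b"] V_scale[of b "- 1"] by simp

lemma G_uminus: "a \<in> G \<Longrightarrow> - a \<in> G"
  using G_scale[of "- 1" a] subring_uminus[OF R subring_1[OF R]] by simp

lemma G_minus: "a \<in> G \<Longrightarrow> b \<in> G \<Longrightarrow> a - b \<in> G"
  using G_add[of a "- b"] G_uminus[of b] by simp

lemma G_V: "a \<in> G \<Longrightarrow> a \<in> V" using G_sub by blast

lemma G_sum: "(\<And>i. i \<in> I \<Longrightarrow> f i \<in> G) \<Longrightarrow> sum f I \<in> G"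
  by (induction I rule: infinite_finite_induct) (auto intro: G_zero G_add)

lemma Val_app [simp, dest]: "v \<in> Val \<Longrightarrow> v i \<in> V" by (auto simp: vals_def)

lemma ValI: "(\<And>i. v i \<in> V) \<Longrightarrow> v \<in> Val" by (auto simp: vals_def)

lemma Val_zero [simp]: "(\<lambda>_. 0) \<in> Val" by (auto intro: ValI V_zero)

lemma Val_upd [simp]: "v \<in> Val \<Longrightarrow> a \<in> V \<Longrightarrow> v(x := a) \<in> Val" by (auto simp: vals_def)

lemma Val_updG [simp]: "v \<in> Val \<Longrightarrow> a \<in> G \<Longrightarrow> v(x := a) \<in> Val" by (simp add: G_V)

lemma Val_override [simp]: "v \<in> Val \<Longrightarrow> (\<And>i. i \<in> U \<Longrightarrow> u i \<in> G) \<Longrightarrow> override_on v u U \<in> Val"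
  by (rule ValI) (auto simp: override_on_def intro: G_V)

lemma lf_V: "v \<in> Val \<Longrightarrow> lf t v \<in> V"
  by (induction t) (auto simp: lin_Cons V_zero intro!: V_add V_scale)

lemma Val_lf [simp]: "v \<in> Val \<Longrightarrow> (\<lambda>i. lf (\<sigma> i) v) \<in> Val"
  by (rule ValI) (rule lf_V)

lemma lf_single [simp]: "lf [(c, i)] v = c *s v i" by (simp add: lin_def)

lemma lf_zero [simp]: "lf t (\<lambda>_. 0) = 0" by (induction t) (auto simp: lin_Cons)

lemma lf_diff: "lf t (\<lambda>i. v i - w i) = lf t v - lf t w"
  by (induction t) (auto simp: lin_Cons scale_right_diff_distrib)

lemma lf_scale: "lf t (\<lambda>i. c *s v i) = c *s lf t v"
  by (induction t) (auto simp: lin_Cons scale_right_distrib mult.commute)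

definition lsub :: "(nat \<Rightarrow> ('k \<times> nat) list) \<Rightarrow> ('k \<times> nat) list \<Rightarrow> ('k \<times> nat) list" where
  "lsub \<sigma> t = concat (map (\<lambda>(c, i). map (\<lambda>(d, j). (c * d, j)) (\<sigma> i)) t)"

lemma lf_map_scale: "lf (map (\<lambda>(d, j). (c * d, j)) t) v = c *s lf t v"
  by (induction t) (auto simp: lin_Cons scale_right_distrib)

lemma lf_lsub: "lf (lsub \<sigma> t) v = lf t (\<lambda>i. lf (\<sigma> i) v)"
  by (induction t) (auto simp: lsub_def lin_Cons lin_append lf_map_scale)

section \<open>Quantification over \<open>G\<close> and primitive positive sets\<close>

definition exG :: "nat \<Rightarrow> (nat \<Rightarrow> 'v) set \<Rightarrow> (nat \<Rightarrow> 'v) set" where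
  "exG x A = {v \<in> Val. \<exists>g\<in>G. v(x := g) \<in> A}"

definition exGs :: "nat set \<Rightarrow> (nat \<Rightarrow> 'v) set \<Rightarrow> (nat \<Rightarrow> 'v) set" where
  "exGs U A = {v \<in> Val. \<exists>u. (\<forall>i\<in>U. u i \<in> G) \<and> override_on v u U \<in> A}"

inductive_set PP :: "(nat \<Rightarrow> 'v) set set" where
  PP_lin: "{v \<in> Val. lf t v = 0} \<in> PP"
| PP_Int: "A \<in> PP \<Longrightarrow> B \<in> PP \<Longrightarrow> A \<inter> B \<in> PP"
| PP_exG: "A \<in> PP \<Longrightarrow> exG x A \<in> PP"

lemma PP_Val: "Val \<in> PP" using PP_lin[of "[]"] by simp

lemma PP_sub: "P \<in> PP \<Longrightarrow> P \<subseteq> Val"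
  by (induction rule: PP.induct) (auto simp: exG_def)

lemma dep_exG: "dep V A N \<Longrightarrow> dep V (exG x A) N"
  unfolding dep_def
proof (intro ballI impI)
  fix v w assume d: "\<forall>v\<in>Val. \<forall>w\<in>Val. (\<forall>i<N. v i = w i) \<longrightarrow> v \<in> A \<longrightarrow> w \<in> A"
    and vw: "v \<in> Val" "w \<in> Val" "\<forall>i<N. v i = w i" and v: "v \<in> exG x A"
  from v obtain g where g: "g \<in> G" "v(x := g) \<in> A" by (auto simp: exG_def)
  have "w(x := g) \<in> A"
    by (rule d[rule_format, of "v(x := g)"]) (use vw g in auto)
  then show "w \<in> exG x A" using vw g by (auto simp: exG_def)
qed

lemma PP_dep: "P \<in> PP \<Longrightarrow> \<exists>N. dep V P N"
proof (induction rule: PP.induct)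
  case (PP_lin t)
  have "dep V {v \<in> Val. lf t v = 0} (Suc (Max (insert 0 (snd ` set t))))"
    unfolding dep_def
  proof (intro ballI impI)
    fix v w :: "nat \<Rightarrow> 'v"
    assume vw: "v \<in> Val" "w \<in> Val" "\<forall>i<Suc (Max (insert 0 (snd ` set t))). v i = w i"
      and v: "v \<in> {v \<in> Val. lf t v = 0}"
    have "i < Suc (Max (insert 0 (snd ` set t)))" if "(c, i) \<in> set t" for c i
      using that by (intro le_imp_less_Suc Max_ge) force+
    then have "lf t v = lf t w" using vw by (intro lin_cong) auto
    then show "w \<in> {v \<in> Val. lf t v = 0}" using v vw by auto
  qed
  then show ?case by blast
qed (blast intro: dep_Int dep_exG)+

lemma PP_zero: "P \<in> PP \<Longrightarrow> (\<lambda>_. 0) \<in> P"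
proof (induction rule: PP.induct)
  case (PP_exG A x)
  then have "(\<lambda>_. 0)(x := 0) \<in> A" by (simp add: fun_upd_idem)
  then show ?case using G_zero unfolding exG_def by (auto intro!: bexI[of _ 0])
qed auto

lemma PP_diff: "P \<in> PP \<Longrightarrow> v \<in> P \<Longrightarrow> w \<in> P \<Longrightarrow> (\<lambda>i. v i - w i) \<in> P"
proof (induction arbitrary: v w rule: PP.induct)
  case (PP_lin t)
  then show ?case by (auto simp: lf_diff intro!: ValI V_minus)
next
  case (PP_exG A x)
  then obtain g h where gh: "g \<in> G" "h \<in> G" "v(x := g) \<in> A" "w(x := h) \<in> A" "v \<in> Val" "w \<in> Val"
    by (auto simp: exG_def)
  have "(\<lambda>i. (v(x := g)) i - (w(x := h)) i) \<in> A" by (rule PP_exG.IH[OF gh(3,4)])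
  moreover have "(\<lambda>i. (v(x := g)) i - (w(x := h)) i) = (\<lambda>i. v i - w i)(x := g - h)" by auto
  ultimately show ?case using gh G_minus by (auto simp: exG_def intro!: ValI V_minus)
qed auto

lemma PP_add: "P \<in> PP \<Longrightarrow> v \<in> P \<Longrightarrow> w \<in> P \<Longrightarrow> (\<lambda>i. v i + w i) \<in> P"
  using PP_diff[of P v "\<lambda>i. 0 - w i"] PP_diff[of P "\<lambda>_. 0" w] PP_zero[of P] by simp

lemma PP_scale: "P \<in> PP \<Longrightarrow> r \<in> R \<Longrightarrow> v \<in> P \<Longrightarrow> (\<lambda>i. r *s v i) \<in> P"
proof (induction arbitrary: v rule: PP.induct)
  case (PP_lin t)
  then show ?case by (auto simp: lf_scale intro!: ValI V_scale)
next
  case (PP_exG A x)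
  then obtain g where g: "g \<in> G" "v(x := g) \<in> A" "v \<in> Val" by (auto simp: exG_def)
  have "(\<lambda>i. r *s (v(x := g)) i) \<in> A" by (rule PP_exG.IH[OF PP_exG.prems(1) g(2)])
  moreover have "(\<lambda>i. r *s (v(x := g)) i) = (\<lambda>i. r *s v i)(x := r *s g)" by auto
  ultimately show ?case using g PP_exG.prems by (auto simp: exG_def intro!: ValI V_scale G_scale)
qed auto

lemma ex_fresh:
  fixes \<sigma> :: "nat \<Rightarrow> ('k \<times> nat) list"
  shows "\<exists>y\<ge>M. \<forall>i<N. y \<notin> snd ` set (\<sigma> i)"
proof -
  have "finite (\<Union>i<N. snd ` set (\<sigma> i))" by (rule finite_UN_I) auto
  then obtain m where m: "\<forall>n\<in>(\<Union>i<N. snd ` set (\<sigma> i)). n < m"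
    unfolding finite_nat_set_iff_bounded by (elim exE)
  have "\<forall>i<N. max M m \<notin> snd ` set (\<sigma> i)"
  proof (intro allI impI notI)
    fix i assume "i < N" "max M m \<in> snd ` set (\<sigma> i)"
    then have "max M m < m" using m by blast
    then show False by simp
  qed
  then show ?thesis by (intro exI[of _ "max M m"]) auto
qed

lemma PP_subst: "P \<in> PP \<Longrightarrow> {v \<in> Val. (\<lambda>i. lf (\<sigma> i) v) \<in> P} \<in> PP"
proof (induction arbitrary: \<sigma> rule: PP.induct)
  case (PP_lin t)
  have "{v \<in> Val. (\<lambda>i. lf (\<sigma> i) v) \<in> {v \<in> Val. lf t v = 0}} = {v \<in> Val. lf (lsub \<sigma> t) v = 0}"
    by (auto simp: lf_lsub)
  then show ?case using PP.PP_lin by simp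
next
  case (PP_Int A B)
  have "{v \<in> Val. (\<lambda>i. lf (\<sigma> i) v) \<in> A \<inter> B} =
      {v \<in> Val. (\<lambda>i. lf (\<sigma> i) v) \<in> A} \<inter> {v \<in> Val. (\<lambda>i. lf (\<sigma> i) v) \<in> B}" by auto
  then show ?case using PP_Int PP.PP_Int by simp
next
  case (PP_exG A x)
  obtain N where N: "dep V A N" using PP_dep[OF PP_exG.hyps] by blast
  obtain y where y: "\<forall>i<N. y \<notin> snd ` set (\<sigma> i)" using ex_fresh by blast
  \<comment> \<open>The bound variable \<open>x\<close> is renamed to \<open>y\<close>, which the
    terms substituted for the first \<open>N\<close> variables do not mention; otherwise their
    variables could be captured.\<close>
  define \<tau> where "\<tau> = \<sigma>(x := [(1, y)])"
  have eq: "(\<lambda>i. lf (\<sigma> i) v)(x := g) \<in> A \<longleftrightarrow> (\<lambda>i. lf (\<tau> i) (v(y := g))) \<in> A"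
    if vg: "v \<in> Val" "g \<in> G" for v g
  proof (rule depD[OF N])
    fix i assume "i < N"
    then have "i \<noteq> x \<Longrightarrow> lf (\<sigma> i) v = lf (\<sigma> i) (v(y := g))"
      using y by (intro lin_cong) force
    then show "((\<lambda>i. lf (\<sigma> i) v)(x := g)) i = lf (\<tau> i) (v(y := g))" by (simp add: \<tau>_def)
  qed (use vg in auto)
  have "{v \<in> Val. (\<lambda>i. lf (\<sigma> i) v) \<in> exG x A} = exG y {v \<in> Val. (\<lambda>i. lf (\<tau> i) v) \<in> A}"
    using eq by (auto simp: exG_def)
  then show ?case using PP_exG.IH[of \<tau>] PP.PP_exG by simp
qed

lemma PP_lf_G: "{v \<in> Val. lf t v \<in> G} \<in> PP"
proof -
  have "{v \<in> Val. v 0 \<in> G} = exG 1 {v \<in> Val. lf [(1, 0), (- 1, 1)] v = 0}"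
    by (auto simp: exG_def lin_Cons intro: G_V)
  also have "\<dots> \<in> PP" by (intro PP_exG PP_lin)
  finally have "{v \<in> Val. v 0 \<in> G} \<in> PP" .
  then have "{v \<in> Val. (\<lambda>i::nat. lf t v) \<in> {v \<in> Val. v 0 \<in> G}} \<in> PP" by (rule PP_subst)
  then show ?thesis by (rule back_subst[where P = "\<lambda>S. S \<in> PP"]) auto
qed

lemma exGs_empty [simp]: "A \<subseteq> Val \<Longrightarrow> exGs {} A = A"
  by (auto simp: exGs_def)

lemma exGs_insert:
  assumes "x \<notin> U"
  shows "exGs (insert x U) A = exG x (exGs U A)"
proof (intro equalityI subsetI)
  fix v assume "v \<in> exGs (insert x U) A"
  then obtain u where u: "v \<in> Val" "\<forall>i\<in>insert x U. u i \<in> G" "override_on v u (insert x U) \<in> A"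
    by (auto simp: exGs_def)
  have "override_on (v(x := u x)) u U = override_on v u (insert x U)"
    by (auto simp: override_on_def)
  then have "\<exists>u'. (\<forall>i\<in>U. u' i \<in> G) \<and> override_on (v(x := u x)) u' U \<in> A"
    using u by (intro exI[of _ u]) auto
  then show "v \<in> exG x (exGs U A)" using u by (auto simp: exG_def exGs_def intro!: bexI[of _ "u x"])
next
  fix v assume "v \<in> exG x (exGs U A)"
  then obtain g u where u: "v \<in> Val" "g \<in> G" "\<forall>i\<in>U. u i \<in> G" "override_on (v(x := g)) u U \<in> A"
    by (auto simp: exG_def exGs_def)
  have "override_on (v(x := g)) u U = override_on v (u(x := g)) (insert x U)"
    using assms by (auto simp: override_on_def)
  then show "v \<in> exGs (insert x U) A" using u assms
    by (auto simp: exGs_def intro!: exI[of _ "u(x := g)"])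
qed

lemma PP_exGs: "finite U \<Longrightarrow> A \<in> PP \<Longrightarrow> exGs U A \<in> PP"
  by (induction U rule: finite_induct) (auto simp: exGs_insert PP_sub intro: PP_exG)

lemma PP_Inter: "finite K \<Longrightarrow> K \<subseteq> PP \<Longrightarrow> Val \<inter> \<Inter>K \<in> PP"
proof (induction K rule: finite_induct)
  case (insert P K)
  then have "P \<inter> (Val \<inter> \<Inter>K) \<in> PP" by (auto intro!: PP_Int[of P])
  then show ?case by (simp add: Int_left_commute)
qed (simp add: PP_Val)

section \<open>Fibres, Boolean combinations and the Baur-Monk theorem\<close>

definition fib :: "nat \<Rightarrow> (nat \<Rightarrow> 'v) set \<Rightarrow> (nat \<Rightarrow> 'v) \<Rightarrow> 'v set" where
  "fib x P v = {g \<in> G. v(x := g) \<in> P}"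

text \<open>Two valuations in \<open>P\<close> that agree off \<open>x\<close> have a difference
  supported at \<open>x\<close>. So the subgroup is read off at the zero valuation and is the same
  for all \<open>v\<close>.\<close>

lemma fib_coset:
  assumes P: "P \<in> PP" and a: "a \<in> fib x P v"
  shows "fib x P v = cst a (fib x P (\<lambda>_. 0))"
proof -
  have d: "(\<lambda>i. (v(x := g)) i - (v(x := h)) i) = (\<lambda>_. 0)(x := g - h)" for g h by auto
  have s: "(\<lambda>i. ((\<lambda>_. 0)(x := g - h)) i + (v(x := h)) i) = v(x := g)" for g h by auto
  show ?thesis
  proof (intro equalityI subsetI)
    fix g assume "g \<in> fib x P v"
    then show "g \<in> cst a (fib x P (\<lambda>_. 0))"
      using a PP_diff[OF P, of "v(x := g)" "v(x := a)"] unfolding d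
      by (auto simp: fib_def cst_def G_minus)
  next
    fix g assume "g \<in> cst a (fib x P (\<lambda>_. 0))"
    then show "g \<in> fib x P v"
      using a PP_add[OF P, of "(\<lambda>_. 0)(x := g - a)" "v(x := a)"] G_add[of "g - a" a] unfolding s
      by (auto simp: fib_def cst_def)
  qed
qed

lemma fib_subgrp:
  assumes P: "P \<in> PP"
  shows "subgrp (fib x P (\<lambda>_. 0))"
  unfolding subgrp_def
proof (intro conjI ballI)
  show "0 \<in> fib x P (\<lambda>_. 0)" using PP_zero[OF P] G_zero by (simp add: fib_def fun_upd_idem)
next
  fix a b assume "a \<in> fib x P (\<lambda>_. 0)" "b \<in> fib x P (\<lambda>_. 0)"
  moreover have "(\<lambda>i. ((\<lambda>_. 0)(x := a)) i - ((\<lambda>_. 0)(x := b)) i) = (\<lambda>_. 0)(x := a - b)" by auto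
  ultimately show "a - b \<in> fib x P (\<lambda>_. 0)"
    using PP_diff[OF P, of "(\<lambda>_. 0)(x := a)" "(\<lambda>_. 0)(x := b)"] by (auto simp: fib_def G_minus)
qed

text \<open>The Boolean algebra generated by \<open>PP\<close>.\<close>

definition BPP :: "(nat \<Rightarrow> 'v) set set" where
  "BPP = {S. S \<subseteq> Val \<and> (\<exists>\<P>. finite \<P> \<and> \<P> \<subseteq> PP \<and>
     (\<forall>v\<in>Val. \<forall>w\<in>Val. (\<forall>P\<in>\<P>. v \<in> P \<longleftrightarrow> w \<in> P) \<longrightarrow> v \<in> S \<longrightarrow> w \<in> S))}"

lemma BPPI:
  assumes "S \<subseteq> Val" "finite \<P>" "\<P> \<subseteq> PP"
    "\<And>v w. v \<in> Val \<Longrightarrow> w \<in> Val \<Longrightarrow> (\<And>P. P \<in> \<P> \<Longrightarrow> v \<in> P \<longleftrightarrow> w \<in> P) \<Longrightarrow> v \<in> S \<Longrightarrow> w \<in> S"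
  shows "S \<in> BPP"
proof -
  have "\<forall>v\<in>Val. \<forall>w\<in>Val. (\<forall>P\<in>\<P>. v \<in> P \<longleftrightarrow> w \<in> P) \<longrightarrow> v \<in> S \<longrightarrow> w \<in> S"
  proof (intro ballI impI)
    fix v w assume a: "v \<in> Val" "w \<in> Val" "\<forall>P\<in>\<P>. v \<in> P \<longleftrightarrow> w \<in> P" "v \<in> S"
    show "w \<in> S" by (rule assms(4)[OF a(1,2) _ a(4)]) (rule bspec[OF a(3)])
  qed
  with assms(1-3) show ?thesis by (auto simp: BPP_def)
qed

text \<open>The one-sided condition in \<open>BPP\<close> becomes an equivalence by exchanging
  \<open>v\<close> and \<open>w\<close>. Being determined by finitely many sets does the work of a
  syntax for Boolean combinations.\<close>

definition det :: "(nat \<Rightarrow> 'v) set set \<Rightarrow> (nat \<Rightarrow> 'v) set \<Rightarrow> bool" where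
  "det \<P> S \<longleftrightarrow> (\<forall>v\<in>Val. \<forall>w\<in>Val. (\<forall>P\<in>\<P>. v \<in> P \<longleftrightarrow> w \<in> P) \<longrightarrow> (v \<in> S \<longleftrightarrow> w \<in> S))"

lemma detD:
  assumes "det \<P> S" "v \<in> Val" "w \<in> Val" "\<And>P. P \<in> \<P> \<Longrightarrow> v \<in> P \<longleftrightarrow> w \<in> P"
  shows "v \<in> S \<longleftrightarrow> w \<in> S"
  by (rule assms(1)[unfolded det_def, rule_format, OF assms(2-4)])

lemma BPPE:
  assumes "S \<in> BPP"
  obtains \<P> where "finite \<P>" "\<P> \<subseteq> PP"
    "det \<P> S"
proof -
  from assms obtain \<P> where *: "finite \<P>" "\<P> \<subseteq> PP"
    "\<forall>v\<in>Val. \<forall>w\<in>Val. (\<forall>P\<in>\<P>. v \<in> P \<longleftrightarrow> w \<in> P) \<longrightarrow> v \<in> S \<longrightarrow> w \<in> S"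
    unfolding BPP_def mem_Collect_eq by (elim conjE exE)
  then have "det \<P> S" unfolding det_def by metis
  with * show ?thesis by (intro that)
qed

lemma BPP_sub: "S \<in> BPP \<Longrightarrow> S \<subseteq> Val" by (auto simp: BPP_def)

lemma PP_BPP: "P \<in> PP \<Longrightarrow> P \<in> BPP"
  by (rule BPPI[of _ "{P}"]) (use PP_sub in auto)

lemma BPP_Compl:
  assumes "S \<in> BPP"
  shows "Val - S \<in> BPP"
proof -
  obtain \<P> where "finite \<P>" "\<P> \<subseteq> PP"
    "det \<P> S"
    using assms by (rule BPPE) (rule that; assumption)
  then show ?thesis by (intro BPPI[of _ \<P>]) (auto dest: detD)
qed

lemma BPP_Int:
  assumes "S \<in> BPP" "T \<in> BPP"
  shows "S \<inter> T \<in> BPP"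
proof -
  obtain \<P> where 1: "finite \<P>" "\<P> \<subseteq> PP"
    "det \<P> S"
    using assms(1) by (rule BPPE) (rule that; assumption)
  obtain \<Q> where 2: "finite \<Q>" "\<Q> \<subseteq> PP"
    "det \<Q> T"
    using assms(2) by (rule BPPE) (rule that; assumption)
  show ?thesis
  proof (rule BPPI[of _ "\<P> \<union> \<Q>"])
    fix v w assume "v \<in> Val" "w \<in> Val" "\<And>P. P \<in> \<P> \<union> \<Q> \<Longrightarrow> v \<in> P \<longleftrightarrow> w \<in> P" "v \<in> S \<inter> T"
    then show "w \<in> S \<inter> T" using detD[OF 1(3), of v w] detD[OF 2(3), of v w] by blast
  qed (use 1 2 BPP_sub assms in auto)
qed

lemma BPP_Un: "S \<in> BPP \<Longrightarrow> T \<in> BPP \<Longrightarrow> S \<union> T \<in> BPP"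
proof -
  assume st: "S \<in> BPP" "T \<in> BPP"
  then have "Val - ((Val - S) \<inter> (Val - T)) \<in> BPP" by (intro BPP_Compl BPP_Int)
  also have "Val - ((Val - S) \<inter> (Val - T)) = S \<union> T" using BPP_sub st by blast
  finally show ?thesis .
qed

lemma BPP_Val: "Val \<in> BPP" by (rule PP_BPP[OF PP_Val])

lemma BPP_dep: "S \<in> BPP \<Longrightarrow> \<exists>N. dep V S N"
proof -
  assume "S \<in> BPP"
  then obtain \<P> where P: "finite \<P>" "\<P> \<subseteq> PP"
    "det \<P> S"
    by (rule BPPE) (rule that; assumption)
  have "\<forall>P\<in>\<P>. \<exists>N. dep V P N" using P(2) PP_dep by blast
  from bchoice[OF this] obtain n where n: "\<forall>P\<in>\<P>. dep V P (n P)" by (elim exE)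
  have eq: "v \<in> S \<longleftrightarrow> w \<in> S"
    if vw: "v \<in> Val" "w \<in> Val" "\<forall>i<Max (insert 0 (n ` \<P>)). v i = w i" for v w
  proof (rule detD[OF P(3) vw(1,2)])
    fix Q assume Q: "Q \<in> \<P>"
    have "n Q \<le> Max (insert 0 (n ` \<P>))" using P(1) Q by auto
    then have "v i = w i" if "i < n Q" for i using vw(3) that by simp
    then show "v \<in> Q \<longleftrightarrow> w \<in> Q" by (rule depD[OF n[rule_format, OF Q] vw(1,2)])
  qed
  have "dep V S (Max (insert 0 (n ` \<P>)))"
    unfolding dep_def
  proof (intro ballI impI)
    fix v w assume "v \<in> Val" "w \<in> Val" "\<forall>i<Max (insert 0 (n ` \<P>)). v i = w i" "v \<in> S"
    then show "w \<in> S" using eq[of v w] by (simp only:)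
  qed
  then show ?thesis by blast
qed

lemma BPP_subst:
  assumes "S \<in> BPP"
  shows "{v \<in> Val. (\<lambda>i. lf (\<sigma> i) v) \<in> S} \<in> BPP"
proof -
  obtain \<P> where P: "finite \<P>" "\<P> \<subseteq> PP"
    "det \<P> S"
    using assms by (rule BPPE) (rule that; assumption)
  show ?thesis
  proof (rule BPPI[of _ "(\<lambda>P. {v \<in> Val. (\<lambda>i. lf (\<sigma> i) v) \<in> P}) ` \<P>"])
    fix v w assume vw: "v \<in> Val" "w \<in> Val"
      and eq: "\<And>P. P \<in> (\<lambda>P. {v \<in> Val. (\<lambda>i. lf (\<sigma> i) v) \<in> P}) ` \<P> \<Longrightarrow> v \<in> P \<longleftrightarrow> w \<in> P"
      and v: "v \<in> {v \<in> Val. (\<lambda>i. lf (\<sigma> i) v) \<in> S}"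
    have "(\<lambda>i. lf (\<sigma> i) v) \<in> P \<longleftrightarrow> (\<lambda>i. lf (\<sigma> i) w) \<in> P" if "P \<in> \<P>" for P
      using eq[OF imageI[OF that]] vw by auto
    then show "w \<in> {v \<in> Val. (\<lambda>i. lf (\<sigma> i) v) \<in> S}"
      using detD[OF P(3), of "\<lambda>i. lf (\<sigma> i) v" "\<lambda>i. lf (\<sigma> i) w"] v vw by auto
  qed (use P PP_subst in auto)
qed

text \<open>The Baur-Monk theorem: the fibres of the sets in \<open>PP\<close> are cosets, so the truth of
  \<open>\<exists>g\<in>G. P \<and> \<not> P\<^sub>1 \<and> \<dots> \<and> \<not> P\<^sub>k\<close> is a matter of cosets not covering a coset.\<close>

lemma BPP_exG:
  assumes "S \<in> BPP"
  shows "exG x S \<in> BPP"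
proof -
  obtain \<P> where P: "finite \<P>" "\<P> \<subseteq> PP"
    "det \<P> S"
    using assms by (rule BPPE) (rule that; assumption)
  \<comment> \<open>The sets \<open>exG x (D K)\<close> will decide \<open>exG x S\<close>: they
    tell which intersections of fibres are empty, and \<open>cover_transfer\<close> asks for nothing
    more.\<close>
  define D where "D K = Val \<inter> \<Inter>K" for K :: "(nat \<Rightarrow> 'v) set set"
  have D: "D K \<in> PP" if "K \<subseteq> \<P>" for K
    unfolding D_def using that P by (intro PP_Inter) (auto intro: finite_subset)
  show ?thesis
  proof (rule BPPI[of _ "(\<lambda>K. exG x (D K)) ` Pow \<P>"])
    fix v w assume vw: "v \<in> Val" "w \<in> Val"
      and eq: "\<And>P. P \<in> (\<lambda>K. exG x (D K)) ` Pow \<P> \<Longrightarrow> v \<in> P \<longleftrightarrow> w \<in> P"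
      and v: "v \<in> exG x S"
    from v obtain g where g: "g \<in> G" "v(x := g) \<in> S" by (auto simp: exG_def)
    \<comment> \<open>The truth pattern of the witness \<open>g\<close> over \<open>v\<close>: the
      sets in \<open>K\<close> hold and those in \<open>J\<close> fail. What is needed over
      \<open>w\<close> is a witness with the same pattern, that is, a point of one coset outside the
      cosets \<open>A w Q\<close>.\<close>
    define K where "K = {P \<in> \<P>. v(x := g) \<in> P}"
    define J where "J = \<P> - K"
    have K: "K \<subseteq> \<P>" and J: "finite J" "J \<subseteq> \<P>" using P by (auto simp: K_def J_def)
    define H where "H = fib x (D K) (\<lambda>_. 0)"
    define L where "L Q = fib x (D (insert Q K)) (\<lambda>_. 0)" for Q
    define A where "A z Q = fib x (D (insert Q K)) z" for z Q
    have gD: "g \<in> fib x (D K) v" using g vw by (auto simp: fib_def D_def K_def)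
    have ne: "fib x (D K') v = {} \<longleftrightarrow> fib x (D K') w = {}" if "K' \<subseteq> \<P>" for K'
      using eq[of "exG x (D K')"] that vw by (auto simp: exG_def fib_def)
    obtain h where h: "h \<in> fib x (D K) w" using ne[OF K] gD by blast
    have Cv: "fib x (D K) v = cst g H" and Cw: "fib x (D K) w = cst h H"
      unfolding H_def using fib_coset[OF D[OF K]] gD h by blast+
    have coset: "A z Q = {} \<or> (\<exists>a. A z Q = cst a (L Q))" if "Q \<in> J" for z Q
      using fib_coset[OF D[of "insert Q K"], of _ x z] that K J unfolding A_def L_def by blast
    have meet: "fib x (D K) z \<inter> (\<Inter>Q\<in>I. A z Q) = fib x (D (K \<union> I)) z" if "I \<subseteq> J" for I z
      unfolding A_def fib_def D_def by auto
    have "\<not> cst h H \<subseteq> (\<Union>Q\<in>J. A w Q)"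
    proof
      assume "cst h H \<subseteq> (\<Union>Q\<in>J. A w Q)"
      then have "cst g H \<subseteq> (\<Union>Q\<in>J. A v Q)"
      proof (rule cover_transfer[rotated -1])
        show "subgrp H" unfolding H_def by (rule fib_subgrp[OF D[OF K]])
        show "subgrp (L Q)" if "Q \<in> J" for Q
          unfolding L_def using that K J by (intro fib_subgrp D) auto
        show "cst h H \<inter> (\<Inter>Q\<in>I. A w Q) = {} \<longleftrightarrow> cst g H \<inter> (\<Inter>Q\<in>I. A v Q) = {}" if "I \<subseteq> J" for I
          unfolding Cv[symmetric] Cw[symmetric] meet[OF that] using ne[of "K \<union> I"] that K J by blast
      qed (use J coset in auto)
      then obtain Q where "Q \<in> J" "g \<in> A v Q" using gD Cv by blast
      then show False by (auto simp: A_def fib_def D_def J_def K_def)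
    qed
    then obtain g' where g': "g' \<in> fib x (D K) w" "\<And>Q. Q \<in> J \<Longrightarrow> g' \<notin> A w Q" using Cw by blast
    have "v(x := g) \<in> Q \<longleftrightarrow> w(x := g') \<in> Q" if "Q \<in> \<P>" for Q
    proof (cases "Q \<in> K")
      case True
      then show ?thesis using g' by (auto simp: fib_def D_def K_def)
    next
      case False
      then have "g' \<notin> A w Q" using g' that by (auto simp: J_def)
      then show ?thesis using g' False that by (auto simp: A_def fib_def D_def K_def)
    qed
    moreover have "g' \<in> G" using g' by (auto simp: fib_def)
    ultimately have "w(x := g') \<in> S" using detD[OF P(3), of "v(x := g)" "w(x := g')"] g vw by auto
    then show "w \<in> exG x S" using \<open>g' \<in> G\<close> vw by (auto simp: exG_def)
  qed (use P D PP_exG in \<open>auto simp: exG_def[of x S]\<close>)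
qed

lemma BPP_exGs: "finite U \<Longrightarrow> A \<in> BPP \<Longrightarrow> exGs U A \<in> BPP"
  by (induction U rule: finite_induct) (auto simp: exGs_insert BPP_sub intro: BPP_exG)

section \<open>Independence in \<open>G\<close> and the dichotomy for primitive positive
  groups\<close>

text \<open>Axiom (B) turned around. Expand the scalars \<open>e i\<close>, up to a denominator
  \<open>s\<close>, over scalars \<open>ls\<close> that are independent over \<open>R\<close>. The
  collected coefficients \<open>h l\<close> of the \<open>ls\<close> lie in \<open>G\<close> and
  vanish by (B); independence of \<open>b\<close> over \<open>R\<close> then makes every
  \<open>q i l\<close> vanish.\<close>

lemma G_indep:
  assumes b: "rind (*s) R b" "set b \<subseteq> G" and e: "(\<Sum>i<length b. e i *s b ! i) = 0" and i: "i < length b"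
  shows "e i = 0"
proof -
  interpret sc: vector_space "(*) :: 'k \<Rightarrow> 'k \<Rightarrow> 'k" by unfold_locales (auto simp: algebra_simps)
  let ?n = "length b"
  have "rind (*) R ([] :: 'k list)" by (simp add: rind_def)
  from sc.rind_extend[OF R this, of "map e [0..<?n]"]
  obtain ls s where ls: "rind (*) R ls" "s \<in> R" "s \<noteq> 0"
    and sp: "\<forall>y\<in>e ` {..<?n}. \<exists>q. (\<forall>i. q i \<in> R) \<and> s * y = (\<Sum>i<length ls. q i * ls ! i)"
    by (auto simp: atLeast0LessThan)
  then have "\<forall>i\<in>{..<?n}. \<exists>q. (\<forall>l. q l \<in> R) \<and> s * e i = (\<Sum>l<length ls. q l * ls ! l)" by blast
  then obtain q where q: "\<And>i l. i < ?n \<Longrightarrow> q i l \<in> R"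
    "\<And>i. i < ?n \<Longrightarrow> s * e i = (\<Sum>l<length ls. q i l * ls ! l)" by (metis lessThan_iff)
  define h where "h l = (\<Sum>i<?n. q i l *s b ! i)" for l
  have "(\<Sum>l<length ls. ls ! l *s h l) = (\<Sum>l<length ls. \<Sum>i<?n. (q i l * ls ! l) *s b ! i)"
    unfolding h_def scale_sum_right by (simp add: mult.commute)
  also have "\<dots> = (\<Sum>i<?n. \<Sum>l<length ls. (q i l * ls ! l) *s b ! i)" by (rule sum.swap)
  also have "\<dots> = (\<Sum>i<?n. (s * e i) *s b ! i)"
    by (intro sum.cong refl) (simp add: q(2) scale_sum_left)
  also have "\<dots> = s *s (\<Sum>i<?n. e i *s b ! i)" by (simp add: scale_sum_right)
  finally have "(\<Sum>l<length ls. ls ! l *s h l) = 0" using e by simp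
  moreover have "h l \<in> G" for l
    unfolding h_def using b(2) q(1) by (intro G_sum G_scale) auto
  ultimately have "h l = 0" if "l < length ls" for l using indepB[OF ls(1), of h l] that by simp
  then have "q i l = 0" if "l < length ls" for l
    using b(1)[unfolded rind_def, rule_format, of "\<lambda>i. q i l" i] q(1) i that by (simp add: h_def)
  then have "s * e i = 0" unfolding q(2)[OF i] by simp
  then show ?thesis using ls(3) by simp
qed

text \<open>A solution of a system with values in \<open>G\<close>, expanded over independent elements of \<open>G\<close>, can be
  projected onto each of them.\<close>

lemma PP_ray:
  assumes "P \<in> PP" "v \<in> P" "rind (*s) R b" "set b \<subseteq> G" "\<And>j i. q j i \<in> R"
    "\<And>j. v j = (\<Sum>i<length b. q j i *s b ! i)" "i < length b"
  shows "\<exists>r\<in>R. r \<noteq> 0 \<and> (\<forall>g\<in>G. (\<lambda>j. (r * q j i) *s g) \<in> P)"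
  using assms
proof (induction arbitrary: v b q rule: PP.induct)
  case (PP_lin t)
  \<comment> \<open>The coefficient of \<open>b ! i\<close> in the value of the linear form. It
    vanishes by \<open>G_indep\<close>, so the coordinates at \<open>i\<close> alone already solve
    the equation.\<close>
  let ?e = "\<lambda>i. (\<Sum>(c, j)\<leftarrow>t. c * q j i)"
  have "lf t (\<lambda>j. \<Sum>i<length b. q j i *s b ! i) = (\<Sum>i<length b. ?e i *s b ! i)"
    by (induction t)
      (auto simp: lin_Cons scale_sum_right scale_left_distrib sum.distrib)
  moreover have "v = (\<lambda>j. \<Sum>i<length b. q j i *s b ! i)" using PP_lin.prems(5) by (rule ext)
  ultimately have "(\<Sum>i<length b. ?e i *s b ! i) = 0" using PP_lin.prems(1) by simp
  then have e: "?e i = 0" by (rule G_indep[OF PP_lin.prems(2,3)]) (rule PP_lin.prems)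
  have "lf t (\<lambda>j. q j i *s g) = ?e i *s g" for g
    by (induction t) (auto simp: lin_Cons scale_left_distrib)
  then have "(\<lambda>j. (1 * q j i) *s g) \<in> {v \<in> Val. lf t v = 0}" if "g \<in> G" for g
    using e that by (auto intro!: ValI V_scale dest: G_V)
  then show ?case using subring_1[OF R] by (intro bexI[of _ 1]) auto
next
  case (PP_Int A B)
  obtain r where r: "r \<in> R" "r \<noteq> 0" "\<forall>g\<in>G. (\<lambda>j. (r * q j i) *s g) \<in> A"
    using PP_Int.IH(1)[of v b q, OF _ PP_Int.prems(2-6)] PP_Int.prems(1) by blast
  obtain r' where r': "r' \<in> R" "r' \<noteq> 0" "\<forall>g\<in>G. (\<lambda>j. (r' * q j i) *s g) \<in> B"
    using PP_Int.IH(2)[of v b q, OF _ PP_Int.prems(2-6)] PP_Int.prems(1) by blast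
  have "(\<lambda>j. (r * r' * q j i) *s g) \<in> A \<inter> B" if "g \<in> G" for g
    using r(3)[rule_format, OF G_scale[OF r'(1) that]] r'(3)[rule_format, OF G_scale[OF r(1) that]]
    by (simp add: ac_simps)
  then show ?case using r r' R by (intro bexI[of _ "r * r'"]) (auto simp: subring_mult)
next
  case (PP_exG A y)
  from PP_exG.prems(1) obtain g0 where g0: "g0 \<in> G" "v(y := g0) \<in> A" by (auto simp: exG_def)
  \<comment> \<open>The witness \<open>g0\<close> may lie outside the span of \<open>b\<close>. So
    \<open>b\<close> is enlarged and the solution is multiplied by the denominator \<open>s\<close>;
    at the variables other than \<open>y\<close> the added elements get coefficient 0.\<close>
  obtain c s where cs: "rind (*s) R (b @ c)" "set c \<subseteq> {g0}" "s \<in> R" "s \<noteq> 0"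
    and ex: "\<exists>q. (\<forall>i. q i \<in> R) \<and> s *s g0 = (\<Sum>i<length (b @ c). q i *s (b @ c) ! i)"
    using rind_extend[OF R PP_exG.prems(2), of "[g0]"] by auto
  then obtain q0 where q0: "\<And>i. q0 i \<in> R" "s *s g0 = (\<Sum>i<length (b @ c). q0 i *s (b @ c) ! i)" by blast
  define q' where "q' j l = (if j = y then q0 l else if l < length b then s * q j l else 0)" for j l
  have "\<exists>r\<in>R. r \<noteq> 0 \<and> (\<forall>g\<in>G. (\<lambda>j. (r * q' j i) *s g) \<in> A)"
  proof (rule PP_exG.IH)
    show "(\<lambda>j. s *s (v(y := g0)) j) \<in> A" by (rule PP_scale[OF PP_exG.hyps cs(3) g0(2)])
    show "rind (*s) R (b @ c)" by (rule cs)
    show "set (b @ c) \<subseteq> G" using cs g0 PP_exG.prems by auto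
    show "q' j i \<in> R" for j i using q0 cs PP_exG.prems R by (auto simp: q'_def subring_mult subring_0)
    show "i < length (b @ c)" using PP_exG.prems by simp
    show "s *s (v(y := g0)) j = (\<Sum>i<length (b @ c). q' j i *s (b @ c) ! i)" for j
    proof (cases "j = y")
      case True
      then show ?thesis using q0(2) by (simp add: q'_def)
    next
      case False
      have "(\<Sum>i<length (b @ c). q' j i *s (b @ c) ! i) = (\<Sum>i<length b. q' j i *s (b @ c) ! i)"
        by (rule sum.mono_neutral_right) (auto simp: q'_def False)
      also have "\<dots> = (\<Sum>i<length b. s *s (q j i *s b ! i))"
        by (intro sum.cong) (auto simp: q'_def False nth_append)
      finally show ?thesis using False PP_exG.prems(5)[of j] by (simp add: scale_sum_right)
    qed
  qed
  then obtain r where r: "r \<in> R" "r \<noteq> 0" "\<And>g. g \<in> G \<Longrightarrow> (\<lambda>j. (r * q' j i) *s g) \<in> A" by blast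
  have "(\<lambda>j. (r * s * q j i) *s g) \<in> exG y A" if "g \<in> G" for g
  proof -
    have "(\<lambda>j. (r * q' j i) *s g) = (\<lambda>j. (r * s * q j i) *s g)(y := (r * q0 i) *s g)"
      using PP_exG.prems(6) by (auto simp: q'_def ac_simps)
    moreover have "(r * q0 i) *s g \<in> G" using that r q0 R by (intro G_scale) (auto simp: subring_mult)
    moreover have "(\<lambda>j. (r * s * q j i) *s g) \<in> Val" using that by (intro ValI V_scale G_V)
    ultimately show ?thesis using r(3)[OF that] by (auto simp: exG_def)
  qed
  then show ?case using r cs R by (intro bexI[of _ "r * s"]) (auto simp: subring_mult)
qed

text \<open>Put \<open>u x\<close> first in a list independent over \<open>R\<close> that spans the
  values of \<open>u\<close> up to a denominator, and project the solution onto this first element.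
  So as soon as one solution in \<open>G\<close> is nonzero at \<open>x\<close>, there is a whole
  line of solutions, parametrized by \<open>G\<close>, that moves \<open>x\<close>.\<close>

lemma PP_dichotomy:
  assumes P: "P \<in> PP" and U: "finite U" "\<And>i. i \<in> U \<Longrightarrow> u i \<in> G" "override_on (\<lambda>_. 0) u U \<in> P"
    and x: "x \<in> U" "u x \<noteq> 0"
  obtains \<rho> where "\<And>j. \<rho> j \<in> R" "\<rho> x \<noteq> 0" "\<And>j. j \<notin> U \<Longrightarrow> \<rho> j = 0"
    "\<And>g. g \<in> G \<Longrightarrow> (\<lambda>j. \<rho> j *s g) \<in> P"
proof -
  obtain us where us: "set us = u ` U" using finite_list[of "u ` U"] U by auto
  have "rind (*s) R [u x]" using x by (simp add: rind_def)
  from rind_extend[OF R this, of us] obtain c s where cs: "rind (*s) R (u x # c)" "set c \<subseteq> u ` U" "s \<in> R" "s \<noteq> 0"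
    and ex: "\<And>y. y \<in> u ` U \<Longrightarrow>
      \<exists>q. (\<forall>i. q i \<in> R) \<and> s *s y = (\<Sum>i<length (u x # c). q i *s (u x # c) ! i)"
    unfolding us append_Cons append_Nil by (elim exE conjE) (rule that; blast)
  define b where "b = u x # c"
  have "\<forall>j\<in>U. \<exists>q. (\<forall>i. q i \<in> R) \<and> s *s u j = (\<Sum>i<length b. q i *s b ! i)"
    using ex by (simp add: b_def)
  then obtain q where q: "\<And>j i. j \<in> U \<Longrightarrow> q j i \<in> R"
    "\<And>j. j \<in> U \<Longrightarrow> s *s u j = (\<Sum>i<length b. q j i *s b ! i)" by metis
  \<comment> \<open>Coordinates of \<open>s\<close> times the solution. At \<open>x\<close> they are
    \<open>s\<close> in position 0 and 0 elsewhere, as \<open>u x\<close> is the first element of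
    \<open>b\<close>; hence \<open>\<rho> x\<close> will be a multiple of \<open>s\<close> and
    nonzero.\<close>
  define q' where "q' j i = (if j \<notin> U then 0 else if j = x then (if i = 0 then s else 0) else q j i)" for j i :: nat
  have "\<exists>r\<in>R. r \<noteq> 0 \<and> (\<forall>g\<in>G. (\<lambda>j. (r * q' j 0) *s g) \<in> P)"
  proof (rule PP_ray[OF P PP_scale[OF P cs(3) U(3)]])
    show "rind (*s) R b" using cs by (simp add: b_def)
    show "set b \<subseteq> G" using cs U x by (auto simp: b_def)
    show "q' j i \<in> R" for j i using q(1) cs R by (auto simp: q'_def subring_0)
    show "s *s override_on (\<lambda>_. 0) u U j = (\<Sum>i<length b. q' j i *s b ! i)" for j
    proof (cases "j = x")
      case True
      have "(\<Sum>i<length b. q' j i *s b ! i) = (\<Sum>i<length b. if i = 0 then s *s b ! 0 else 0)"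
        using True x by (intro sum.cong) (auto simp: q'_def)
      also have "\<dots> = s *s u x" by (simp add: b_def)
      finally show ?thesis using True x by (simp add: override_on_def)
    qed (use q(2) in \<open>auto simp: q'_def override_on_def\<close>)
    show "0 < length b" by (simp add: b_def)
  qed
  then obtain r where r: "r \<in> R" "r \<noteq> 0" "\<And>g. g \<in> G \<Longrightarrow> (\<lambda>j. (r * q' j 0) *s g) \<in> P" by blast
  show ?thesis
    by (rule that[of "\<lambda>j. r * q' j 0"])
      (use r cs q x R in \<open>auto simp: q'_def subring_mult subring_0\<close>)
qed

section \<open>A normal form for definable sets\<close>

text \<open>For a group \<open>P\<close> of valuations, it says that the values in \<open>G\<close> at the variables in \<open>U\<close> are
  determined by the other values.\<close>

definition uniq :: "nat set \<Rightarrow> (nat \<Rightarrow> 'v) set \<Rightarrow> bool" where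
  "uniq U P \<longleftrightarrow> (\<forall>u. (\<forall>i\<in>U. u i \<in> G) \<longrightarrow> override_on (\<lambda>_. 0) u U \<in> P \<longrightarrow> (\<forall>i\<in>U. u i = 0))"

lemma uniqD:
  assumes "uniq U P" "\<And>i. i \<in> U \<Longrightarrow> u i \<in> G" "override_on (\<lambda>_. 0) u U \<in> P" "i \<in> U"
  shows "u i = 0"
  using assms(1)[unfolded uniq_def, rule_format, of u] assms(2-4) by simp

lemma uniq_eq:
  assumes U: "uniq U P" and P: "P \<in> PP"
    and u: "\<And>i. i \<in> U \<Longrightarrow> u i \<in> G" "\<And>i. i \<in> U \<Longrightarrow> u' i \<in> G"
    and v: "override_on v u U \<in> P" "override_on v u' U \<in> P"
  shows "override_on v u U = override_on v u' U"
proof -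
  have "(\<lambda>i. override_on v u U i - override_on v u' U i) = override_on (\<lambda>_. 0) (\<lambda>i. u i - u' i) U"
    by (auto simp: override_on_def)
  then have "override_on (\<lambda>_. 0) (\<lambda>i. u i - u' i) U \<in> P" using PP_diff[OF P v] by simp
  then have "u i - u' i = 0" if "i \<in> U" for i
    using uniqD[OF U, of "\<lambda>i. u i - u' i" i] that u by (auto intro: G_minus)
  then show ?thesis by (auto simp: override_on_def)
qed

lemma LD_Val: "Val \<in> LD" using LD_lin[of "[]"] by simp

lemma exGs_Val: "exGs U A \<subseteq> Val" by (auto simp: exGs_def)

lemma dep_exGs: "finite U \<Longrightarrow> A \<subseteq> Val \<Longrightarrow> dep V A N \<Longrightarrow> dep V (exGs U A) N"
proof (induction U arbitrary: A rule: finite_induct)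
  case (insert x U)
  then show ?case unfolding exGs_insert[OF insert.hyps(2)] by (intro dep_exG insert.IH)
qed simp

definition spec :: "nat set \<Rightarrow> (nat \<Rightarrow> 'v) set \<Rightarrow> (nat \<Rightarrow> 'v) set \<Rightarrow> (nat \<Rightarrow> 'v) set \<Rightarrow> bool" where
  "spec U P B \<Phi> \<longleftrightarrow> finite U \<and> P \<in> PP \<and> uniq U P \<and> B \<in> BPP \<and> \<Phi> \<in> LD"

definition SP :: "(nat \<Rightarrow> 'v) set set" where
  "SP = {exGs U (P \<inter> B \<inter> \<Phi>) |U P B \<Phi>. spec U P B \<Phi>}"

inductive_set NF :: "(nat \<Rightarrow> 'v) set set" where
  NF_empty: "{} \<in> NF"
| NF_insert: "A \<in> SP \<Longrightarrow> S \<in> NF \<Longrightarrow> A \<union> S \<in> NF"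

lemma SPI: "finite U \<Longrightarrow> P \<in> PP \<Longrightarrow> uniq U P \<Longrightarrow> B \<in> BPP \<Longrightarrow> \<Phi> \<in> LD \<Longrightarrow> exGs U (P \<inter> B \<inter> \<Phi>) \<in> SP"
  unfolding SP_def spec_def by blast

lemma SP_base: "B \<in> BPP \<Longrightarrow> \<Phi> \<in> LD \<Longrightarrow> B \<inter> \<Phi> \<in> SP"
proof -
  assume a: "B \<in> BPP" "\<Phi> \<in> LD"
  have "exGs {} (Val \<inter> B \<inter> \<Phi>) \<in> SP" by (rule SPI) (use a PP_Val in \<open>auto simp: uniq_def\<close>)
  also have "exGs {} (Val \<inter> B \<inter> \<Phi>) = B \<inter> \<Phi>" using BPP_sub[OF a(1)] by (subst exGs_empty) auto
  finally show ?thesis .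
qed

lemma SP_sub: "A \<in> SP \<Longrightarrow> A \<subseteq> Val" unfolding SP_def using exGs_Val by blast

lemma SP_dep:
  assumes "A \<in> SP"
  shows "\<exists>N. dep V A N"
proof -
  from assms obtain U P B \<Phi> where A: "A = exGs U (P \<inter> B \<inter> \<Phi>)" "spec U P B \<Phi>"
    unfolding SP_def by blast
  obtain N1 N2 N3 where "dep V P N1" "dep V B N2" "dep V \<Phi> N3"
    using A(2) PP_dep BPP_dep LD_dep unfolding spec_def by blast
  then have "dep V (P \<inter> B \<inter> \<Phi>) (max (max N1 N2) N3)" by (intro dep_Int)
  then have "dep V A (max (max N1 N2) N3)"
    unfolding A using A(2) by (intro dep_exGs) (auto simp: spec_def dest: PP_sub)
  then show ?thesis by blast
qed

text \<open>The quantified block is shifted out of the way of the substituted terms, and beyond an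
  arbitrary \<open>M\<close> as well. For the identity substitution this amounts to renaming the
  bound variables, which later arguments use to make the block fresh.\<close>

lemma SP_subst_fresh:
  assumes "A \<in> SP"
  obtains U P B \<Phi> where "{v \<in> Val. (\<lambda>i. lf (\<sigma> i) v) \<in> A} = exGs U (P \<inter> B \<inter> \<Phi>)" "spec U P B \<Phi>"
    "\<forall>i\<in>U. M \<le> i"
proof -
  from assms obtain U P B \<Phi> where A: "A = exGs U (P \<inter> B \<inter> \<Phi>)" "spec U P B \<Phi>"
    unfolding SP_def by blast
  obtain N1 N2 N3 where "dep V P N1" "dep V B N2" "dep V \<Phi> N3"
    using A(2) PP_dep BPP_dep LD_dep unfolding spec_def by blast
  then have "dep V (P \<inter> B \<inter> \<Phi>) (max (max N1 N2) N3)" by (intro dep_Int)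
  then obtain N where N: "dep V (P \<inter> B \<inter> \<Phi>) N" by blast
  have fin: "finite (\<Union>i<N. snd ` set (\<sigma> i))" by (rule finite_UN_I) auto
  then obtain m where m: "\<forall>n\<in>(\<Union>i<N. snd ` set (\<sigma> i)). n < m"
    unfolding finite_nat_set_iff_bounded by (elim exE)
  define K where "K = max m M"
  define W where "W = (\<lambda>i. i + K) ` U"
  \<comment> \<open>Variables from \<open>N\<close> on do not affect membership, but their terms in
    \<open>\<sigma>\<close> might mention \<open>W\<close>. The empty term keeps them 0 in the proof
    of uniqueness.\<close>
  define \<tau> where "\<tau> i = (if i \<in> U then [(1, i + K)] else if i < N then \<sigma> i else [])" for i
  define pb where "pb X = {v \<in> Val. (\<lambda>i. lf (\<tau> i) v) \<in> X}" for X
  have fresh: "j \<notin> W" if "i < N" "(c, j) \<in> set (\<sigma> i)" for i c j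
  proof
    assume "j \<in> W"
    then have "m \<le> j" by (auto simp: W_def K_def)
    moreover have "j < m" using m that by force
    ultimately show False by simp
  qed
  have pb_mem: "override_on v w W \<in> pb (P \<inter> B \<inter> \<Phi>) \<longleftrightarrow>
      override_on (\<lambda>i. lf (\<sigma> i) v) (\<lambda>i. w (i + K)) U \<in> P \<inter> B \<inter> \<Phi>"
    if v: "v \<in> Val" "\<And>i. i \<in> W \<Longrightarrow> w i \<in> G" for v w
  proof -
    have "(\<lambda>i. lf (\<tau> i) (override_on v w W)) \<in> P \<inter> B \<inter> \<Phi> \<longleftrightarrow>
      override_on (\<lambda>i. lf (\<sigma> i) v) (\<lambda>i. w (i + K)) U \<in> P \<inter> B \<inter> \<Phi>"
    proof (rule depD[OF N])
      fix i assume "i < N"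
      then have "lf (\<sigma> i) (override_on v w W) = lf (\<sigma> i) v"
        using fresh by (intro lin_cong) (auto simp: override_on_def)
      then show "lf (\<tau> i) (override_on v w W) = override_on (\<lambda>i. lf (\<sigma> i) v) (\<lambda>i. w (i + K)) U i"
        using \<open>i < N\<close> by (auto simp: \<tau>_def override_on_def W_def)
    qed (use v in \<open>auto simp: W_def intro!: Val_override\<close>)
    then show ?thesis using v by (simp add: pb_def)
  qed
  have "{v \<in> Val. (\<lambda>i. lf (\<sigma> i) v) \<in> A} = exGs W (pb (P \<inter> B \<inter> \<Phi>))"
  proof (intro equalityI subsetI)
    fix v assume "v \<in> {v \<in> Val. (\<lambda>i. lf (\<sigma> i) v) \<in> A}"
    then obtain u where v: "v \<in> Val" and u: "\<forall>i\<in>U. u i \<in> G"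
      "override_on (\<lambda>i. lf (\<sigma> i) v) u U \<in> P \<inter> B \<inter> \<Phi>" by (auto simp: A exGs_def)
    have "override_on v (\<lambda>i. u (i - K)) W \<in> pb (P \<inter> B \<inter> \<Phi>)"
      by (subst pb_mem) (use v u in \<open>auto simp: W_def\<close>)
    then show "v \<in> exGs W (pb (P \<inter> B \<inter> \<Phi>))" using v u
      by (auto simp: exGs_def W_def intro!: exI[of _ "\<lambda>i. u (i - K)"])
  next
    fix v assume "v \<in> exGs W (pb (P \<inter> B \<inter> \<Phi>))"
    then obtain w where v: "v \<in> Val" and w: "\<And>i. i \<in> W \<Longrightarrow> w i \<in> G" "override_on v w W \<in> pb (P \<inter> B \<inter> \<Phi>)"
      by (auto simp: exGs_def)
    have "override_on (\<lambda>i. lf (\<sigma> i) v) (\<lambda>i. w (i + K)) U \<in> P \<inter> B \<inter> \<Phi>"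
      by (rule iffD1[OF pb_mem[OF v] w(2)]) (rule w(1))
    then show "v \<in> {v \<in> Val. (\<lambda>i. lf (\<sigma> i) v) \<in> A}"
      using v w(1) unfolding A exGs_def
      by (auto simp: W_def intro!: exI[of _ "\<lambda>i. w (i + K)"])
  qed
  also have "pb (P \<inter> B \<inter> \<Phi>) = pb P \<inter> pb B \<inter> pb \<Phi>" by (auto simp: pb_def)
  finally have 1: "{v \<in> Val. (\<lambda>i. lf (\<sigma> i) v) \<in> A} = exGs W (pb P \<inter> pb B \<inter> pb \<Phi>)" .
  have "uniq W (pb P)"
    unfolding uniq_def
  proof (intro allI impI ballI)
    fix w i assume w: "\<forall>i\<in>W. w i \<in> G" "override_on (\<lambda>_. 0) w W \<in> pb P" and i: "i \<in> W"
    have "lf (\<tau> j) (override_on (\<lambda>_. 0) w W) = override_on (\<lambda>_. 0) (\<lambda>i. w (i + K)) U j" for j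
    proof -
      have "lf (\<sigma> j) (override_on (\<lambda>_. 0) w W) = lf (\<sigma> j) (\<lambda>_. 0)" if "j < N"
        using fresh that by (intro lin_cong) (auto simp: override_on_def)
      then show ?thesis by (auto simp: \<tau>_def override_on_def W_def)
    qed
    then have "override_on (\<lambda>_. 0) (\<lambda>i. w (i + K)) U \<in> P" using w(2) by (simp add: pb_def)
    moreover obtain j where j: "j \<in> U" "i = j + K" using i by (auto simp: W_def)
    ultimately show "w i = 0"
      using uniqD[of U P "\<lambda>i. w (i + K)" j] A(2) w(1) by (auto simp: spec_def W_def)
  qed
  then have 2: "spec W (pb P) (pb B) (pb \<Phi>)"
    using A(2) PP_subst BPP_subst LD_subst by (auto simp: spec_def W_def pb_def)
  have 3: "\<forall>i\<in>W. M \<le> i" by (auto simp: W_def K_def)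
  show ?thesis by (rule that[OF 1 2 3])
qed

lemma SP_E:
  assumes "A \<in> SP"
  obtains U P B \<Phi> where "A = exGs U (P \<inter> B \<inter> \<Phi>)" "spec U P B \<Phi>" "\<forall>i\<in>U. M \<le> i"
proof -
  obtain U P B \<Phi> where 1: "{v \<in> Val. (\<lambda>i. lf [(1, i)] v) \<in> A} = exGs U (P \<inter> B \<inter> \<Phi>)"
    and 2: "spec U P B \<Phi>" and 3: "\<forall>i\<in>U. M \<le> i"
    using SP_subst_fresh[OF assms, of "\<lambda>i. [(1, i)]" M] .
  have "{v \<in> Val. (\<lambda>i. lf [(1, i)] v) \<in> A} = A" using SP_sub[OF assms] by auto
  then show ?thesis using 1 2 3 that by simp
qed

lemma SP_subst: "A \<in> SP \<Longrightarrow> {v \<in> Val. (\<lambda>i. lf (\<sigma> i) v) \<in> A} \<in> SP"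
proof -
  assume "A \<in> SP"
  then obtain U P B \<Phi> where "{v \<in> Val. (\<lambda>i. lf (\<sigma> i) v) \<in> A} = exGs U (P \<inter> B \<inter> \<Phi>)" "spec U P B \<Phi>"
    by (rule SP_subst_fresh[of A \<sigma> 0])
  then show ?thesis unfolding SP_def by blast
qed

lemma exGs_exGs: "exGs U (exGs W A) = exGs (U \<union> W) A"
proof (intro equalityI subsetI)
  fix v assume "v \<in> exGs U (exGs W A)"
  then obtain u w where uw: "v \<in> Val" "\<forall>i\<in>U. u i \<in> G" "\<forall>i\<in>W. w i \<in> G"
    "override_on (override_on v u U) w W \<in> A" by (auto simp: exGs_def)
  have "override_on (override_on v u U) w W = override_on v (override_on u w W) (U \<union> W)"
    by (auto simp: override_on_def)
  then have "override_on v (override_on u w W) (U \<union> W) \<in> A" using uw(4) by simp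
  moreover have "\<forall>i\<in>U \<union> W. override_on u w W i \<in> G" using uw(2,3) by (auto simp: override_on_def)
  ultimately show "v \<in> exGs (U \<union> W) A" using uw(1) unfolding exGs_def by blast
next
  fix v assume "v \<in> exGs (U \<union> W) A"
  then obtain u where u: "v \<in> Val" "\<forall>i\<in>U \<union> W. u i \<in> G" "override_on v u (U \<union> W) \<in> A"
    by (auto simp: exGs_def)
  have "override_on (override_on v u U) u W = override_on v u (U \<union> W)"
    by (auto simp: override_on_def)
  then have "override_on v u U \<in> exGs W A" using u by (auto simp: exGs_def)
  then show "v \<in> exGs U (exGs W A)" using u unfolding exGs_def[of U] by blast
qed

lemma exGs_fresh:
  assumes "dep V A N" "\<And>i. i \<in> U \<Longrightarrow> N \<le> i" "A \<subseteq> Val"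
  shows "exGs U (A \<inter> B) = A \<inter> exGs U B"
proof -
  have "override_on v u U \<in> A \<longleftrightarrow> v \<in> A" if "v \<in> Val" "\<forall>i\<in>U. u i \<in> G" for v u
  proof (rule depD[OF assms(1)])
    fix i assume "i < N"
    then have "i \<notin> U" using assms(2)[of i] by auto
    then show "override_on v u U i = v i" by (simp add: override_on_def)
  qed (use that in auto)
  then show ?thesis using assms(3) by (auto simp: exGs_def)
qed

lemma SP_Int_base:
  assumes "A \<in> SP" "B' \<in> BPP" "\<Psi> \<in> LD"
  shows "A \<inter> (B' \<inter> \<Psi>) \<in> SP"
proof -
  obtain N1 N2 where "dep V B' N1" "dep V \<Psi> N2" using assms BPP_dep LD_dep by blast
  then have d: "dep V (B' \<inter> \<Psi>) (max N1 N2)" by (rule dep_Int)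
  obtain U P B \<Phi> where A: "A = exGs U (P \<inter> B \<inter> \<Phi>)" and s: "spec U P B \<Phi>"
    and U: "\<forall>i\<in>U. max N1 N2 \<le> i"
    using SP_E[OF assms(1)] .
  have "exGs U ((B' \<inter> \<Psi>) \<inter> (P \<inter> B \<inter> \<Phi>)) = (B' \<inter> \<Psi>) \<inter> A"
    unfolding A by (rule exGs_fresh[OF d U[rule_format]]) (use assms BPP_sub in auto)
  moreover have "(B' \<inter> \<Psi>) \<inter> (P \<inter> B \<inter> \<Phi>) = P \<inter> (B \<inter> B') \<inter> (\<Phi> \<inter> \<Psi>)" by blast
  ultimately have "A \<inter> (B' \<inter> \<Psi>) = exGs U (P \<inter> (B \<inter> B') \<inter> (\<Phi> \<inter> \<Psi>))" by (metis Int_commute)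
  also have "\<dots> \<in> SP" using s assms by (intro SPI BPP_Int LD_Int) (auto simp: spec_def)
  finally show ?thesis .
qed

text \<open>Two nested blocks of determined witnesses merge into one. Since \<open>Q\<close> does
  not see the renamed block \<open>U\<close>, it forces the values on \<open>W\<close> to vanish
  first, and then \<open>P\<close> forces those on \<open>U\<close>.\<close>

lemma SP_wrap:
  assumes W: "finite W" "Q \<in> PP" "uniq W Q" and "A \<in> SP"
  shows "exGs W (Q \<inter> A) \<in> SP"
proof -
  obtain N where N: "dep V Q N" using PP_dep[OF W(2)] by blast
  obtain U P B \<Phi> where A: "A = exGs U (P \<inter> B \<inter> \<Phi>)" and s: "spec U P B \<Phi>"
    and U: "\<forall>i\<in>U. N \<le> i"
    using SP_E[OF assms(4)] .
  have "Q \<inter> A = exGs U (Q \<inter> (P \<inter> B \<inter> \<Phi>))"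
    unfolding A by (rule exGs_fresh[OF N U[rule_format], symmetric]) (use W PP_sub in auto)
  then have "exGs W (Q \<inter> A) = exGs (W \<union> U) ((Q \<inter> P) \<inter> B \<inter> \<Phi>)"
    by (simp add: exGs_exGs Int_assoc)
  moreover have "uniq (W \<union> U) (Q \<inter> P)"
    unfolding uniq_def
  proof (intro allI impI)
    fix u assume u: "\<forall>i\<in>W \<union> U. u i \<in> G" "override_on (\<lambda>_. 0) u (W \<union> U) \<in> Q \<inter> P"
    have "override_on (\<lambda>_. 0) u W \<in> Q \<longleftrightarrow> override_on (\<lambda>_. 0) u (W \<union> U) \<in> Q"
    proof (rule depD[OF N])
      fix i assume "i < N"
      then show "override_on (\<lambda>_. 0) u W i = override_on (\<lambda>_. 0) u (W \<union> U) i"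
        using U by (auto simp: override_on_def)
    qed (use u in \<open>auto intro!: Val_override\<close>)
    then have 0: "u i = 0" if "i \<in> W" for i using uniqD[OF W(3), of u i] u that by auto
    have "override_on (\<lambda>_. 0) u (W \<union> U) = override_on (\<lambda>_. 0) u U"
      using 0 by (auto simp: override_on_def)
    then have "u i = 0" if "i \<in> U" for i using uniqD[of U P u i] u that s by (auto simp: spec_def)
    with 0 show "\<forall>i\<in>W \<union> U. u i = 0" by blast
  qed
  ultimately show ?thesis using s W PP_Int by (auto simp: spec_def intro!: SPI)
qed

lemma SP_Int:
  assumes "A \<in> SP" "A' \<in> SP"
  shows "A \<inter> A' \<in> SP"
proof -
  obtain N where N: "dep V A N" using SP_dep[OF assms(1)] by blast
  obtain U P B \<Phi> where A': "A' = exGs U (P \<inter> B \<inter> \<Phi>)" and s: "spec U P B \<Phi>"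
    and U: "\<forall>i\<in>U. N \<le> i"
    using SP_E[OF assms(2)] .
  have "A \<inter> A' = exGs U (A \<inter> (P \<inter> B \<inter> \<Phi>))"
    unfolding A' by (rule exGs_fresh[OF N U[rule_format], symmetric]) (use assms SP_sub in auto)
  also have "A \<inter> (P \<inter> B \<inter> \<Phi>) = P \<inter> (A \<inter> (B \<inter> \<Phi>))" by blast
  also have "exGs U \<dots> \<in> SP"
    using s assms(1) by (intro SP_wrap SP_Int_base) (auto simp: spec_def)
  finally show ?thesis .
qed

lemma SP_NF: "A \<in> SP \<Longrightarrow> A \<in> NF" using NF_insert[OF _ NF_empty] by auto

lemma BPP_NF: "B \<in> BPP \<Longrightarrow> B \<in> NF"
proof -
  assume "B \<in> BPP"
  then have "B \<inter> Val \<in> SP" "B \<inter> Val = B" using SP_base LD_Val BPP_sub by auto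
  then show ?thesis using SP_NF by simp
qed

lemma LD_NF: "\<Phi> \<in> LD \<Longrightarrow> \<Phi> \<in> NF"
proof -
  assume "\<Phi> \<in> LD"
  then have "Val \<inter> \<Phi> \<in> SP" "Val \<inter> \<Phi> = \<Phi>" using SP_base BPP_Val LD_sub by auto
  then show ?thesis using SP_NF by simp
qed

lemma NF_Un: "S \<in> NF \<Longrightarrow> T \<in> NF \<Longrightarrow> S \<union> T \<in> NF"
  by (induction rule: NF.induct) (auto simp: Un_assoc intro: NF_insert)

lemma NF_UN: "finite I \<Longrightarrow> (\<And>i. i \<in> I \<Longrightarrow> f i \<in> NF) \<Longrightarrow> (\<Union>i\<in>I. f i) \<in> NF"
  by (induction I rule: finite_induct) (auto intro: NF_Un NF_empty)

lemma NF_SP_Int: "S \<in> NF \<Longrightarrow> A \<in> SP \<Longrightarrow> A \<inter> S \<in> NF"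
  by (induction rule: NF.induct) (auto simp: Int_Un_distrib intro: NF_empty NF_insert SP_Int)

lemma NF_Int: "S \<in> NF \<Longrightarrow> T \<in> NF \<Longrightarrow> S \<inter> T \<in> NF"
  by (induction rule: NF.induct) (auto simp: Int_Un_distrib2 intro: NF_empty NF_Un NF_SP_Int)

lemma NF_sub: "S \<in> NF \<Longrightarrow> S \<subseteq> Val"
  by (induction rule: NF.induct) (auto dest: SP_sub)

text \<open>With a unique witness negation passes under the quantifier: either \<open>P\<close> has
  no witness at all, or its only witness fails \<open>B\<close> or fails
  \<open>\<Phi>\<close>.\<close>

lemma SP_Compl:
  assumes "A \<in> SP"
  shows "Val - A \<in> NF"
proof -
  from assms obtain U P B \<Phi> where A: "A = exGs U (P \<inter> B \<inter> \<Phi>)" "spec U P B \<Phi>"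
    unfolding SP_def by blast
  have P: "P \<in> PP" "uniq U P" and sub: "P \<subseteq> Val" "B \<subseteq> Val" "\<Phi> \<subseteq> Val"
    using A(2) PP_sub BPP_sub LD_sub by (auto simp: spec_def)
  have "Val - A = (Val - exGs U P) \<union> (exGs U (P \<inter> (Val - B) \<inter> Val) \<union> exGs U (P \<inter> Val \<inter> (Val - \<Phi>)))"
  proof (intro equalityI subsetI)
    fix v assume v: "v \<in> Val - A"
    show "v \<in> (Val - exGs U P) \<union> (exGs U (P \<inter> (Val - B) \<inter> Val) \<union> exGs U (P \<inter> Val \<inter> (Val - \<Phi>)))"
    proof (cases "v \<in> exGs U P")
      case True
      then obtain u where u: "\<forall>i\<in>U. u i \<in> G" "override_on v u U \<in> P" by (auto simp: exGs_def)
      have "override_on v u U \<in> Val" using u sub by blast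
      moreover have "override_on v u U \<notin> B \<or> override_on v u U \<notin> \<Phi>"
        using v u by (auto simp: A exGs_def)
      ultimately show ?thesis using u v by (auto simp: exGs_def)
    qed (use v in auto)
  next
    fix v assume v: "v \<in> (Val - exGs U P) \<union> (exGs U (P \<inter> (Val - B) \<inter> Val) \<union> exGs U (P \<inter> Val \<inter> (Val - \<Phi>)))"
    show "v \<in> Val - A"
    proof
      show "v \<in> Val" using v by (auto simp: exGs_def)
      show "v \<notin> A"
      proof
        assume "v \<in> A"
        then obtain u where u: "\<forall>i\<in>U. u i \<in> G" "override_on v u U \<in> P \<inter> B \<inter> \<Phi>"
          by (auto simp: A exGs_def)
        then have "v \<in> exGs U P" using \<open>v \<in> Val\<close> by (auto simp: exGs_def)
        with v obtain u' where u': "\<forall>i\<in>U. u' i \<in> G" "override_on v u' U \<in> P"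
          "override_on v u' U \<notin> B \<or> override_on v u' U \<notin> \<Phi>" by (auto simp: exGs_def)
        have "override_on v u U = override_on v u' U"
          by (rule uniq_eq[OF P(2,1)]) (use u u' in auto)
        with u u' show False by auto
      qed
    qed
  qed
  moreover have "Val - exGs U P \<in> NF"
    using A(2) by (intro BPP_NF BPP_Compl PP_BPP PP_exGs) (auto simp: spec_def)
  moreover have "exGs U (P \<inter> (Val - B) \<inter> Val) \<in> NF" "exGs U (P \<inter> Val \<inter> (Val - \<Phi>)) \<in> NF"
    using A(2) LD_Val BPP_Val BPP_Compl LD_Compl unfolding spec_def by (blast intro: SP_NF SPI)+
  ultimately show ?thesis by (auto intro: NF_Un)
qed

lemma NF_Compl: "S \<in> NF \<Longrightarrow> Val - S \<in> NF"
proof (induction rule: NF.induct)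
  case NF_empty
  then show ?case using BPP_NF[OF BPP_Val] by simp
next
  case (NF_insert A S)
  have "Val - (A \<union> S) = (Val - A) \<inter> (Val - S)" by blast
  then show ?case using NF_Int[OF SP_Compl[OF NF_insert.hyps(1)] NF_insert.IH] by simp
qed

lemma NF_dep: "S \<in> NF \<Longrightarrow> \<exists>N. dep V S N"
proof (induction rule: NF.induct)
  case (NF_insert A S)
  then obtain N1 N2 where n: "dep V A N1" "dep V S N2" using SP_dep by blast
  have "dep V A (max N1 N2)" "dep V S (max N1 N2)" using n by (auto intro: dep_mono)
  then have "dep V (A \<union> S) (max N1 N2)" unfolding dep_def by fast
  then show ?case by blast
qed (auto simp: dep_def)

lemma NF_subst: "S \<in> NF \<Longrightarrow> {v \<in> Val. (\<lambda>i. lf (\<sigma> i) v) \<in> S} \<in> NF"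
proof (induction rule: NF.induct)
  case (NF_insert A S)
  have "{v \<in> Val. (\<lambda>i. lf (\<sigma> i) v) \<in> A \<union> S} =
    {v \<in> Val. (\<lambda>i. lf (\<sigma> i) v) \<in> A} \<union> {v \<in> Val. (\<lambda>i. lf (\<sigma> i) v) \<in> S}" by blast
  then show ?case using NF.NF_insert[OF SP_subst[OF NF_insert.hyps(1), of \<sigma>] NF_insert.IH] by simp
qed (simp add: NF_empty)

lemma NF_subst1: "S \<in> NF \<Longrightarrow> {v \<in> Val. v(x := lf t v) \<in> S} \<in> NF"
proof -
  assume "S \<in> NF"
  then have "{v \<in> Val. (\<lambda>i. lf (((\<lambda>i. [(1, i)])(x := t)) i) v) \<in> S} \<in> NF" by (rule NF_subst)
  moreover have "(\<lambda>i. lf (((\<lambda>i. [(1, i)])(x := t)) i) v) = v(x := lf t v)" for v by auto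
  ultimately show ?thesis by simp
qed

lemma exGs_Un: "exGs U (A \<union> B) = exGs U A \<union> exGs U B"
  by (auto simp: exGs_def)

lemma NF_wrap:
  assumes "finite W" "Q \<in> PP" "uniq W Q" "S \<in> NF"
  shows "exGs W (Q \<inter> S) \<in> NF"
  using assms(4)
proof (induction rule: NF.induct)
  case (NF_insert A S)
  have "exGs W (Q \<inter> (A \<union> S)) = exGs W (Q \<inter> A) \<union> exGs W (Q \<inter> S)"
    by (simp add: Int_Un_distrib exGs_Un)
  then show ?case using NF.NF_insert[OF SP_wrap[OF assms(1-3) NF_insert.hyps(1)] NF_insert.IH] by simp
qed (simp add: exGs_def NF_empty)

lemma exG_exGs: "A \<subseteq> Val \<Longrightarrow> exG x A = exGs {x} A"
  by (simp add: exGs_insert)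

text \<open>A quantified variable that is determined by a set in \<open>PP\<close> simply joins the
  block of determined witnesses.\<close>

lemma NF_exG_unique:
  assumes "P \<in> PP" "uniq {x} P" "S \<in> NF"
  shows "exG x (P \<inter> S) \<in> NF"
proof -
  have "P \<inter> S \<subseteq> Val" using NF_sub[OF assms(3)] by blast
  then show ?thesis using NF_wrap[OF _ assms] by (simp add: exG_exGs)
qed

section \<open>Eliminating quantifiers over \<open>G\<close>\<close>

definition dfn :: "'v set \<Rightarrow> bool" where
  "dfn X \<longleftrightarrow> (\<exists>\<Phi>\<in>LD. \<exists>v\<in>Val. \<exists>x. X = {a \<in> V. v(x := a) \<in> \<Phi>})"

lemma dfn_remove:
  assumes "dfn X" "f \<in> V"
  shows "dfn (X - {f})"
proof -
  from assms obtain \<Phi> v x where X: "\<Phi> \<in> LD" "v \<in> Val" "X = {a \<in> V. v(x := a) \<in> \<Phi>}"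
    unfolding dfn_def by blast
  obtain N where N: "dep V \<Phi> N" using LD_dep[OF X(1)] by blast
  \<comment> \<open>A variable beyond the support of \<open>\<Phi>\<close> holds the point
    \<open>f\<close> as a new parameter.\<close>
  define y where "y = max N (Suc x)"
  let ?\<Psi> = "\<Phi> \<inter> (Val - {v \<in> Val. lf [(1, x), (- 1, y)] v = 0})"
  have y: "y \<noteq> x" "N \<le> y" by (auto simp: y_def)
  have "(v(y := f))(x := a) \<in> \<Phi> \<longleftrightarrow> v(x := a) \<in> \<Phi>" if "a \<in> V" for a
    by (rule depD[OF N]) (use that X assms y in auto)
  then have "X - {f} = {a \<in> V. (v(y := f))(x := a) \<in> ?\<Psi>}"
    using X assms y by (auto simp: lin_Cons)
  moreover have "?\<Psi> \<in> LD" using X LD_lin LD_Int LD_Compl by blast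
  moreover have "v(y := f) \<in> Val" using X assms by simp
  ultimately show ?thesis unfolding dfn_def by blast
qed

lemma dfn_shift:
  assumes "dfn X" "b \<in> V"
  shows "dfn {a \<in> V. b + a \<in> X}"
proof -
  from assms obtain \<Phi> v x where X: "\<Phi> \<in> LD" "v \<in> Val" "X = {a \<in> V. v(x := a) \<in> \<Phi>}"
    unfolding dfn_def by blast
  obtain N where N: "dep V \<Phi> N" using LD_dep[OF X(1)] by blast
  define y where "y = max N (Suc x)"
  have y: "y \<noteq> x" "N \<le> y" by (auto simp: y_def)
  let ?\<sigma> = "(\<lambda>i. [(1, i)])(x := [(1, y), (1, x)])"
  let ?\<Psi> = "{v \<in> Val. (\<lambda>i. lf (?\<sigma> i) v) \<in> \<Phi>}"
  have "(\<lambda>i. lf (?\<sigma> i) ((v(y := b))(x := a))) \<in> \<Phi> \<longleftrightarrow> v(x := b + a) \<in> \<Phi>" if "a \<in> V" for a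
    by (rule depD[OF N]) (use that X assms y in \<open>auto simp: lin_Cons V_add intro!: Val_upd\<close>)
  then have "{a \<in> V. b + a \<in> X} = {a \<in> V. (v(y := b))(x := a) \<in> ?\<Psi>}"
    using X assms by (auto intro: V_add)
  moreover have "?\<Psi> \<in> LD" by (rule LD_subst[OF X(1)])
  moreover have "v(y := b) \<in> Val" using X assms by simp
  ultimately show ?thesis unfolding dfn_def by blast
qed

text \<open>Density speaks of \<open>rG\<close> only. Removing the finite set and translating by
  \<open>- b\<close> leaves an infinite definable set, to which it applies.\<close>

lemma dens_coset:
  assumes "dfn X" "infinite X" "r \<in> R" "r \<noteq> 0" "b \<in> V" "finite F" "F \<subseteq> V"
  shows "\<exists>g\<in>G. b + r *s g \<in> X - F"
proof -
  have "dfn (X - F)" using assms(6,7)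
  proof (induction F rule: finite_induct)
    case (insert f F)
    then have "dfn (X - F - {f})" by (intro dfn_remove) auto
    moreover have "X - insert f F = X - F - {f}" by auto
    ultimately show ?case by simp
  qed (simp add: assms)
  then have "dfn {a \<in> V. b + a \<in> X - F}" by (rule dfn_shift[OF _ assms(5)])
  then obtain \<Phi> v x where X: "\<Phi> \<in> LD" "v \<in> Val" "{a \<in> V. b + a \<in> X - F} = {a \<in> V. v(x := a) \<in> \<Phi>}"
    unfolding dfn_def by blast
  have XV: "X \<subseteq> V" using assms(1) unfolding dfn_def by blast
  have "infinite (X - F)" using assms by simp
  moreover have "X - F \<subseteq> (+) b ` {a \<in> V. b + a \<in> X - F}"
  proof
    fix a assume "a \<in> X - F"
    then show "a \<in> (+) b ` {a \<in> V. b + a \<in> X - F}"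
      using XV assms(5) by (intro image_eqI[of _ _ "a - b"]) (auto intro: V_minus)
  qed
  ultimately have "infinite {a \<in> V. v(x := a) \<in> \<Phi>}" unfolding X(3)[symmetric]
    by (meson finite_imageI finite_subset)
  then obtain g where g: "g \<in> G" "v(x := r *s g) \<in> \<Phi>" using dens[OF X(1,2) assms(3,4)] by blast
  have "r *s g \<in> {a \<in> V. b + a \<in> X - F}" unfolding X(3) using g by (auto intro: V_scale G_V)
  with g show ?thesis by blast
qed

abbreviation "fiber x \<Phi> v \<equiv> {a \<in> V. v(x := a) \<in> \<Phi>}"

text \<open>Fibres of sets in \<open>PP\<close> are cosets of a subgroup that is trivial or contains \<open>rG\<close> for some
  \<open>r \<noteq> 0\<close>. In the first case the element of the fibre is a definable function; off these
  exceptional points, truth only depends on a coset of \<open>rG\<close>, and density applies.\<close>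

lemma exG_base:
  assumes B: "B \<in> BPP" and \<Phi>: "\<Phi> \<in> LD"
  shows "exG x (B \<inter> \<Phi>) \<in> NF"
proof -
  obtain \<P> where P: "finite \<P>" "\<P> \<subseteq> PP" "det \<P> B"
    using B by (rule BPPE)
  \<comment> \<open>The sets that determine \<open>x\<close>, so that their fibres have at most one
    point. By the dichotomy the fibre group of every other set in \<open>\<P>\<close> contains a
    nonzero multiple of \<open>G\<close>.\<close>
  define exc where "exc = {P \<in> \<P>. uniq {x} P}"
  have exc: "finite exc" "exc \<subseteq> PP" using P by (auto simp: exc_def)
  have "\<exists>r\<in>R. r \<noteq> 0 \<and> (\<forall>g\<in>G. r *s g \<in> fib x Q (\<lambda>_. 0))" if Q: "Q \<in> \<P> - exc" for Q
  proof -
    from Q obtain u where u: "u x \<in> G" "override_on (\<lambda>_. 0) u {x} \<in> Q" "u x \<noteq> 0"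
      by (auto simp: exc_def uniq_def)
    have "Q \<in> PP" using Q P by blast
    then obtain \<rho> where \<rho>: "\<And>j. \<rho> j \<in> R" "\<rho> x \<noteq> 0" "\<And>j. j \<notin> {x} \<Longrightarrow> \<rho> j = 0"
      "\<And>g. g \<in> G \<Longrightarrow> (\<lambda>j. \<rho> j *s g) \<in> Q"
      using PP_dichotomy[of Q "{x}" u x] u by auto
    have "(\<lambda>j. \<rho> j *s g) = (\<lambda>_. 0)(x := \<rho> x *s g)" for g using \<rho>(3) by auto
    then have "\<rho> x *s g \<in> fib x Q (\<lambda>_. 0)" if "g \<in> G" for g
      using \<rho>(4)[OF that] G_scale[OF \<rho>(1) that] by (simp add: fib_def)
    then show ?thesis using \<rho> by blast
  qed
  then obtain r0 where r0: "\<forall>Q\<in>\<P> - exc. r0 Q \<in> R \<and> r0 Q \<noteq> 0 \<and> (\<forall>g\<in>G. r0 Q *s g \<in> fib x Q (\<lambda>_. 0))"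
    using bchoice[of "\<P> - exc" "\<lambda>Q r. r \<in> R \<and> r \<noteq> 0 \<and> (\<forall>g\<in>G. r *s g \<in> fib x Q (\<lambda>_. 0))"] by blast
  \<comment> \<open>A common multiple of the factors, so that adding an element of \<open>rG\<close>
    at \<open>x\<close> changes membership in none of the sets outside \<open>exc\<close>.\<close>
  define r where "r = (\<Prod>Q\<in>\<P> - exc. r0 Q)"
  have prodR: "(\<Prod>Q\<in>K. r0 Q) \<in> R" if "finite K" "K \<subseteq> \<P> - exc" for K
    using that by (induction K rule: finite_induct) (use r0 R in \<open>auto simp: subring_1 subring_mult\<close>)
  have r: "r \<in> R" "r \<noteq> 0" using prodR[of "\<P> - exc"] r0 P(1) by (auto simp: r_def)
  have rfib: "r *s g \<in> fib x Q (\<lambda>_. 0)" if "Q \<in> \<P> - exc" "g \<in> G" for Q g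
  proof -
    have "r = r0 Q * (\<Prod>Q\<in>\<P> - exc - {Q}. r0 Q)"
      unfolding r_def using P(1) that(1) by (intro prod.remove) auto
    moreover have "(\<Prod>Q\<in>\<P> - exc - {Q}. r0 Q) *s g \<in> G" by (intro G_scale prodR) (use P that in auto)
    ultimately show ?thesis using r0 that(1) by (metis scale_scale)
  qed
  define B1 where "B1 = B - \<Union>exc"
  have "\<Union>exc \<in> BPP"
    using exc by (induction exc rule: finite_induct) (auto intro: BPP_Un PP_BPP simp: BPP_Compl[OF BPP_Val, simplified])
  then have "B \<inter> (Val - \<Union>exc) \<in> BPP" by (intro BPP_Int B BPP_Compl)
  also have "B \<inter> (Val - \<Union>exc) = B1" using BPP_sub[OF B] by (auto simp: B1_def)
  finally have B1: "B1 \<in> BPP" .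
  obtain T where T: "finite T" "\<forall>t\<in>T. x \<notin> snd ` set t"
    "\<forall>v\<in>Val. finite (fiber x \<Phi> v) \<longrightarrow> fiber x \<Phi> v \<subseteq> (\<lambda>t. lf t v) ` T"
    using LD_alg[OF \<Phi>, of x] by (elim exE conjE)
  \<comment> \<open>The graph of the term \<open>t\<close> is a set in \<open>PP\<close> that
    determines \<open>x\<close>; it makes a solution given by a term a determined witness.\<close>
  define Qt where "Qt t = {v \<in> Val. lf ((1, x) # map (\<lambda>(d, j). (- 1 * d, j)) t) v = 0}" for t
  have neg: "lf (map (\<lambda>(d, j). (- d, j)) t) v = - lf t v" for t v
    using lf_map_scale[of "- 1" t v] by simp
  have Qt: "v \<in> Qt t \<longleftrightarrow> v \<in> Val \<and> v x = lf t v" for v t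
    by (simp add: Qt_def lin_Cons neg)
  define I where "I = {v \<in> Val. infinite (fiber x \<Phi> v)}"
  have lf_x: "lf t (v(x := a)) = lf t v" if "t \<in> T" for t v a
    using T(2) that by (intro lin_cong) force
  \<comment> \<open>Three sources of a witness: a set in \<open>exc\<close>, which determines it; an
    infinite fibre of \<open>\<Phi>\<close>, where density makes the conditions \<open>B1\<close>
    and \<open>\<Phi>\<close> independent of each other; a finite fibre of \<open>\<Phi>\<close>,
    where it is the value of a term.\<close>
  have "exG x (B \<inter> \<Phi>) = (\<Union>P\<in>exc. exG x (P \<inter> (B \<inter> \<Phi>))) \<union>
      ((exG x B1 \<inter> I) \<union> (\<Union>t\<in>T. exG x (Qt t \<inter> (B1 \<inter> \<Phi>))))" (is "?L = ?R")
  proof (intro equalityI subsetI)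
    fix v assume "v \<in> ?L"
    then obtain g where v: "v \<in> Val" and g: "g \<in> G" "v(x := g) \<in> B" "v(x := g) \<in> \<Phi>" by (auto simp: exG_def)
    show "v \<in> ?R"
    proof (cases "v(x := g) \<in> \<Union>exc")
      case True
      then show ?thesis using v g by (auto simp: exG_def)
    next
      case False
      then have B1g: "v(x := g) \<in> B1" using g by (simp add: B1_def)
      show ?thesis
      proof (cases "infinite (fiber x \<Phi> v)")
        case True
        then show ?thesis using v g B1g by (auto simp: exG_def I_def)
      next
        case False
        then have "fiber x \<Phi> v \<subseteq> (\<lambda>t. lf t v) ` T" using T(3) v by blast
        then have "g \<in> (\<lambda>t. lf t v) ` T" using g G_V by blast
        then obtain t where t: "t \<in> T" "g = lf t v" by blast
        then have "v(x := g) \<in> Qt t" using v g by (simp add: Qt lf_x)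
        then show ?thesis using v g B1g t by (auto simp: exG_def)
      qed
    qed
  next
    fix v assume "v \<in> ?R"
    then consider "v \<in> (\<Union>P\<in>exc. exG x (P \<inter> (B \<inter> \<Phi>))) \<union> (\<Union>t\<in>T. exG x (Qt t \<inter> (B1 \<inter> \<Phi>)))"
      | "v \<in> exG x B1" "v \<in> I" by blast
    then show "v \<in> ?L"
    proof cases
      case 1
      then show ?thesis by (auto simp: exG_def B1_def)
    next
      case 2
      then obtain b where v: "v \<in> Val" and b: "b \<in> G" "v(x := b) \<in> B1" by (auto simp: exG_def)
      \<comment> \<open>The finitely many exceptional points over \<open>v\<close>. The point
        \<open>b\<close> is in none of the sets in \<open>exc\<close>, and the new witness
        \<open>b + r h\<close> has to share this.\<close>
      define F where "F = (\<Union>P\<in>exc. fib x P v)"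
      have "finite (fib x P v)" if Pe: "P \<in> exc" for P
      proof (cases "fib x P v = {}")
        case False
        then obtain a where a: "a \<in> fib x P v" by blast
        have PP: "P \<in> PP" using that exc by blast
        have "fib x P (\<lambda>_. 0) \<subseteq> {0}"
        proof
          fix g assume "g \<in> fib x P (\<lambda>_. 0)"
          then have "g \<in> G" "override_on (\<lambda>_. 0) (\<lambda>_. g) {x} \<in> P"
            by (auto simp: fib_def override_on_def fun_upd_def)
          then show "g \<in> {0}" using uniqD[of "{x}" P "\<lambda>_. g" x] Pe by (simp add: exc_def)
        qed
        then have "fib x P v \<subseteq> {a}" using fib_coset[OF PP a] by (auto simp: cst_def)
        then show ?thesis by (rule finite_subset) simp
      qed simp
      then have F: "finite F" "F \<subseteq> V" using exc by (auto simp: F_def fib_def intro: G_V)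
      have "dfn (fiber x \<Phi> v)" unfolding dfn_def using \<Phi> v by blast
      moreover have "infinite (fiber x \<Phi> v)" using 2 by (simp add: I_def)
      ultimately obtain h where h: "h \<in> G" "b + r *s h \<in> fiber x \<Phi> v - F"
        using dens_coset[OF _ _ r G_V[OF b(1)] F] by blast
      define g where "g = b + r *s h"
      have g: "g \<in> G" "v(x := g) \<in> \<Phi>" "g \<notin> F" using h b r by (auto simp: g_def G_add G_scale)
      have "v(x := g) \<in> Q \<longleftrightarrow> v(x := b) \<in> Q" if Q: "Q \<in> \<P>" for Q
      proof (cases "Q \<in> exc")
        case True
        then show ?thesis using g b by (auto simp: F_def fib_def B1_def)
      next
        case False
        then have rh: "(\<lambda>_. 0)(x := r *s h) \<in> Q" using rfib[of Q h] Q h by (auto simp: fib_def)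
        have QP: "Q \<in> PP" using Q P by blast
        have 1: "(\<lambda>i. (v(x := b)) i + ((\<lambda>_. 0)(x := r *s h)) i) = v(x := g)"
          and 2: "(\<lambda>i. (v(x := g)) i - ((\<lambda>_. 0)(x := r *s h)) i) = v(x := b)"
          by (auto simp: g_def)
        show ?thesis using PP_add[OF QP _ rh, of "v(x := b)"] PP_diff[OF QP _ rh, of "v(x := g)"]
          unfolding 1 2 by blast
      qed
      then have "v(x := g) \<in> B \<longleftrightarrow> v(x := b) \<in> B"
        by (intro detD[OF P(3)]) (use v g b in auto)
      then have "v(x := g) \<in> B \<inter> \<Phi>" using b g by (simp add: B1_def)
      then show ?thesis using v g by (auto simp: exG_def)
    qed
  qed
  also have "\<dots> \<in> NF"
  proof (intro NF_Un NF_UN NF_Int)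
    show "exG x (P \<inter> (B \<inter> \<Phi>)) \<in> NF" if "P \<in> exc" for P
      using that exc B \<Phi> by (intro NF_exG_unique SP_NF SP_base) (auto simp: exc_def)
    show "exG x (Qt t \<inter> (B1 \<inter> \<Phi>)) \<in> NF" if t: "t \<in> T" for t
    proof (rule NF_exG_unique[OF _ _ SP_NF[OF SP_base[OF B1 \<Phi>]]])
      show "Qt t \<in> PP" unfolding Qt_def by (rule PP_lin)
      show "uniq {x} (Qt t)"
        unfolding uniq_def
      proof (intro allI impI ballI)
        fix u i assume "override_on (\<lambda>_. 0) u {x} \<in> Qt t" "i \<in> {x}"
        moreover have "override_on (\<lambda>_. 0) u {x} = (\<lambda>_. 0)(x := u x)"
          by (auto simp: override_on_def)
        ultimately show "u i = 0" using lf_x[OF t, of "\<lambda>_. 0" "u x"] by (simp add: Qt)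
      qed
    qed
    show "I \<in> NF" unfolding I_def by (intro LD_NF LD_inf \<Phi>)
    show "exG x B1 \<in> NF" by (intro BPP_NF BPP_exG B1)
  qed (use exc T in auto)
  finally show ?thesis .
qed

lemma LD_NF_inf: "\<Phi> \<in> LD \<Longrightarrow> {v \<in> Val. infinite (fiber x \<Phi> v)} \<in> NF"
  by (intro LD_NF LD_inf)

text \<open>If \<open>u\<close> is determined by \<open>v\<close> and the quantified variable \<open>x\<close>, but \<open>x\<close> is not determined by
  \<open>v\<close>, then by the dichotomy \<open>u\<close> depends on \<open>x\<close> in a linear way, up to the elements
  \<open>\<rho>\<^sub>x u\<^sub>j - \<rho>\<^sub>j x\<close> of \<open>G\<close> that are determined by \<open>v\<close>.\<close>

lemma SP_exG:
  assumes "A \<in> SP"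
  shows "exG x A \<in> NF"
proof -
  obtain U P B \<Phi> where A: "A = exGs U (P \<inter> B \<inter> \<Phi>)" and s: "spec U P B \<Phi>" and U: "\<forall>i\<in>U. Suc x \<le> i"
    using SP_E[OF assms] .
  have xU: "x \<notin> U" using U by auto
  have fU: "finite U" and P: "P \<in> PP" "uniq U P" and B: "B \<in> BPP" and \<Phi>: "\<Phi> \<in> LD"
    using s by (auto simp: spec_def)
  have ex: "exG x A = exGs (insert x U) (P \<inter> B \<inter> \<Phi>)" unfolding A exGs_insert[OF xU] ..
  show ?thesis
  proof (cases "uniq (insert x U) P")
    case True
    then show ?thesis unfolding ex using fU P B \<Phi> by (intro SP_NF SPI) auto
  next
    case False
    then obtain u where u: "\<forall>i\<in>insert x U. u i \<in> G" "override_on (\<lambda>_. 0) u (insert x U) \<in> P"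
      "\<exists>i\<in>insert x U. u i \<noteq> 0" unfolding uniq_def by blast
    have ux: "u x \<noteq> 0"
    proof
      assume "u x = 0"
      then have "override_on (\<lambda>_. 0) u (insert x U) = override_on (\<lambda>_. 0) u U"
        by (auto simp: override_on_def)
      then have "override_on (\<lambda>_. 0) u U \<in> P" using u(2) by simp
      then have "\<forall>i\<in>U. u i = 0" using P(2) u(1) unfolding uniq_def by blast
      with u(3) \<open>u x = 0\<close> show False by blast
    qed
    have fxU: "finite (insert x U)" using fU by simp
    obtain \<rho> where \<rho>: "\<And>j. \<rho> j \<in> R" "\<rho> x \<noteq> 0" "\<And>j. j \<notin> insert x U \<Longrightarrow> \<rho> j = 0"
      "\<And>g. g \<in> G \<Longrightarrow> (\<lambda>j. \<rho> j *s g) \<in> P"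
      using PP_dichotomy[OF P(1) fxU _ u(2) insertI1 ux] u(1) by auto
    define r where "r = \<rho> x"
    have r: "r \<in> R" "r \<noteq> 0" using \<rho> by (auto simp: r_def)
    \<comment> \<open>Change of variables: the new witnesses are
      \<open>w\<^sub>j = r u\<^sub>j - \<rho>\<^sub>j x\<close>, and \<open>\<sigma>\<close>
      recovers \<open>u\<^sub>j\<close> from them by division by \<open>r\<close>. For an arbitrary
      \<open>w\<close> in \<open>G\<close> the result need not lie in \<open>G\<close>, and
      \<open>D\<close> demands that it does.\<close>
    define \<sigma> where "\<sigma> j = (if j \<in> U then [(1 / r, j), (\<rho> j / r, x)] else [(1, j)])" for j
    define pb where "pb X = {v \<in> Val. (\<lambda>i. lf (\<sigma> i) v) \<in> X}" for X
    define D where "D = Val \<inter> \<Inter>((\<lambda>j. {v \<in> Val. lf (\<sigma> j) v \<in> G}) ` U)"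
    define X1 where "X1 = (pb P \<inter> D) \<inter> (pb B \<inter> pb \<Phi>)"
    have D: "D \<in> PP" unfolding D_def using fU PP_lf_G by (intro PP_Inter) auto
    have pbP: "pb P \<inter> D \<in> PP" unfolding pb_def by (intro PP_Int PP_subst P D)
    have X1V: "X1 \<subseteq> Val" by (auto simp: X1_def pb_def)
    have \<sigma>: "lf (\<sigma> j) v = (if j \<in> U then (1 / r) *s v j + (\<rho> j / r) *s v x else v j)" for j v
      by (simp add: \<sigma>_def lin_Cons)
    have "exGs (insert x U) (P \<inter> B \<inter> \<Phi>) = exGs (insert x U) X1"
    proof (intro equalityI subsetI)
      fix v assume "v \<in> exGs (insert x U) (P \<inter> B \<inter> \<Phi>)"
      then obtain u where v: "v \<in> Val" and u: "\<forall>i\<in>insert x U. u i \<in> G"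
        "override_on v u (insert x U) \<in> P \<inter> B \<inter> \<Phi>" by (auto simp: exGs_def)
      define w where "w j = (if j = x then u x else r *s u j - \<rho> j *s u x)" for j
      have w: "\<forall>i\<in>insert x U. w i \<in> G" using u(1) \<rho>(1) r by (auto simp: w_def intro!: G_minus G_scale)
      have eq: "lf (\<sigma> j) (override_on v w (insert x U)) = override_on v u (insert x U) j" for j
        using xU r by (auto simp: \<sigma> override_on_def w_def scale_right_diff_distrib)
      have "override_on v w (insert x U) \<in> Val" using v w by (intro Val_override) auto
      moreover have "override_on v u (insert x U) j \<in> G" if "j \<in> U" for j
        using u(1) that by (simp add: override_on_def)
      ultimately have "override_on v w (insert x U) \<in> X1"
        using u(2) by (simp add: X1_def pb_def D_def eq)
      then show "v \<in> exGs (insert x U) X1" using v w unfolding exGs_def by blast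
    next
      fix v assume "v \<in> exGs (insert x U) X1"
      then obtain w where v: "v \<in> Val" and w: "\<forall>i\<in>insert x U. w i \<in> G"
        "override_on v w (insert x U) \<in> X1" by (auto simp: exGs_def)
      define u where "u j = lf (\<sigma> j) (override_on v w (insert x U))" for j
      have "(\<lambda>j. lf (\<sigma> j) (override_on v w (insert x U))) = override_on v u (insert x U)"
        using xU by (auto simp: u_def override_on_def \<sigma>)
      then have "override_on v u (insert x U) \<in> P \<inter> B \<inter> \<Phi>" using w(2) by (auto simp: X1_def pb_def)
      moreover have "u j \<in> G" if "j \<in> insert x U" for j
      proof (cases "j = x")
        case True
        then show ?thesis using w(1) xU by (simp add: u_def \<sigma> override_on_def)
      next
        case False
        then show ?thesis using w(2) that by (auto simp: u_def X1_def D_def)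
      qed
      ultimately show "v \<in> exGs (insert x U) (P \<inter> B \<inter> \<Phi>)" using v unfolding exGs_def by blast
    qed
    also have "\<dots> = exGs U (exG x X1)" using exGs_exGs[of U "{x}" X1] exG_exGs[OF X1V, of x] by simp
    \<comment> \<open>The set stays the same, but now it displays a set in \<open>PP\<close> that
      determines the block \<open>U\<close> without reference to \<open>x\<close>, as
      \<open>NF_wrap\<close> requires.\<close>
    also have "exG x X1 = exG x (pb P \<inter> D) \<inter> exG x X1" by (auto simp: X1_def exG_def)
    also have "exGs U \<dots> \<in> NF"
    proof (rule NF_wrap[OF fU PP_exG[OF pbP]])
      show "uniq U (exG x (pb P \<inter> D))"
        unfolding uniq_def
      proof (intro allI impI)
        fix w assume w: "\<forall>i\<in>U. w i \<in> G" "override_on (\<lambda>_. 0) w U \<in> exG x (pb P \<inter> D)"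
        then obtain g where g: "g \<in> G" "(override_on (\<lambda>_. 0) w U)(x := g) \<in> pb P" by (auto simp: exG_def)
        define z where "z = (\<lambda>i. lf (\<sigma> i) ((override_on (\<lambda>_. 0) w U)(x := g)))"
        have "z \<in> P" using g(2) by (simp add: pb_def z_def)
        \<comment> \<open>Scaling by \<open>r\<close> and subtracting the solution on the line at
          \<open>g\<close> cancels the value at \<open>x\<close> and leaves \<open>w\<close> on
          \<open>U\<close>, so that uniqueness for \<open>U\<close> alone applies.\<close>
        then have "(\<lambda>i. r *s z i) \<in> P" by (rule PP_scale[OF P(1) r(1)])
        then have "(\<lambda>i. r *s z i - \<rho> i *s g) \<in> P" by (rule PP_diff[OF P(1) _ \<rho>(4)[OF g(1)]])
        moreover have "(\<lambda>i. r *s z i - \<rho> i *s g) = override_on (\<lambda>_. 0) w U"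
        proof
          fix i
          show "r *s z i - \<rho> i *s g = override_on (\<lambda>_. 0) w U i"
            using xU r \<rho>(3)[of i]
            by (auto simp: z_def \<sigma> override_on_def r_def scale_right_distrib)
        qed
        ultimately show "\<forall>i\<in>U. w i = 0" using P(2) w(1) unfolding uniq_def by simp
      qed
      have "X1 = ((pb P \<inter> D) \<inter> pb B) \<inter> pb \<Phi>" by (auto simp: X1_def)
      moreover have "(pb P \<inter> D) \<inter> pb B \<in> BPP"
        by (rule BPP_Int[OF PP_BPP[OF pbP]]) (simp add: pb_def BPP_subst B)
      moreover have "pb \<Phi> \<in> LD" unfolding pb_def by (rule LD_subst[OF \<Phi>])
      ultimately show "exG x X1 \<in> NF" using exG_base by simp
    qed
    finally show ?thesis unfolding ex .
  qed
qed

lemma NF_exG: "S \<in> NF \<Longrightarrow> exG x S \<in> NF"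
proof (induction rule: NF.induct)
  case (NF_insert A S)
  have "exG x (A \<union> S) = exG x A \<union> exG x S" by (auto simp: exG_def)
  then show ?case using NF_Un[OF SP_exG[OF NF_insert.hyps(1)] NF_insert.IH] by simp
qed (simp add: exG_def NF_empty)

lemma NF_exGs: "finite U \<Longrightarrow> S \<in> NF \<Longrightarrow> exGs U S \<in> NF"
proof (induction U rule: finite_induct)
  case empty
  then show ?case by (simp add: NF_sub)
next
  case (insert x U)
  then show ?case by (simp add: exGs_insert NF_exG)
qed

section \<open>Eliminating quantifiers over \<open>V\<close>\<close>

definition exV :: "nat \<Rightarrow> (nat \<Rightarrow> 'v) set \<Rightarrow> (nat \<Rightarrow> 'v) set" where
  "exV x A = {v \<in> Val. \<exists>a\<in>V. v(x := a) \<in> A}"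

definition coef :: "('k \<times> nat) list \<Rightarrow> nat \<Rightarrow> 'k" where
  "coef t y = (\<Sum>(c, i)\<leftarrow>t. if i = y then c else 0)"

lemma lf_upd: "lf t (v(y := g)) = lf (filter (\<lambda>p. snd p \<noteq> y) t) v + coef t y *s g"
  by (induction t) (auto simp: lin_Cons coef_def scale_left_distrib)

definition free_in :: "nat \<Rightarrow> (nat \<Rightarrow> 'v) set \<Rightarrow> bool" where
  "free_in x P \<longleftrightarrow> (\<forall>v\<in>Val. \<forall>a\<in>V. v(x := a) \<in> P \<longleftrightarrow> v \<in> P)"

text \<open>The list \<open>cs\<close> collects the coefficients of the variables quantified over
  \<open>G\<close>; co-density avoids finitely many sets of exactly this shape.\<close>

definition solves :: "nat \<Rightarrow> (nat \<Rightarrow> 'v) set \<Rightarrow> ('k \<times> nat) list \<Rightarrow> 'k list \<Rightarrow> bool" where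
  "solves x P t cs \<longleftrightarrow> x \<notin> snd ` set t \<and> (\<forall>v\<in>P. \<exists>gs. length gs = length cs \<and> set gs \<subseteq> G \<and>
     v x = lf t v + (\<Sum>i<length cs. cs ! i *s gs ! i))"

text \<open>An equation has coefficient 0 at \<open>x\<close> or can be solved for \<open>x\<close>.
  When another variable is quantified over \<open>G\<close>, its coefficient moves from the term
  \<open>t\<close> to the list \<open>cs\<close>; in an intersection one solved side is
  enough.\<close>

lemma PP_free_or_solves: "P \<in> PP \<Longrightarrow> free_in x P \<or> (\<exists>t cs. solves x P t cs)"
proof (induction rule: PP.induct)
  case (PP_lin t)
  let ?t = "filter (\<lambda>p. snd p \<noteq> x) t"
  have lft: "lf t v = lf ?t v + coef t x *s v x" for v using lf_upd[of t v x "v x"] by simp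
  show ?case
  proof (cases "coef t x = 0")
    case True
    have "lf t (v(x := a)) = lf t v" for v a using lf_upd[of t v x a] lft[of v] True by simp
    then show ?thesis by (auto simp: free_in_def)
  next
    case False
    let ?s = "map (\<lambda>(d, j). ((- 1 / coef t x) * d, j)) ?t"
    have "solves x {v \<in> Val. lf t v = 0} ?s []"
      unfolding solves_def
    proof (intro conjI ballI exI[of _ "[]"])
      show "x \<notin> snd ` set ?s" by auto
      fix v assume "v \<in> {v \<in> Val. lf t v = 0}"
      then have "coef t x *s v x = - lf ?t v" using lft[of v] by (simp add: eq_neg_iff_add_eq_0 add.commute)
      then have "(1 / coef t x) *s coef t x *s v x = (1 / coef t x) *s (- lf ?t v)" by simp
      then show "v x = lf ?s v + (\<Sum>i<length []. [] ! i *s [] ! i)"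
        unfolding lf_map_scale using False by simp
    qed auto
    then show ?thesis by blast
  qed
next
  case (PP_Int A B)
  have 1: "solves x (A \<inter> B) t cs" if "solves x A t cs \<or> solves x B t cs" for t cs
    using that unfolding solves_def by blast
  show ?case
  proof (cases "free_in x A \<and> free_in x B")
    case True
    then show ?thesis by (simp add: free_in_def)
  next
    case False
    then show ?thesis using PP_Int.IH 1 by blast
  qed
next
  case (PP_exG A y)
  show ?case
  proof (cases "y = x")
    case True
    then show ?thesis by (simp add: free_in_def exG_def)
  next
    case False
    from PP_exG.IH show ?thesis
    proof
      assume f: "free_in x A"
      have "v(x := a) \<in> exG y A \<longleftrightarrow> v \<in> exG y A" if "v \<in> Val" "a \<in> V" for v a
      proof -
        have "(v(x := a))(y := g) \<in> A \<longleftrightarrow> v(y := g) \<in> A" if "g \<in> G" for g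
          using f[unfolded free_in_def, rule_format, of "v(y := g)" a] \<open>v \<in> Val\<close> \<open>a \<in> V\<close> that False
          by (simp add: fun_upd_twist)
        then show ?thesis using that by (simp add: exG_def)
      qed
      then show ?thesis by (simp add: free_in_def)
    next
      assume "\<exists>t cs. solves x A t cs"
      then obtain t cs where s: "solves x A t cs" by blast
      have "solves x (exG y A) (filter (\<lambda>p. snd p \<noteq> y) t) (coef t y # cs)"
        unfolding solves_def
      proof (intro conjI ballI)
        show "x \<notin> snd ` set (filter (\<lambda>p. snd p \<noteq> y) t)" using s by (auto simp: solves_def)
        fix v assume "v \<in> exG y A"
        then obtain g where g: "g \<in> G" "v(y := g) \<in> A" by (auto simp: exG_def)
        then obtain gs where gs: "length gs = length cs" "set gs \<subseteq> G"
          "(v(y := g)) x = lf t (v(y := g)) + (\<Sum>i<length cs. cs ! i *s gs ! i)"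
          using s unfolding solves_def by blast
        show "\<exists>gs. length gs = length (coef t y # cs) \<and> set gs \<subseteq> G \<and>
          v x = lf (filter (\<lambda>p. snd p \<noteq> y) t) v + (\<Sum>i<length (coef t y # cs). (coef t y # cs) ! i *s gs ! i)"
          using gs g False
          by (intro exI[of _ "g # gs"]) (simp del: sum.lessThan_Suc add: lf_upd sum.lessThan_Suc_shift)
      qed
      then show ?thesis by blast
    qed
  qed
qed

text \<open>If the witness \<open>x\<close> lies in some set of \<open>sol\<close>, it is a term
  plus a combination of elements of \<open>G\<close>, and the quantifier over \<open>V\<close> turns
  into quantifiers over \<open>G\<close>, which are eliminated already. Otherwise a finite fibre of
  \<open>\<Phi>\<close> makes \<open>x\<close> a term, and in an infinite fibre co-density finds a
  point outside all sets of \<open>sol\<close>.\<close>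

lemma exV_base:
  assumes B: "B \<in> BPP" and \<Phi>: "\<Phi> \<in> LD"
  shows "exV x (B \<inter> \<Phi>) \<in> NF"
proof -
  obtain \<P> where P: "finite \<P>" "\<P> \<subseteq> PP" "det \<P> B"
    using B by (rule BPPE)
  define sol where "sol = {P \<in> \<P>. \<not> free_in x P}"
  have sol: "finite sol" "sol \<subseteq> PP" using P by (auto simp: sol_def)
  have "\<forall>P\<in>sol. \<exists>p. solves x P (fst p) (snd p)"
    using PP_free_or_solves sol unfolding sol_def by fastforce
  from bchoice[OF this] obtain tc where tc: "\<forall>P\<in>sol. solves x P (fst (tc P)) (snd (tc P))" by (elim exE)
  obtain T where T: "finite T" "\<forall>t\<in>T. x \<notin> snd ` set t"
    "\<forall>v\<in>Val. finite (fiber x \<Phi> v) \<longrightarrow> fiber x \<Phi> v \<subseteq> (\<lambda>t. lf t v) ` T"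
    using LD_alg[OF \<Phi>, of x] by (elim exE conjE)
  \<comment> \<open>Some truth pattern allowed by \<open>B\<close> makes all sets of
    \<open>sol\<close> false and agrees with \<open>v\<close> on the sets that ignore
    \<open>x\<close>. The valuation \<open>w\<close> merely names the pattern and need not resemble
    \<open>v\<close> otherwise.\<close>
  define B0 where "B0 = {v \<in> Val. \<exists>w\<in>Val. w \<in> B \<and> w \<notin> \<Union>sol \<and> (\<forall>P\<in>\<P> - sol. w \<in> P \<longleftrightarrow> v \<in> P)}"
  have B0: "B0 \<in> BPP"
  proof (rule BPPI[of _ "\<P> - sol"])
    fix v w assume vw: "v \<in> Val" "w \<in> Val" "\<And>P. P \<in> \<P> - sol \<Longrightarrow> v \<in> P \<longleftrightarrow> w \<in> P" "v \<in> B0"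
    then obtain z where z: "z \<in> Val" "z \<in> B" "z \<notin> \<Union>sol" "\<forall>P\<in>\<P> - sol. z \<in> P \<longleftrightarrow> v \<in> P"
      by (auto simp: B0_def)
    have "\<forall>P\<in>\<P> - sol. z \<in> P \<longleftrightarrow> w \<in> P"
    proof
      fix P assume "P \<in> \<P> - sol"
      then show "z \<in> P \<longleftrightarrow> w \<in> P" using z(4) vw(3)[of P] by metis
    qed
    then show "w \<in> B0" using z vw unfolding B0_def by blast
  qed (use P in \<open>auto simp: B0_def\<close>)
  define I where "I = {v \<in> Val. infinite (fiber x \<Phi> v)}"
  have free: "v(x := a) \<in> P \<longleftrightarrow> v \<in> P" if "P \<in> \<P> - sol" "v \<in> Val" "a \<in> V" for P v a
    using that by (simp add: sol_def free_in_def)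
  have "exV x (B \<inter> \<Phi>) = (\<Union>P\<in>sol. exV x (P \<inter> (B \<inter> \<Phi>))) \<union>
      ((B0 \<inter> I) \<union> (\<Union>t\<in>T. {v \<in> Val. v(x := lf t v) \<in> B \<inter> \<Phi>}))" (is "?L = ?R")
  proof (intro equalityI subsetI)
    fix v assume "v \<in> ?L"
    then obtain a where v: "v \<in> Val" and a: "a \<in> V" "v(x := a) \<in> B" "v(x := a) \<in> \<Phi>" by (auto simp: exV_def)
    show "v \<in> ?R"
    proof (cases "v(x := a) \<in> \<Union>sol")
      case True
      then show ?thesis using v a by (auto simp: exV_def)
    next
      case ns: False
      show ?thesis
      proof (cases "infinite (fiber x \<Phi> v)")
        case True
        have "v \<in> B0" unfolding B0_def
          using v a ns free[of _ v a] by (intro CollectI conjI bexI[of _ "v(x := a)"]) auto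
        then show ?thesis using v True by (auto simp: I_def)
      next
        case False
        then have "fiber x \<Phi> v \<subseteq> (\<lambda>t. lf t v) ` T" using T(3) v by blast
        then obtain t where "t \<in> T" "a = lf t v" using a by blast
        then show ?thesis using v a by auto
      qed
    qed
  next
    fix v assume "v \<in> ?R"
    then consider "v \<in> (\<Union>P\<in>sol. exV x (P \<inter> (B \<inter> \<Phi>)))"
      | "v \<in> (\<Union>t\<in>T. {v \<in> Val. v(x := lf t v) \<in> B \<inter> \<Phi>})" | "v \<in> B0" "v \<in> I" by blast
    then show "v \<in> ?L"
    proof cases
      case 1
      then show ?thesis by (auto simp: exV_def)
    next
      case 2
      then show ?thesis by (auto simp: exV_def intro: lf_V)
    next
      case 3
      then obtain z where v: "v \<in> Val" and z: "z \<in> Val" "z \<in> B" "z \<notin> \<Union>sol" "\<forall>P\<in>\<P> - sol. z \<in> P \<longleftrightarrow> v \<in> P"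
        by (auto simp: B0_def)
      \<comment> \<open>One pair for each set of \<open>sol\<close>: the value of its term at
        \<open>v\<close> and its coefficients for \<open>G\<close>. A point that co-density keeps
        off all of these belongs to no set of \<open>sol\<close>.\<close>
      define C where "C = (\<lambda>P. (lf (fst (tc P)) v, snd (tc P))) ` sol"
      have C: "finite C" "fst ` C \<subseteq> V" using sol v by (auto simp: C_def intro: lf_V)
      have "infinite (fiber x \<Phi> v)" using 3 by (simp add: I_def)
      from codens[OF \<Phi> v this C] obtain a where a: "a \<in> V" "v(x := a) \<in> \<Phi>"
        and av: "\<forall>(b, cs)\<in>C. \<forall>gs. length gs = length cs \<and> set gs \<subseteq> G \<longrightarrow>
           a \<noteq> b + (\<Sum>i<length cs. cs ! i *s gs ! i)" by blast
      have ns: "v(x := a) \<notin> P" if P': "P \<in> sol" for P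
      proof
        assume "v(x := a) \<in> P"
        moreover have s: "solves x P (fst (tc P)) (snd (tc P))" using tc P' by blast
        ultimately obtain gs where gs: "length gs = length (snd (tc P))" "set gs \<subseteq> G"
          "(v(x := a)) x = lf (fst (tc P)) (v(x := a)) + (\<Sum>i<length (snd (tc P)). snd (tc P) ! i *s gs ! i)"
          unfolding solves_def by blast
        have "lf (fst (tc P)) (v(x := a)) = lf (fst (tc P)) v"
          using s unfolding solves_def by (intro lin_cong) force
        moreover have "(lf (fst (tc P)) v, snd (tc P)) \<in> C" using P' by (auto simp: C_def)
        ultimately show False using av gs by fastforce
      qed
      have "v(x := a) \<in> Q \<longleftrightarrow> z \<in> Q" if Q: "Q \<in> \<P>" for Q
      proof (cases "Q \<in> sol")
        case True
        then show ?thesis using ns z by blast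
      next
        case False
        then show ?thesis using free[of Q v a] z(4) Q v a by blast
      qed
      then have "v(x := a) \<in> B \<longleftrightarrow> z \<in> B"
        by (intro detD[OF P(3)]) (use v a z in auto)
      then show ?thesis using v a z by (auto simp: exV_def)
    qed
  qed
  also have "\<dots> \<in> NF"
  proof (intro NF_Un NF_UN NF_Int)
    show "B0 \<in> NF" by (rule BPP_NF[OF B0])
    show "I \<in> NF" unfolding I_def by (rule LD_NF_inf[OF \<Phi>])
    show "{v \<in> Val. v(x := lf t v) \<in> B \<inter> \<Phi>} \<in> NF" for t
      by (intro NF_subst1 SP_NF SP_base B \<Phi>)
    show "exV x (Q \<inter> (B \<inter> \<Phi>)) \<in> NF" if Q: "Q \<in> sol" for Q
    proof -
      define S where "S = Q \<inter> (B \<inter> \<Phi>)"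
      have S: "S \<in> NF" unfolding S_def using Q sol by (intro NF_Int BPP_NF PP_BPP B LD_NF \<Phi>) auto
      obtain t cs where s: "solves x Q t cs" using tc Q by blast
      obtain N0 where N0: "dep V S N0" using NF_dep[OF S] by blast
      obtain m where m: "\<forall>n\<in>snd ` set t. n < m"
        using finite_nat_set_iff_bounded[of "snd ` set t"] by auto
      define N where "N = max N0 (max (Suc x) m)"
      have N: "dep V S N" using N0 by (rule dep_mono) (simp add: N_def)
      have xN: "x < N" and tN: "\<And>n. n \<in> snd ` set t \<Longrightarrow> n < N" using m by (auto simp: N_def less_max_iff_disj)
      \<comment> \<open>Fresh variables for the elements of \<open>G\<close> that occur in the
        solution for \<open>x\<close>; the term \<open>t'\<close> built from them then replaces
        \<open>x\<close>.\<close>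
      define Z where "Z = {N..<N + length cs}"
      define t' where "t' = t @ map (\<lambda>i. (cs ! i, N + i)) [0..<length cs]"
      have lft': "lf t' w = lf t w + (\<Sum>i<length cs. cs ! i *s w (N + i))" for w
        by (simp add: t'_def lin_append) (simp add: lin_def interv_sum_list_conv_sum_set_nat atLeast0LessThan comp_def)
      have agree: "lf t (override_on v u Z) = lf t v" for v u
        using tN by (intro lin_cong) (force simp: override_on_def Z_def)
      have "exV x S = exGs Z {v \<in> Val. v(x := lf t' v) \<in> S}"
      proof (intro equalityI subsetI)
        fix v assume "v \<in> exV x S"
        then obtain a where v: "v \<in> Val" and a: "a \<in> V" "v(x := a) \<in> S" by (auto simp: exV_def)
        then have "v(x := a) \<in> Q" by (auto simp: S_def)
        then obtain gs where gs: "length gs = length cs" "set gs \<subseteq> G"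
          "(v(x := a)) x = lf t (v(x := a)) + (\<Sum>i<length cs. cs ! i *s gs ! i)"
          using s unfolding solves_def by blast
        define u where "u i = gs ! (i - N)" for i
        have u: "\<forall>i\<in>Z. u i \<in> G" using gs by (auto simp: Z_def u_def subset_iff)
        have "lf t (v(x := a)) = lf t v" using s unfolding solves_def by (intro lin_cong) force
        moreover have "(\<Sum>i<length cs. cs ! i *s override_on v u Z (N + i)) = (\<Sum>i<length cs. cs ! i *s gs ! i)"
          by (intro sum.cong) (auto simp: override_on_def Z_def u_def)
        ultimately have eq: "lf t' (override_on v u Z) = a" using gs(3) by (simp add: lft' agree)
        have w: "override_on v u Z \<in> Val" using v u by (intro Val_override) auto
        have "(override_on v u Z)(x := a) \<in> S \<longleftrightarrow> v(x := a) \<in> S"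
          by (rule depD[OF N]) (use v w a in \<open>auto simp: override_on_def Z_def\<close>)
        then have "override_on v u Z \<in> {v \<in> Val. v(x := lf t' v) \<in> S}" using a w by (simp add: eq)
        then show "v \<in> exGs Z {v \<in> Val. v(x := lf t' v) \<in> S}" using v u unfolding exGs_def by blast
      next
        fix v assume "v \<in> exGs Z {v \<in> Val. v(x := lf t' v) \<in> S}"
        then obtain u where v: "v \<in> Val" and w: "override_on v u Z \<in> Val"
          "(override_on v u Z)(x := lf t' (override_on v u Z)) \<in> S" unfolding exGs_def by blast
        define a where "a = lf t' (override_on v u Z)"
        have a: "a \<in> V" unfolding a_def by (rule lf_V[OF w(1)])
        have "(override_on v u Z)(x := a) \<in> S \<longleftrightarrow> v(x := a) \<in> S"
          by (rule depD[OF N]) (use v w a in \<open>auto simp: override_on_def Z_def\<close>)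
        then show "v \<in> exV x S" using w v a by (auto simp: exV_def a_def)
      qed
      also have "\<dots> \<in> NF" by (intro NF_exGs NF_subst1 S) (simp add: Z_def)
      finally show ?thesis by (simp add: S_def)
    qed
  qed (use sol T in auto)
  finally show ?thesis .
qed

lemma NF_exV: "S \<in> NF \<Longrightarrow> exV x S \<in> NF"
proof (induction rule: NF.induct)
  case (NF_insert A S)
  obtain U P B \<Phi> where A: "A = exGs U (P \<inter> B \<inter> \<Phi>)" and s: "spec U P B \<Phi>" and U: "\<forall>i\<in>U. Suc x \<le> i"
    using SP_E[OF NF_insert.hyps(1)] .
  have xU: "x \<notin> U" using U by auto
  have tw: "override_on (v(x := a)) u U = (override_on v u U)(x := a)" for v u a
    using xU by (auto simp: override_on_def)
  have "exV x A = exGs U (exV x ((P \<inter> B) \<inter> \<Phi>))"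
  proof (intro equalityI subsetI)
    fix v assume "v \<in> exV x A"
    then obtain a u where v: "v \<in> Val" and a: "a \<in> V" and u: "\<forall>i\<in>U. u i \<in> G"
      "(override_on v u U)(x := a) \<in> P \<inter> B \<inter> \<Phi>" by (auto simp: exV_def A exGs_def tw)
    have "override_on v u U \<in> Val" using v u by (intro Val_override) auto
    then show "v \<in> exGs U (exV x ((P \<inter> B) \<inter> \<Phi>))" using v u a unfolding exGs_def exV_def by blast
  next
    fix v assume "v \<in> exGs U (exV x ((P \<inter> B) \<inter> \<Phi>))"
    then obtain a u where v: "v \<in> Val" and a: "a \<in> V" and u: "\<forall>i\<in>U. u i \<in> G"
      "(override_on v u U)(x := a) \<in> P \<inter> B \<inter> \<Phi>" unfolding exGs_def exV_def by blast
    then show "v \<in> exV x A" by (auto simp: exV_def A exGs_def tw)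
  qed
  also have "\<dots> \<in> NF"
    using s by (intro NF_exGs exV_base BPP_Int[OF PP_BPP]) (auto simp: spec_def)
  finally have "exV x A \<in> NF" .
  moreover have "exV x (A \<union> S) = exV x A \<union> exV x S" by (auto simp: exV_def)
  ultimately show ?case using NF_Un NF_insert.IH by simp
qed (simp add: exV_def NF_empty)

section \<open>Normal forms are NIP\<close>

lemma Val_splice: "range a \<subseteq> V \<Longrightarrow> range b \<subseteq> V \<Longrightarrow> splice_val X a b \<in> Val"
  unfolding vals_def by (simp add: range_splice_val)

lemma nip_Compl: "nip_set V S \<Longrightarrow> nip_set V (Val - S)"
  using nip_set_Compl by (simp add: vals_def)

lemma nip_Un:
  assumes "nip_set V S" "nip_set V T" "S \<subseteq> Val" "T \<subseteq> Val"
  shows "nip_set V (S \<union> T)"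
proof -
  have "nip_set V (Val - ((Val - S) \<inter> (Val - T)))" by (intro nip_Compl nip_set_Int assms)
  also have "Val - ((Val - S) \<inter> (Val - T)) = S \<union> T" using assms by blast
  finally show ?thesis .
qed

lemma nip_empty: "nip_set V {}"
  unfolding nip_set_def
proof (intro allI exI[of _ 1] notI)
  fix X :: "nat set" assume "shatters_val V {} X 1"
  then obtain a b where ab: "\<And>i. range (a i) \<subseteq> V" "\<And>I. range (b I) \<subseteq> V"
    "\<And>i I. i < (1::nat) \<Longrightarrow> I \<subseteq> {..<1} \<Longrightarrow> splice_val X (a i) (b I) \<in> {} \<longleftrightarrow> i \<in> I"
    by (rule shatters_valE) (rule that; assumption)
  from ab(3)[of 0 "{0}"] show False by simp
qed

text \<open>Splicing makes the valuation at \<open>(1, {0})\<close> equal to that at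
  \<open>(1, {0, 1})\<close> minus that at \<open>(0, {0, 1})\<close> plus that at
  \<open>(0, {0})\<close>. A group that contains these three contains the fourth.\<close>

lemma PP_nip:
  assumes P: "P \<in> PP"
  shows "nip_set V P"
  unfolding nip_set_def
proof (intro allI exI[of _ 2] notI)
  fix X :: "nat set" assume "shatters_val V P X 2"
  then obtain a b where V: "\<And>i. range (a i) \<subseteq> V" "\<And>I. range (b I) \<subseteq> V"
    and ab: "\<And>i I. i < (2::nat) \<Longrightarrow> I \<subseteq> {..<2} \<Longrightarrow> splice_val X (a i) (b I) \<in> P \<longleftrightarrow> i \<in> I"
    by (rule shatters_valE) (rule that; assumption)
  let ?v = "\<lambda>i I. splice_val X (a i) (b I)"
  have 1: "?v 1 {0, 1} \<in> P" "?v 0 {0, 1} \<in> P" "?v 0 {0} \<in> P" by (simp_all add: ab)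
  have "(\<lambda>z. (?v 1 {0, 1} z - ?v 0 {0, 1} z) + ?v 0 {0} z) \<in> P"
    by (intro PP_add[OF P] PP_diff[OF P] 1)
  also have "(\<lambda>z. (?v 1 {0, 1} z - ?v 0 {0, 1} z) + ?v 0 {0} z) = ?v 1 {0}"
    by (auto simp: splice_val_def)
  finally show False by (simp add: ab)
qed

lemma nip_UN:
  assumes "finite I" "\<And>i. i \<in> I \<Longrightarrow> nip_set V (f i) \<and> f i \<subseteq> Val"
  shows "nip_set V (\<Union>i\<in>I. f i)"
  using assms by (induction I rule: finite_induct) (auto intro!: nip_Un nip_empty)

lemma BPP_nip:
  assumes "B \<in> BPP"
  shows "nip_set V B"
proof -
  obtain \<P> where P: "finite \<P>" "\<P> \<subseteq> PP" "det \<P> B"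
    using assms by (rule BPPE)
  define cell where "cell \<Q> K = {v \<in> Val. \<forall>P\<in>\<Q>. v \<in> P \<longleftrightarrow> P \<in> K}" for \<Q> K :: "(nat \<Rightarrow> 'v) set set"
  have cell: "nip_set V (cell \<Q> K)" if "finite \<Q>" "\<Q> \<subseteq> PP" for \<Q> K
    using that
  proof (induction \<Q> rule: finite_induct)
    case empty
    have "cell {} K = Val - {}" by (simp add: cell_def)
    then show ?case using nip_Compl[OF nip_empty] by simp
  next
    case (insert P \<Q>)
    have "cell (insert P \<Q>) K = cell \<Q> K \<inter> (if P \<in> K then P else Val - P)"
      by (auto simp: cell_def)
    moreover have "nip_set V (if P \<in> K then P else Val - P)"
      using insert.prems by (auto intro: nip_Compl PP_nip)
    ultimately show ?case using insert by (simp add: nip_set_Int)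
  qed
  have "B = (\<Union>K\<in>{K. K \<subseteq> \<P> \<and> cell \<P> K \<inter> B \<noteq> {}}. cell \<P> K)"
  proof (intro equalityI subsetI)
    fix v assume v: "v \<in> B"
    then have "v \<in> cell \<P> {P \<in> \<P>. v \<in> P}" using BPP_sub[OF assms] by (auto simp: cell_def)
    then show "v \<in> (\<Union>K\<in>{K. K \<subseteq> \<P> \<and> cell \<P> K \<inter> B \<noteq> {}}. cell \<P> K)" using v by blast
  next
    fix v assume "v \<in> (\<Union>K\<in>{K. K \<subseteq> \<P> \<and> cell \<P> K \<inter> B \<noteq> {}}. cell \<P> K)"
    then obtain K w where v: "v \<in> cell \<P> K" and w: "w \<in> cell \<P> K" "w \<in> B" by blast
    have "v \<in> B \<longleftrightarrow> w \<in> B"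
      by (rule detD[OF P(3)]) (use v w in \<open>auto simp: cell_def\<close>)
    with w show "v \<in> B" by simp
  qed
  also have "nip_set V \<dots>" by (rule nip_UN) (use P cell in \<open>auto simp: cell_def\<close>)
  finally show ?thesis .
qed

text \<open>The witness \<open>u\<close> is an additive function of the valuation, so it splits into a part that only
  depends on the shattered points and a part that only depends on the parameters, once a point is
  sacrificed to keep all arguments in its domain.\<close>

lemma unique_witness_nip:
  assumes U: "finite U" and P: "P \<in> PP" "uniq U P" and \<Phi>: "\<Phi> \<in> LD"
  shows "nip_set V (exGs U (P \<inter> \<Phi>))"
  unfolding nip_set_def
proof
  fix X :: "nat set"
  obtain N0 where N0: "dep V \<Phi> N0" using LD_dep[OF \<Phi>] by blast
  obtain m where m: "\<forall>n\<in>U. n < m" using U finite_nat_set_iff_bounded[of U] by auto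
  define N where "N = max N0 m"
  have N: "dep V \<Phi> N" using N0 by (rule dep_mono) (simp add: N_def)
  have UN: "j < N" if "j \<in> U" for j using m that by (auto simp: N_def less_max_iff_disj)
  \<comment> \<open>A second copy of the witness variables: \<open>\<Phi>'\<close> uses the sum of
    the values at \<open>j\<close> and \<open>j + N\<close> as the witness at \<open>j\<close>. The
    first summand counts as an object variable and the second as a parameter, hence the form of
    \<open>X'\<close>.\<close>
  define W where "W = (\<lambda>j. j + N) ` U"
  define \<sigma> :: "nat \<Rightarrow> ('k \<times> nat) list"
    where "\<sigma> j = (if j \<in> U then [(1, j), (1, j + N)] else [(1, j)])" for j
  define \<Phi>' where "\<Phi>' = {v \<in> Val. (\<lambda>i. lf (\<sigma> i) v) \<in> \<Phi>}"
  define X' where "X' = X \<union> U - W"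
  have "\<Phi>' \<in> LD" unfolding \<Phi>'_def by (rule LD_subst[OF \<Phi>])
  then obtain n where n: "\<not> shatters_val V \<Phi>' X' n" using LD_nip unfolding nip_set_def by blast
  have "\<not> shatters_val V (exGs U (P \<inter> \<Phi>)) X (Suc n)"
  proof
    assume "shatters_val V (exGs U (P \<inter> \<Phi>)) X (Suc n)"
    then obtain a b where ab: "\<And>i. range (a i) \<subseteq> V" "\<And>I. range (b I) \<subseteq> V"
      "\<And>i I. i < Suc n \<Longrightarrow> I \<subseteq> {..<Suc n} \<Longrightarrow> splice_val X (a i) (b I) \<in> exGs U (P \<inter> \<Phi>) \<longleftrightarrow> i \<in> I"
      by (rule shatters_valE) (rule that; assumption)
    define v where "v i I = splice_val X (a i) (b I)" for i I
    have vV: "v i I \<in> Val" for i I unfolding v_def by (rule Val_splice[OF ab(1,2)])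
    define u where "u i I = (SOME u. (\<forall>j\<in>U. u j \<in> G) \<and> override_on (v i I) u U \<in> P \<inter> \<Phi>)" for i I
    have u: "j \<in> U \<Longrightarrow> u i I j \<in> G" "override_on (v i I) (u i I) U \<in> P"
      if "i < Suc n" "I \<subseteq> {..<Suc n}" "i \<in> I" for i I j
    proof -
      have "v i I \<in> exGs U (P \<inter> \<Phi>)" using ab(3)[OF that(1,2)] that(3) by (simp add: v_def)
      then have "\<exists>u. (\<forall>j\<in>U. u j \<in> G) \<and> override_on (v i I) u U \<in> P \<inter> \<Phi>" by (simp add: exGs_def)
      then have "(\<forall>j\<in>U. u i I j \<in> G) \<and> override_on (v i I) (u i I) U \<in> P \<inter> \<Phi>"
        unfolding u_def by (rule someI_ex)
      then show "j \<in> U \<Longrightarrow> u i I j \<in> G" "override_on (v i I) (u i I) U \<in> P" by auto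
    qed
    define F where "F = {..<Suc n}"
    \<comment> \<open>The change of the witness from point 0 to point \<open>i\<close>, measured at
      the full index set \<open>F\<close>, where both points have a witness. By additivity the same
      change is right for all other parameters.\<close>
    define d where "d i j = (if i < Suc n \<and> j \<in> U then u i F j - u 0 F j else 0)" for i j
    have dG: "d i j \<in> G" for i j using u(1)[of _ F j] by (auto simp: d_def F_def G_zero intro!: G_minus)
    \<comment> \<open>Point 0 is put into every index set, so that it has a witness for all
      parameters used; that witness is the summand that depends on the parameters. The remaining
      points are shifted by one, which is why \<open>Suc n\<close> points are shattered at the
      outset.\<close>
    define J where "J I = insert 0 (Suc ` (I \<inter> {..<n}))" for I
    have J: "J I \<subseteq> {..<Suc n}" "0 \<in> J I" for I by (auto simp: J_def)
    define a' where "a' i = override_on (a (Suc i)) (d (Suc i)) U" for i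
    define b' where "b' I j = (if j \<in> W then u 0 (J I) (j - N) else b (J I) j)" for I j
    have "shatters_val V \<Phi>' X' n"
      unfolding shatters_val_def
    proof (intro exI[of _ a'] exI[of _ b'] conjI allI impI)
      show a'V: "range (a' i) \<subseteq> V" for i
        using ab(1)[of "Suc i"] dG G_V by (auto simp: a'_def override_on_def)
      show b'V: "range (b' I) \<subseteq> V" for I
      proof
        fix y assume "y \<in> range (b' I)"
        then obtain j where j: "y = b' I j" by blast
        show "y \<in> V"
        proof (cases "j \<in> W")
          case True
          then obtain k where k: "k \<in> U" "j = k + N" by (auto simp: W_def)
          then have "y = u 0 (J I) k" using j True by (simp add: b'_def)
          then show ?thesis using u(1)[of 0 "J I" k] J[of I] k G_V by simp
        next
          case False
          then show ?thesis using ab(2)[of "J I"] j by (auto simp: b'_def)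
        qed
      qed
      fix i I assume i: "i < n" and I: "I \<subseteq> {..<n}"
      define w where "w = splice_val X' (a' i) (b' I)"
      define z where "z = override_on (v (Suc i) (J I)) (\<lambda>j. d (Suc i) j + u 0 (J I) j) U"
      have wV: "w \<in> Val" unfolding w_def by (rule Val_splice[OF a'V b'V])
      have zG: "d (Suc i) j + u 0 (J I) j \<in> G" if "j \<in> U" for j
        using dG u(1)[of 0 "J I" j] J[of I] that by (auto intro: G_add)
      have zV: "z \<in> Val" unfolding z_def by (rule Val_override[OF vV zG])
      have "(\<lambda>j. lf (\<sigma> j) w) \<in> \<Phi> \<longleftrightarrow> z \<in> \<Phi>"
      proof (rule depD[OF N Val_lf[OF wV] zV])
        fix j assume j: "j < N"
        then have jW: "j \<notin> W" by (auto simp: W_def)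
        show "lf (\<sigma> j) w = z j"
        proof (cases "j \<in> U")
          case True
          then have "j \<in> X'" "j + N \<in> W" "j + N \<notin> X'" using jW by (auto simp: X'_def W_def)
          then show ?thesis using True
            by (simp add: \<sigma>_def lin_Cons w_def splice_val_def a'_def b'_def z_def override_on_def)
        next
          case False
          then have "j \<in> X' \<longleftrightarrow> j \<in> X" using jW by (auto simp: X'_def)
          then show ?thesis using False jW
            by (simp add: \<sigma>_def w_def splice_val_def a'_def b'_def z_def override_on_def v_def)
        qed
      qed
      then have 1: "w \<in> \<Phi>' \<longleftrightarrow> z \<in> \<Phi>" using wV by (simp add: \<Phi>'_def)
      have "(\<lambda>j. (override_on (v (Suc i) F) (u (Suc i) F) U j - override_on (v 0 F) (u 0 F) U j) +
          override_on (v 0 (J I)) (u 0 (J I)) U j) \<in> P"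
        by (intro PP_add[OF P(1)] PP_diff[OF P(1)] u(2)) (use i J[of I] in \<open>auto simp: F_def\<close>)
      also have "(\<lambda>j. (override_on (v (Suc i) F) (u (Suc i) F) U j - override_on (v 0 F) (u 0 F) U j) +
          override_on (v 0 (J I)) (u 0 (J I)) U j) = z"
        using i by (auto simp: z_def override_on_def v_def splice_val_def d_def)
      finally have zP: "z \<in> P" .
      have "v (Suc i) (J I) \<in> exGs U (P \<inter> \<Phi>) \<longleftrightarrow> z \<in> \<Phi>"
      proof
        assume "v (Suc i) (J I) \<in> exGs U (P \<inter> \<Phi>)"
        then obtain u' where u': "\<forall>j\<in>U. u' j \<in> G" "override_on (v (Suc i) (J I)) u' U \<in> P \<inter> \<Phi>"
          by (auto simp: exGs_def)
        have "override_on (v (Suc i) (J I)) u' U = z"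
          unfolding z_def
          by (rule uniq_eq[OF P(2,1)]) (use u' zG zP in \<open>auto simp: z_def\<close>)
        then show "z \<in> \<Phi>" using u' by simp
      next
        assume "z \<in> \<Phi>"
        with zP have "z \<in> P \<inter> \<Phi>" by simp
        then show "v (Suc i) (J I) \<in> exGs U (P \<inter> \<Phi>)"
          unfolding exGs_def z_def
          by (intro CollectI conjI vV exI[of _ "\<lambda>j. d (Suc i) j + u 0 (J I) j"]) (use zG in auto)
      qed
      also have "v (Suc i) (J I) \<in> exGs U (P \<inter> \<Phi>) \<longleftrightarrow> Suc i \<in> J I"
        unfolding v_def using i J[of I] by (intro ab(3)) auto
      also have "Suc i \<in> J I \<longleftrightarrow> i \<in> I" using i by (auto simp: J_def)
      finally show "splice_val X' (a' i) (b' I) \<in> \<Phi>' \<longleftrightarrow> i \<in> I" using 1 by (simp add: w_def)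
    qed
    with n show False by blast
  qed
  then show "\<exists>n. \<not> shatters_val V (exGs U (P \<inter> \<Phi>)) X n" by blast
qed

text \<open>As the witness is unique, the quantifier commutes with the conjunction, and
  \<open>B\<close> and \<open>\<Phi>\<close> can be dealt with separately.\<close>

lemma SP_nip:
  assumes "A \<in> SP"
  shows "nip_set V A"
proof -
  from assms obtain U P B \<Phi> where A: "A = exGs U (P \<inter> B \<inter> \<Phi>)" and s: "spec U P B \<Phi>"
    unfolding SP_def by blast
  have P: "finite U" "P \<in> PP" "uniq U P" "B \<in> BPP" "\<Phi> \<in> LD" using s by (auto simp: spec_def)
  have "A = exGs U (P \<inter> B) \<inter> exGs U (P \<inter> \<Phi>)"
  proof (intro equalityI subsetI)
    fix v assume "v \<in> exGs U (P \<inter> B) \<inter> exGs U (P \<inter> \<Phi>)"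
    then obtain u u' where v: "v \<in> Val" and u: "\<forall>i\<in>U. u i \<in> G" "override_on v u U \<in> P \<inter> B"
      and u': "\<forall>i\<in>U. u' i \<in> G" "override_on v u' U \<in> P \<inter> \<Phi>" by (auto simp: exGs_def)
    have "override_on v u U = override_on v u' U"
      by (rule uniq_eq[OF P(3,2)]) (use u u' in auto)
    then have "override_on v u U \<in> P \<inter> B \<inter> \<Phi>" using u u' by simp
    then show "v \<in> A" using v u unfolding A exGs_def by blast
  qed (auto simp: A exGs_def)
  then show ?thesis
    using P by (simp add: nip_set_Int BPP_nip BPP_exGs BPP_Int PP_BPP unique_witness_nip)
qed

theorem NF_nip: "S \<in> NF \<Longrightarrow> nip_set V S"
proof (induction rule: NF.induct)
  case (NF_insert A S)
  show ?case
    by (rule nip_Un[OF SP_nip[OF NF_insert.hyps(1)] NF_insert.IH SP_sub[OF NF_insert.hyps(1)]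
        NF_sub[OF NF_insert.hyps(2)]])
qed (rule nip_empty)

end

section \<open>Skolem hulls in ultrapowers\<close>

lemma eval_tm_cong: "(\<And>i. i \<in> fv_tm t \<Longrightarrow> v i = w i) \<Longrightarrow> eval_tm M v t = eval_tm M w t"
proof (induction t)
  case (Fn f ts)
  then have "map (eval_tm M v) ts = map (eval_tm M w) ts" by (intro map_cong) auto
  then show ?case by (simp only: eval_tm.simps)
qed simp

lemma sat_cong: "(\<And>i. i \<in> fv \<phi> \<Longrightarrow> v i = w i) \<Longrightarrow> sat M v \<phi> \<longleftrightarrow> sat M w \<phi>"
proof (induction \<phi> arbitrary: v w)
  case (Eq s t)
  have "eval_tm M v s = eval_tm M w s" "eval_tm M v t = eval_tm M w t"
    by (rule eval_tm_cong, rule Eq.prems, simp)+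
  then show ?case by simp
next
  case (Pred p ts)
  have "map (eval_tm M v) ts = map (eval_tm M w) ts"
    by (intro map_cong refl eval_tm_cong Pred.prems) auto
  then show ?case by (simp only: sat.simps)
next
  case (Neg \<phi>)
  have "sat M v \<phi> \<longleftrightarrow> sat M w \<phi>" by (rule Neg.IH, rule Neg.prems, simp)
  then show ?case by simp
next
  case (And \<phi> \<psi>)
  have "sat M v \<phi> \<longleftrightarrow> sat M w \<phi>" by (rule And.IH, rule And.prems, simp)
  moreover have "sat M v \<psi> \<longleftrightarrow> sat M w \<psi>" by (rule And.IH, rule And.prems, simp)
  ultimately show ?case by simp
next
  case (Exi x \<phi>)
  have "sat M (v(x := a)) \<phi> \<longleftrightarrow> sat M (w(x := a)) \<phi>" for a
    by (rule Exi.IH) (use Exi.prems in auto)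
  then show ?case by simp
qed

lemma finite_fv_tm: "finite (fv_tm t)"
  by (induction t) auto

lemma finite_fv: "finite (fv \<phi>)"
  by (induction \<phi>) (auto simp: finite_fv_tm)

lemma fv_bound: obtains N where "\<forall>i\<in>fv \<phi>. i < N"
proof -
  obtain N where "\<forall>i\<in>fv \<phi>. i < N"
    using finite_fv[of \<phi>] unfolding finite_nat_set_iff_bounded by (elim exE)
  then show thesis by (rule that)
qed

lemma fv_tm_bound: obtains N where "\<forall>i\<in>fv_tm t. i < N"
proof -
  obtain N where "\<forall>i\<in>fv_tm t. i < N"
    using finite_fv_tm[of t] unfolding finite_nat_set_iff_bounded by (elim exE)
  then show thesis by (rule that)
qed

lemma eval_tm_Dom:
  assumes "is_struct L M" "range v \<subseteq> Dom M" "wf_tm L t"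
  shows "eval_tm M v t \<in> Dom M"
  using assms(3)
proof (induction t)
  case (Fn f ts)
  then have "set (map (eval_tm M v) ts) \<subseteq> Dom M" by auto
  then show ?case using Fn.prems assms(1) unfolding is_struct_def by (simp del: set_map)
qed (use assms in auto)

section \<open>Ultrafilters\<close>

definition ultra :: "'i set set \<Rightarrow> bool" where
  "ultra U \<longleftrightarrow> {} \<notin> U \<and> (\<forall>A\<in>U. \<forall>B\<in>U. A \<inter> B \<in> U) \<and> (\<forall>A\<in>U. \<forall>B. A \<subseteq> B \<longrightarrow> B \<in> U) \<and> (\<forall>A. A \<in> U \<or> - A \<in> U)"

lemma ultraD:
  assumes "ultra U"
  shows "{} \<notin> U" "A \<in> U \<Longrightarrow> B \<in> U \<Longrightarrow> A \<inter> B \<in> U" "A \<in> U \<Longrightarrow> A \<subseteq> B \<Longrightarrow> B \<in> U"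
    "- A \<in> U \<longleftrightarrow> A \<notin> U" "UNIV \<in> U"
proof -
  show 1: "{} \<notin> U" and 2: "\<And>A B. A \<in> U \<Longrightarrow> B \<in> U \<Longrightarrow> A \<inter> B \<in> U"
    and "A \<in> U \<Longrightarrow> A \<subseteq> B \<Longrightarrow> B \<in> U"
    using assms by (simp_all add: ultra_def)
  show "- A \<in> U \<longleftrightarrow> A \<notin> U"
  proof
    assume "- A \<in> U"
    then show "A \<notin> U" using 1 2[of "- A" A] by auto
  qed (use assms in \<open>auto simp: ultra_def\<close>)
  have "{} \<in> U \<or> - {} \<in> U" using assms unfolding ultra_def by blast
  with 1 show "UNIV \<in> U" by simp
qed

text \<open>A family that is maximal for the finite intersection property contains every set that
  meets all its finite intersections. If both \<open>A\<close> and its complement failed to do so,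
  two finite intersections would be disjoint.\<close>

lemma ultra_exists:
  fixes \<B> :: "'i set set"
  assumes fip: "\<And>F. finite F \<Longrightarrow> F \<subseteq> \<B> \<Longrightarrow> \<Inter>F \<noteq> {}"
  shows "\<exists>U. ultra U \<and> \<B> \<subseteq> U"
proof -
  define \<A> where "\<A> = {C :: 'i set set. \<B> \<subseteq> C \<and> (\<forall>F. finite F \<and> F \<subseteq> C \<longrightarrow> \<Inter>F \<noteq> {})}"
  have "\<exists>M\<in>\<A>. \<forall>X\<in>\<A>. M \<subseteq> X \<longrightarrow> X = M"
  proof (rule subset_Zorn_nonempty)
    show "\<A> \<noteq> {}" using fip by (auto simp: \<A>_def)
    fix \<C> assume ne: "\<C> \<noteq> {}" and ch: "subset.chain \<A> \<C>"
    have "\<Inter>F \<noteq> {}" if F: "finite F" "F \<subseteq> \<Union>\<C>" for F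
    proof -
      obtain C where "C \<in> \<C>" "F \<subseteq> C"
        using finite_subset_Union_chain[OF F ne ch] by blast
      then show ?thesis using ch F(1) unfolding subset.chain_def \<A>_def by blast
    qed
    moreover have "\<B> \<subseteq> \<Union>\<C>" using ne ch unfolding subset.chain_def \<A>_def by blast
    ultimately show "\<Union>\<C> \<in> \<A>" by (simp add: \<A>_def)
  qed
  then obtain U where U: "U \<in> \<A>" and max: "\<forall>X\<in>\<A>. U \<subseteq> X \<longrightarrow> X = U" by blast
  have fipU: "\<Inter>F \<noteq> {}" if "finite F" "F \<subseteq> U" for F using U that by (simp add: \<A>_def)
  have mem: "A \<in> U" if A: "\<And>F. finite F \<Longrightarrow> F \<subseteq> U \<Longrightarrow> A \<inter> \<Inter>F \<noteq> {}" for A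
  proof -
    have "\<Inter>F \<noteq> {}" if F: "finite F" "F \<subseteq> insert A U" for F
    proof -
      have "A \<inter> \<Inter>(F - {A}) \<noteq> {}" using F by (intro A) auto
      moreover have "A \<inter> \<Inter>(F - {A}) \<subseteq> \<Inter>F" by blast
      ultimately show ?thesis by blast
    qed
    then have "insert A U \<in> \<A>" using U by (auto simp: \<A>_def)
    then have "insert A U = U" using max by blast
    then show ?thesis by blast
  qed
  have "ultra U"
    unfolding ultra_def
  proof (intro conjI ballI allI impI)
    show "{} \<notin> U" using fipU[of "{{}}"] by auto
  next
    fix A B assume AB: "A \<in> U" "B \<in> U"
    show "A \<inter> B \<in> U"
    proof (rule mem)
      fix F assume "finite F" "F \<subseteq> U"
      then have "\<Inter>(insert A (insert B F)) \<noteq> {}" using AB by (intro fipU) auto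
      then show "A \<inter> B \<inter> \<Inter>F \<noteq> {}" by (simp add: Int_assoc)
    qed
  next
    fix A B assume AB: "A \<in> U" "A \<subseteq> B"
    show "B \<in> U"
    proof (rule mem)
      fix F assume "finite F" "F \<subseteq> U"
      then have "\<Inter>(insert A F) \<noteq> {}" using AB by (intro fipU) auto
      then show "B \<inter> \<Inter>F \<noteq> {}" using AB by auto
    qed
  next
    fix A
    show "A \<in> U \<or> - A \<in> U"
    proof (rule ccontr)
      assume n: "\<not> (A \<in> U \<or> - A \<in> U)"
      then obtain F where F: "finite F" "F \<subseteq> U" "A \<inter> \<Inter>F = {}" using mem[of A] by blast
      from n obtain E where E: "finite E" "E \<subseteq> U" "- A \<inter> \<Inter>E = {}" using mem[of "- A"] by blast
      have "\<Inter>(F \<union> E) \<noteq> {}" using F E by (intro fipU) auto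
      then show False using F(3) E(3) by blast
    qed
  qed
  moreover have "\<B> \<subseteq> U" using U by (simp add: \<A>_def)
  ultimately show ?thesis by blast
qed

section \<open>Skolem terms and their hull\<close>

text \<open>\<open>SK \<phi> x ss\<close> applies the Skolem function for \<open>x\<close> in
  \<open>\<phi>\<close> to \<open>ss\<close>, read as values of the variables 0, 1 and so
  on.\<close>

datatype ('f, 'p) sk = SV nat | SK "('f, 'p) fm" nat "('f, 'p) sk list"

abbreviation (input) "verum \<equiv> Eq (Var 0) (Var 0)"

text \<open>Only the shape of the formula matters, not its truth: being injective, it shows that
  there are no more Skolem terms than formulas.\<close>

fun enc :: "('f, 'p) sk \<Rightarrow> ('f, 'p) fm" where
  "enc (SV n) = Exi n verum"
| "enc (SK \<phi> x ss) = And (And \<phi> (Exi x verum)) (foldr (\<lambda>s. And (enc s)) ss verum)"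

lemma enc_inj: "enc s = enc t \<Longrightarrow> s = t"
proof (induction s arbitrary: t)
  case (SV n)
  then show ?case by (cases t) auto
next
  case (SK \<phi> x ss)
  then obtain ts where t: "t = SK \<phi> x ts"
    and eq: "foldr (\<lambda>s. And (enc s)) ss verum = foldr (\<lambda>s. And (enc s)) ts verum"
    by (cases t) auto
  from eq SK.IH have "ss = ts"
  proof (induction ss arbitrary: ts)
    case Nil
    then show ?case by (cases ts) auto
  next
    case (Cons s ss)
    then obtain u us where ts: "ts = u # us" by (cases ts) auto
    then have "s = u" using Cons.prems by auto
    moreover have "ss = us" using Cons.prems ts by (intro Cons.IH) auto
    ultimately show ?case using ts by simp
  qed
  then show ?case using t by simp
qed

text \<open>The implication makes the choice total: without a witness any element of the domain is
  taken. Variables beyond the list are left undefined, which is harmless when the list covers the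
  free variables.\<close>

definition wit :: "('a, 'f, 'p) struct \<Rightarrow> ('f, 'p) fm \<Rightarrow> nat \<Rightarrow> 'a list \<Rightarrow> 'a" where
  "wit N \<phi> x as = (SOME a. a \<in> Dom N \<and>
     ((\<exists>a\<in>Dom N. sat N ((\<lambda>i. if i < length as then as ! i else undefined)(x := a)) \<phi>) \<longrightarrow>
       sat N ((\<lambda>i. if i < length as then as ! i else undefined)(x := a)) \<phi>))"

lemma wit:
  assumes "Dom N \<noteq> {}"
  shows "wit N \<phi> x as \<in> Dom N"
    "a \<in> Dom N \<Longrightarrow> sat N ((\<lambda>i. if i < length as then as ! i else undefined)(x := a)) \<phi> \<Longrightarrow>
      sat N ((\<lambda>i. if i < length as then as ! i else undefined)(x := wit N \<phi> x as)) \<phi>"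
proof -
  let ?s = "\<lambda>a. sat N ((\<lambda>i. if i < length as then as ! i else undefined)(x := a)) \<phi>"
  have ex: "\<exists>a. a \<in> Dom N \<and> ((\<exists>a\<in>Dom N. ?s a) \<longrightarrow> ?s a)" using assms by blast
  have "wit N \<phi> x as \<in> Dom N \<and> ((\<exists>a\<in>Dom N. ?s a) \<longrightarrow> ?s (wit N \<phi> x as))"
    unfolding wit_def by (rule someI_ex[OF ex])
  then show "wit N \<phi> x as \<in> Dom N" "a \<in> Dom N \<Longrightarrow> ?s a \<Longrightarrow> ?s (wit N \<phi> x as)" by blast+
qed

fun evs :: "('a, 'f, 'p) struct \<Rightarrow> (nat \<Rightarrow> 'a) \<Rightarrow> ('f, 'p) sk \<Rightarrow> 'a" where
  "evs N w (SV n) = w n"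
| "evs N w (SK \<phi> x ss) = wit N \<phi> x (map (evs N w) ss)"

text \<open>The elements of the ultrapower of \<open>N\<close> that are Skolem terms in the class of \<open>w\<close> form an
  elementary substructure. Skolem terms are coded by formulas, so that this structure lives on any
  type with as many elements as there are formulas.\<close>

locale skolem_hull =
  fixes L :: "('f, 'p) lang" and N :: "('a, 'f, 'p) struct" and w :: "'i \<Rightarrow> nat \<Rightarrow> 'a"
    and U :: "'i set set" and \<iota> :: "('f, 'p) fm \<Rightarrow> 'b"
  assumes str: "is_struct L N" and wN: "\<And>i. range (w i) \<subseteq> Dom N" and U: "ultra U" and inj: "inj \<iota>"
begin

lemma Dom_ne: "Dom N \<noteq> {}" using str by (simp add: is_struct_def)

lemma evs_Dom: "evs N (w i) s \<in> Dom N"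
  by (cases s) (use wN wit(1)[OF Dom_ne] in auto)

definition eqv :: "('f, 'p) sk \<Rightarrow> ('f, 'p) sk \<Rightarrow> bool" where
  "eqv s t \<longleftrightarrow> {i. evs N (w i) s = evs N (w i) t} \<in> U"

text \<open>A class is named by the code of a chosen representative, so that only terms and not sets
  of terms need room in the type \<open>'b\<close>.\<close>

definition cl :: "('f, 'p) sk \<Rightarrow> 'b" where
  "cl s = \<iota> (enc (SOME t. eqv t s))"

definition pre :: "'b \<Rightarrow> ('f, 'p) sk" where
  "pre u = (SOME s. cl s = u)"

definition H :: "('b, 'f, 'p) struct" where
  "H = \<lparr>Dom = range cl,
    fn = (\<lambda>f us. cl (SK (Eq (Var (length us)) (Fn f (map Var [0..<length us]))) (length us) (map pre us))),
    rl = (\<lambda>p us. {i. rl N p (map (evs N (w i)) (map pre us))} \<in> U)\<rparr>"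

lemma eqv_refl: "eqv s s" using ultraD(5)[OF U] by (simp add: eqv_def)

lemma eqv_sym: "eqv s t \<Longrightarrow> eqv t s" by (simp add: eqv_def eq_commute)

lemma eqv_trans:
  assumes "eqv s t" "eqv t u"
  shows "eqv s u"
  using ultraD(2)[OF U assms[unfolded eqv_def]] unfolding eqv_def
  by (rule ultraD(3)[OF U]) auto

lemma cl_eq_iff: "cl s = cl t \<longleftrightarrow> eqv s t"
proof
  assume "eqv s t"
  then have "eqv u s \<longleftrightarrow> eqv u t" for u using eqv_trans eqv_sym by blast
  then show "cl s = cl t" by (simp add: cl_def)
next
  assume "cl s = cl t"
  then have "(SOME u. eqv u s) = (SOME u. eqv u t)"
    unfolding cl_def using inj enc_inj by (metis injD)
  moreover have "eqv (SOME u. eqv u s) s" "eqv (SOME u. eqv u t) t"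
    by (rule someI, rule eqv_refl)+
  ultimately show "eqv s t" using eqv_trans eqv_sym by metis
qed

lemma eqv_pre: "eqv (pre (cl s)) s"
proof -
  have "cl (pre (cl s)) = cl s" unfolding pre_def by (rule someI[of _ s]) simp
  then show ?thesis by (simp add: cl_eq_iff)
qed

lemma list_in_U:
  assumes "\<And>j. j < length as \<Longrightarrow> {i. f i (as ! j) = g i (bs ! j)} \<in> U" "length as = length bs"
  shows "{i. map (f i) as = map (g i) bs} \<in> U"
  using assms
proof (induction as arbitrary: bs)
  case Nil
  then show ?case using ultraD(5)[OF U] by simp
next
  case (Cons a as)
  then obtain b bs' where bs: "bs = b # bs'" by (cases bs) auto
  have "{i. f i a = g i b} \<in> U" using Cons.prems(1)[of 0] bs by simp
  moreover have "{i. map (f i) as = map (g i) bs'} \<in> U"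
  proof (rule Cons.IH)
    fix j assume "j < length as"
    then show "{i. f i (as ! j) = g i (bs' ! j)} \<in> U" using Cons.prems(1)[of "Suc j"] bs by simp
  qed (use Cons.prems bs in simp)
  ultimately have "{i. f i a = g i b} \<inter> {i. map (f i) as = map (g i) bs'} \<in> U" by (rule ultraD(2)[OF U])
  then show ?case by (rule ultraD(3)[OF U]) (auto simp: bs)
qed

text \<open>A function symbol is the Skolem function of its own graph, the value being the variable
  numbered just after the arguments. This lets the hull interpret function symbols by Skolem
  terms.\<close>

lemma evs_fn:
  assumes "fun_ar L f = Some (length ss)"
  shows "evs N (w i) (SK (Eq (Var (length ss)) (Fn f (map Var [0..<length ss]))) (length ss) ss) =
    fn N f (map (evs N (w i)) ss)"
proof -
  let ?as = "map (evs N (w i)) ss" and ?n = "length ss"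
  let ?e = "\<lambda>a. (\<lambda>i. if i < length ?as then ?as ! i else undefined)(?n := a)"
  have args: "map (eval_tm N (?e a)) (map Var [0..<?n]) = ?as" for a
    by (rule nth_equalityI) auto
  have dom: "fn N f ?as \<in> Dom N"
  proof -
    have "set ?as \<subseteq> Dom N" using evs_Dom by auto
    then show ?thesis using str assms unfolding is_struct_def by (metis length_map)
  qed
  have "sat N (?e (fn N f ?as)) (Eq (Var ?n) (Fn f (map Var [0..<?n])))"
    by (simp only: sat.simps eval_tm.simps args) simp
  from wit(2)[OF Dom_ne dom this]
  have "sat N (?e (wit N (Eq (Var ?n) (Fn f (map Var [0..<?n]))) ?n ?as)) (Eq (Var ?n) (Fn f (map Var [0..<?n])))" .
  then show ?thesis by (simp only: sat.simps eval_tm.simps args evs.simps) simp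
qed

lemma eval_H:
  assumes "\<And>j. v j = cl (S j)" "wf_tm L t"
  shows "\<exists>s. eval_tm H v t = cl s \<and> {i. evs N (w i) s = eval_tm N (\<lambda>j. evs N (w i) (S j)) t} \<in> U"
  using assms(2)
proof (induction t)
  case (Var x)
  then show ?case using assms(1) ultraD(5)[OF U] by (intro exI[of _ "S x"]) simp
next
  case (Fn f ts)
  let ?us = "map (eval_tm H v) ts"
  let ?s = "SK (Eq (Var (length ?us)) (Fn f (map Var [0..<length ?us]))) (length ?us) (map pre ?us)"
  have "eval_tm H v (Fn f ts) = cl ?s" by (simp add: H_def)
  moreover have "{i. evs N (w i) ?s = eval_tm N (\<lambda>j. evs N (w i) (S j)) (Fn f ts)} \<in> U"
  proof -
    have "{i. map (evs N (w i)) (map pre ?us) = map (eval_tm N (\<lambda>j. evs N (w i) (S j))) ts} \<in> U"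
    proof (rule list_in_U)
      fix j assume "j < length (map pre ?us)"
      then have j: "ts ! j \<in> set ts" "j < length ts" by auto
      then obtain s where s: "eval_tm H v (ts ! j) = cl s"
        "{i. evs N (w i) s = eval_tm N (\<lambda>j. evs N (w i) (S j)) (ts ! j)} \<in> U"
        using Fn.IH[of "ts ! j"] Fn.prems by auto
      have "{i. evs N (w i) (pre (cl s)) = evs N (w i) s} \<in> U" using eqv_pre[of s] by (simp add: eqv_def)
      from ultraD(2)[OF U this s(2)]
      show "{i. evs N (w i) (map pre ?us ! j) = eval_tm N (\<lambda>j. evs N (w i) (S j)) (ts ! j)} \<in> U"
        by (rule ultraD(3)[OF U]) (use j s(1) in auto)
    qed simp
    then show ?thesis
    proof (rule ultraD(3)[OF U], intro subsetI CollectI)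
      fix i assume "i \<in> {i. map (evs N (w i)) (map pre ?us) = map (eval_tm N (\<lambda>j. evs N (w i) (S j))) ts}"
      then have i: "map (evs N (w i)) (map pre ?us) = map (eval_tm N (\<lambda>j. evs N (w i) (S j))) ts" by simp
      have ar: "fun_ar L f = Some (length (map pre ?us))" using Fn.prems by simp
      show "evs N (w i) ?s = eval_tm N (\<lambda>j. evs N (w i) (S j)) (Fn f ts)"
        using evs_fn[OF ar, of i] i by (simp del: map_map)
    qed
  qed
  ultimately show ?case by blast
qed

text \<open>The theorem of Los for the hull. In the quantifier step the Skolem term formed from
  \<open>\<phi>\<close> is itself a witness at all relevant indices, which is why the hull suffices
  in place of the whole ultrapower.\<close>

lemma los:
  assumes "\<And>j. v j = cl (S j)" "wf_fm L \<phi>"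
  shows "sat H v \<phi> \<longleftrightarrow> {i. sat N (\<lambda>j. evs N (w i) (S j)) \<phi>} \<in> U"
  using assms
proof (induction \<phi> arbitrary: v S)
  case (Eq s t)
  obtain a where a: "eval_tm H v s = cl a" "{i. evs N (w i) a = eval_tm N (\<lambda>j. evs N (w i) (S j)) s} \<in> U"
    using eval_H[of v S] Eq.prems by auto
  obtain b where b: "eval_tm H v t = cl b" "{i. evs N (w i) b = eval_tm N (\<lambda>j. evs N (w i) (S j)) t} \<in> U"
    using eval_H[of v S] Eq.prems by auto
  let ?X = "{i. evs N (w i) a = eval_tm N (\<lambda>j. evs N (w i) (S j)) s} \<inter>
    {i. evs N (w i) b = eval_tm N (\<lambda>j. evs N (w i) (S j)) t}"
  have X: "?X \<in> U" by (rule ultraD(2)[OF U a(2) b(2)])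
  have "eqv a b \<longleftrightarrow> {i. sat N (\<lambda>j. evs N (w i) (S j)) (Eq s t)} \<in> U"
    unfolding eqv_def
  proof
    assume "{i. evs N (w i) a = evs N (w i) b} \<in> U"
    from ultraD(2)[OF U this X] show "{i. sat N (\<lambda>j. evs N (w i) (S j)) (Eq s t)} \<in> U"
      by (rule ultraD(3)[OF U]) auto
  next
    assume "{i. sat N (\<lambda>j. evs N (w i) (S j)) (Eq s t)} \<in> U"
    from ultraD(2)[OF U this X] show "{i. evs N (w i) a = evs N (w i) b} \<in> U"
      by (rule ultraD(3)[OF U]) auto
  qed
  then show ?case using a b by (simp add: cl_eq_iff)
next
  case (Pred p ts)
  let ?us = "map (eval_tm H v) ts"
  let ?X = "{i. map (evs N (w i)) (map pre ?us) = map (eval_tm N (\<lambda>j. evs N (w i) (S j))) ts}"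
  have X: "?X \<in> U"
  proof (rule list_in_U)
    fix j assume "j < length (map pre ?us)"
    then have j: "ts ! j \<in> set ts" "j < length ts" by auto
    then obtain s where s: "eval_tm H v (ts ! j) = cl s"
      "{i. evs N (w i) s = eval_tm N (\<lambda>j. evs N (w i) (S j)) (ts ! j)} \<in> U"
      using eval_H[of v S "ts ! j"] Pred.prems by auto
    have "{i. evs N (w i) (pre (cl s)) = evs N (w i) s} \<in> U" using eqv_pre[of s] by (simp add: eqv_def)
    from ultraD(2)[OF U this s(2)]
    show "{i. evs N (w i) (map pre ?us ! j) = eval_tm N (\<lambda>j. evs N (w i) (S j)) (ts ! j)} \<in> U"
      by (rule ultraD(3)[OF U]) (use j s(1) in auto)
  qed simp
  have "sat H v (Pred p ts) \<longleftrightarrow> {i. rl N p (map (evs N (w i)) (map pre ?us))} \<in> U"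
    by (simp add: H_def del: map_map)
  also have "\<dots> \<longleftrightarrow> {i. sat N (\<lambda>j. evs N (w i) (S j)) (Pred p ts)} \<in> U"
  proof
    assume "{i. rl N p (map (evs N (w i)) (map pre ?us))} \<in> U"
    from ultraD(2)[OF U this X] show "{i. sat N (\<lambda>j. evs N (w i) (S j)) (Pred p ts)} \<in> U"
      by (rule ultraD(3)[OF U]) (auto simp del: map_map)
  next
    assume "{i. sat N (\<lambda>j. evs N (w i) (S j)) (Pred p ts)} \<in> U"
    from ultraD(2)[OF U this X] show "{i. rl N p (map (evs N (w i)) (map pre ?us))} \<in> U"
      by (rule ultraD(3)[OF U]) (auto simp del: map_map)
  qed
  finally show ?case .
next
  case (Neg \<phi>)
  have "{i. sat N (\<lambda>j. evs N (w i) (S j)) (Neg \<phi>)} = - {i. sat N (\<lambda>j. evs N (w i) (S j)) \<phi>}" by auto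
  then show ?case using Neg.IH[of v S] Neg.prems ultraD(4)[OF U] by simp
next
  case (And \<phi> \<psi>)
  have "{i. sat N (\<lambda>j. evs N (w i) (S j)) (And \<phi> \<psi>)} =
    {i. sat N (\<lambda>j. evs N (w i) (S j)) \<phi>} \<inter> {i. sat N (\<lambda>j. evs N (w i) (S j)) \<psi>}" (is "?A = ?B \<inter> ?C") by auto
  moreover have "?B \<inter> ?C \<in> U \<longleftrightarrow> ?B \<in> U \<and> ?C \<in> U"
    using ultraD(2,3)[OF U] by (meson Int_lower1 Int_lower2)
  ultimately show ?case using And.IH(1)[of v S] And.IH(2)[of v S] And.prems by simp
next
  case (Exi x \<phi>)
  have IH: "sat H (v(x := cl s)) \<phi> \<longleftrightarrow> {i. sat N ((\<lambda>j. evs N (w i) (S j))(x := evs N (w i) s)) \<phi>} \<in> U" for s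
  proof -
    have "sat H (v(x := cl s)) \<phi> \<longleftrightarrow> {i. sat N (\<lambda>j. evs N (w i) ((S(x := s)) j)) \<phi>} \<in> U"
      by (rule Exi.IH) (use Exi.prems in auto)
    moreover have "(\<lambda>j. evs N (w i) ((S(x := s)) j)) = (\<lambda>j. evs N (w i) (S j))(x := evs N (w i) s)" for i
      by auto
    ultimately show ?thesis by simp
  qed
  show ?case
  proof
    assume "sat H v (Exi x \<phi>)"
    then obtain s where "sat H (v(x := cl s)) \<phi>" by (auto simp: H_def)
    then have "{i. sat N ((\<lambda>j. evs N (w i) (S j))(x := evs N (w i) s)) \<phi>} \<in> U" by (simp only: IH)
    then show "{i. sat N (\<lambda>j. evs N (w i) (S j)) (Exi x \<phi>)} \<in> U"
      by (rule ultraD(3)[OF U]) (auto intro: evs_Dom)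
  next
    assume *: "{i. sat N (\<lambda>j. evs N (w i) (S j)) (Exi x \<phi>)} \<in> U"
    obtain n where n: "\<forall>i\<in>fv \<phi>. i < n" using fv_bound[of \<phi>] .
    let ?s = "SK \<phi> x (map S [0..<n])"
    have "{i. sat N ((\<lambda>j. evs N (w i) (S j))(x := evs N (w i) ?s)) \<phi>} \<in> U"
    proof (rule ultraD(3)[OF U *], intro subsetI CollectI)
      fix i assume "i \<in> {i. sat N (\<lambda>j. evs N (w i) (S j)) (Exi x \<phi>)}"
      then obtain a where a: "a \<in> Dom N" "sat N ((\<lambda>j. evs N (w i) (S j))(x := a)) \<phi>" by auto
      let ?as = "map (evs N (w i)) (map S [0..<n])"
      have agree: "sat N ((\<lambda>i. if i < length ?as then ?as ! i else undefined)(x := b)) \<phi> \<longleftrightarrow>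
          sat N ((\<lambda>j. evs N (w i) (S j))(x := b)) \<phi>" for b
        by (rule sat_cong) (use n in auto)
      have "sat N ((\<lambda>i. if i < length ?as then ?as ! i else undefined)(x := wit N \<phi> x ?as)) \<phi>"
        by (rule wit(2)[OF Dom_ne a(1)]) (simp only: agree a)
      then show "sat N ((\<lambda>j. evs N (w i) (S j))(x := evs N (w i) ?s)) \<phi>" by (simp only: agree evs.simps)
    qed
    then have "sat H (v(x := cl ?s)) \<phi>" by (simp only: IH)
    then show "sat H v (Exi x \<phi>)" by (auto simp: H_def)
  qed
qed

lemma H_struct: "is_struct L H"
  by (auto simp: is_struct_def H_def)

lemma los_SV: "wf_fm L \<phi> \<Longrightarrow> sat H (\<lambda>j. cl (SV j)) \<phi> \<longleftrightarrow> {i. sat N (w i) \<phi>} \<in> U"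
  using los[of "\<lambda>j. cl (SV j)" SV \<phi>] by simp

lemma H_Models:
  assumes "is_theory L T" "N \<in> Models TYPE('a) L T"
  shows "H \<in> Models TYPE('b) L T"
  unfolding Models_def
proof (intro CollectI conjI ballI allI impI)
  show "is_struct L H" by (rule H_struct)
  fix \<theta> and v :: "nat \<Rightarrow> 'b" assume \<theta>: "\<theta> \<in> T" and v: "range v \<subseteq> Dom H"
  have "v j = cl (pre (v j))" for j
  proof -
    have "v j \<in> range cl" using v by (auto simp: H_def)
    then obtain s where "v j = cl s" by blast
    then show ?thesis using eqv_pre[of s] by (simp add: cl_eq_iff eqv_sym)
  qed
  then have "sat H v \<theta> \<longleftrightarrow> {i. sat N (\<lambda>j. evs N (w i) (pre (v j))) \<theta>} \<in> U"
    using assms(1) \<theta> by (intro los) (auto simp: is_theory_def)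
  also have "{i. sat N (\<lambda>j. evs N (w i) (pre (v j))) \<theta>} = UNIV"
  proof -
    have "range (\<lambda>j. evs N (w i) (pre (v j))) \<subseteq> Dom N" for i using evs_Dom by auto
    then show ?thesis using assms(2) \<theta> by (simp add: Models_def)
  qed
  finally show "sat H v \<theta>" using ultraD(5)[OF U] by simp
qed

end

section \<open>Vector spaces as structures\<close>

primrec lin_tm :: "('k \<times> nat) list \<Rightarrow> ('k, 'f) lfun tm" where
  "lin_tm [] = Fn Zero []"
| "lin_tm (p # t) = Fn Add [Fn (Scal (fst p)) [Var (snd p)], lin_tm t]"

lemma fv_lin_tm: "fv_tm (lin_tm t) = snd ` set t"
  by (induction t) auto

lemma fun_ar_mod:
  fixes L :: "(('k, 'f) lfun, 'p) lang"
  assumes "sublang (mod_lang UNIV) L"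
  shows "fun_ar L Add = Some 2" "fun_ar L Zero = Some 0" "fun_ar L (Scal c) = Some 1"
proof -
  have "fun_ar L s = Some n" if "fun_ar (mod_lang UNIV :: (('k, 'f) lfun, 'p) lang) s = Some n" for s n
  proof -
    have "s \<in> dom (fun_ar (mod_lang UNIV :: (('k, 'f) lfun, 'p) lang))" using that by blast
    then show ?thesis using assms that unfolding sublang_def map_le_def by metis
  qed
  then show "fun_ar L Add = Some 2" "fun_ar L Zero = Some 0" "fun_ar L (Scal c) = Some 1"
    by (simp_all add: mod_lang_def)
qed

lemma wf_lin_tm: "sublang (mod_lang UNIV) L \<Longrightarrow> wf_tm L (lin_tm t)"
  by (induction t) (simp_all add: fun_ar_mod)

locale vspace =
  fixes M :: "('u, ('k::field, 'f) lfun, 'p) struct"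
  assumes vs: "is_vector_space M"
begin

lemma closed: "vzero M \<in> Dom M" "a \<in> Dom M \<Longrightarrow> b \<in> Dom M \<Longrightarrow> vadd M a b \<in> Dom M"
  "a \<in> Dom M \<Longrightarrow> smul M c a \<in> Dom M"
proof -
  have *: "fun_ar (mod_lang UNIV :: (('k, 'f) lfun, 'p) lang) f = Some (length as) \<Longrightarrow> set as \<subseteq> Dom M \<Longrightarrow> fn M f as \<in> Dom M" for f as
    using vs by (simp add: is_vector_space_def is_struct_def)
  show "vzero M \<in> Dom M" "a \<in> Dom M \<Longrightarrow> b \<in> Dom M \<Longrightarrow> vadd M a b \<in> Dom M"
    "a \<in> Dom M \<Longrightarrow> smul M c a \<in> Dom M"
    by (rule *; simp add: mod_lang_def)+
qed

lemma add_assoc: "a \<in> Dom M \<Longrightarrow> b \<in> Dom M \<Longrightarrow> c \<in> Dom M \<Longrightarrow> vadd M (vadd M a b) c = vadd M a (vadd M b c)"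
  and add_comm: "a \<in> Dom M \<Longrightarrow> b \<in> Dom M \<Longrightarrow> vadd M a b = vadd M b a"
  and add_0: "a \<in> Dom M \<Longrightarrow> vadd M (vzero M) a = a"
  and ex_neg: "a \<in> Dom M \<Longrightarrow> \<exists>b\<in>Dom M. vadd M a b = vzero M"
  and smul_add: "a \<in> Dom M \<Longrightarrow> b \<in> Dom M \<Longrightarrow> smul M r (vadd M a b) = vadd M (smul M r a) (smul M r b)"
  and add_smul: "a \<in> Dom M \<Longrightarrow> smul M (r + s) a = vadd M (smul M r a) (smul M s a)"
  and mult_smul: "a \<in> Dom M \<Longrightarrow> smul M (r * s) a = smul M r (smul M s a)"
  and one_smul: "a \<in> Dom M \<Longrightarrow> smul M 1 a = a"
  using vs unfolding is_vector_space_def by blast+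

lemma add_0_right: "a \<in> Dom M \<Longrightarrow> vadd M a (vzero M) = a"
  using add_0[of a] add_comm[of a "vzero M"] closed(1) by simp

lemma idem_zero:
  assumes "a \<in> Dom M" "vadd M a a = a"
  shows "a = vzero M"
proof -
  obtain b where b: "b \<in> Dom M" "vadd M a b = vzero M" using ex_neg assms by blast
  have "vadd M a (vadd M a b) = vadd M a b" using add_assoc[of a a b] assms b by simp
  then show ?thesis using b assms add_0_right by simp
qed

lemma zero_smul: "a \<in> Dom M \<Longrightarrow> smul M 0 a = vzero M"
  using idem_zero[of "smul M 0 a"] add_smul[of a 0 0] closed by simp

lemma smul_zero: "smul M c (vzero M) = vzero M"
  using idem_zero[of "smul M c (vzero M)"] smul_add[of "vzero M" "vzero M" c] closed add_0 by simp

lemma neg_add: "a \<in> Dom M \<Longrightarrow> vadd M a (smul M (- 1) a) = vzero M"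
  using add_smul[of a 1 "- 1"] zero_smul one_smul by simp

lemma add_swap:
  assumes "a \<in> Dom M" "b \<in> Dom M" "c \<in> Dom M" "d \<in> Dom M"
  shows "vadd M (vadd M a b) (vadd M c d) = vadd M (vadd M a c) (vadd M b d)"
proof -
  have "vadd M (vadd M a b) (vadd M c d) = vadd M a (vadd M (vadd M b c) d)"
    using assms by (simp add: add_assoc closed)
  also have "vadd M b c = vadd M c b" using assms add_comm by simp
  also have "vadd M a (vadd M (vadd M c b) d) = vadd M (vadd M a c) (vadd M b d)"
    using assms by (simp add: add_assoc closed)
  finally show ?thesis .
qed

lemma eval_lin_Dom: "range v \<subseteq> Dom M \<Longrightarrow> eval_tm M v (lin_tm t) \<in> Dom M"
  by (induction t) (auto intro!: closed)

lemma eval_lin_append: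
  assumes "range v \<subseteq> Dom M"
  shows "eval_tm M v (lin_tm (t @ t')) = vadd M (eval_tm M v (lin_tm t)) (eval_tm M v (lin_tm t'))"
proof (induction t)
  case Nil
  then show ?case using add_0 eval_lin_Dom[OF assms] by simp
next
  case (Cons p t)
  have "v (snd p) \<in> Dom M" using assms by auto
  then show ?case using Cons eval_lin_Dom[OF assms] by (simp add: add_assoc closed)
qed

lemma eval_lin_scale:
  assumes "range v \<subseteq> Dom M"
  shows "eval_tm M v (lin_tm (map (\<lambda>p. (c * fst p, snd p)) t)) = smul M c (eval_tm M v (lin_tm t))"
proof (induction t)
  case Nil
  then show ?case by (simp add: smul_zero)
next
  case (Cons p t)
  have "v (snd p) \<in> Dom M" using assms by auto
  then show ?case using Cons eval_lin_Dom[OF assms] by (simp add: smul_add mult_smul closed)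
qed

lemma vspan_lin_tm:
  assumes v: "range v \<subseteq> Dom M" and b: "b \<in> vspan M (v ` X)"
  shows "\<exists>t. snd ` set t \<subseteq> X \<and> b = eval_tm M v (lin_tm t)"
  using b
proof (induction rule: vspan.induct)
  case zero
  then show ?case by (intro exI[of _ "[]"]) simp
next
  case (base a)
  then obtain i where i: "i \<in> X" "a = v i" by blast
  then have "a \<in> Dom M" using v by auto
  then show ?case using i by (intro exI[of _ "[(1, i)]"]) (simp add: one_smul add_0_right closed)
next
  case (add a b)
  then obtain t t' where "snd ` set t \<subseteq> X" "a = eval_tm M v (lin_tm t)"
    "snd ` set t' \<subseteq> X" "b = eval_tm M v (lin_tm t')" by blast
  then show ?case using eval_lin_append[OF v, of t t'] by (intro exI[of _ "t @ t'"]) auto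
next
  case (scale a c)
  then obtain t where "snd ` set t \<subseteq> X" "a = eval_tm M v (lin_tm t)" by blast
  then show ?case using eval_lin_scale[OF v, of c t]
    by (intro exI[of _ "map (\<lambda>p. (c * fst p, snd p)) t"]) auto
qed

text \<open>Partial linear embeddings into the functions with support in the domain of the embedding: the
  support condition leaves room to extend by a unit vector.\<close>

definition part_embed :: "('u \<times> ('u \<Rightarrow> 'k)) set \<Rightarrow> bool" where
  "part_embed r \<longleftrightarrow> (vzero M, 0) \<in> r \<and> fst ` r \<subseteq> Dom M \<and>
     (\<forall>a f b g. (a, f) \<in> r \<longrightarrow> (b, g) \<in> r \<longrightarrow> (vadd M a b, f + g) \<in> r) \<and>
     (\<forall>a f c. (a, f) \<in> r \<longrightarrow> (smul M c a, (\<lambda>x. c * f x)) \<in> r) \<and>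
     (\<forall>f. (vzero M, f) \<in> r \<longrightarrow> f = 0) \<and> (\<forall>a. (a, 0) \<in> r \<longrightarrow> a = vzero M) \<and>
     (\<forall>a f x. (a, f) \<in> r \<longrightarrow> f x \<noteq> 0 \<longrightarrow> x \<in> fst ` r)"

lemma part_embedD:
  assumes "part_embed r"
  shows "(vzero M, 0) \<in> r" "(a, f) \<in> r \<Longrightarrow> a \<in> Dom M"
    "(a, f) \<in> r \<Longrightarrow> (b, g) \<in> r \<Longrightarrow> (vadd M a b, f + g) \<in> r"
    "(a, f) \<in> r \<Longrightarrow> (smul M c a, (\<lambda>x. c * f x)) \<in> r"
    "(vzero M, f) \<in> r \<Longrightarrow> f = 0" "(a, 0) \<in> r \<Longrightarrow> a = vzero M"
    "(a, f) \<in> r \<Longrightarrow> f x \<noteq> 0 \<Longrightarrow> x \<in> fst ` r"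
proof -
  have *: "(vzero M, 0) \<in> r" "fst ` r \<subseteq> Dom M"
    "\<forall>a f b g. (a, f) \<in> r \<longrightarrow> (b, g) \<in> r \<longrightarrow> (vadd M a b, f + g) \<in> r"
    "\<forall>a f c. (a, f) \<in> r \<longrightarrow> (smul M c a, (\<lambda>x. c * f x)) \<in> r"
    "\<forall>f. (vzero M, f) \<in> r \<longrightarrow> f = 0" "\<forall>a. (a, 0) \<in> r \<longrightarrow> a = vzero M"
    "\<forall>a f x. (a, f) \<in> r \<longrightarrow> f x \<noteq> 0 \<longrightarrow> x \<in> fst ` r"
    by (insert assms[unfolded part_embed_def]) (elim conjE, assumption)+
  show "(vzero M, 0) \<in> r" by (rule *(1))
  show "(a, f) \<in> r \<Longrightarrow> a \<in> Dom M" using *(2) by force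
  show "(a, f) \<in> r \<Longrightarrow> (b, g) \<in> r \<Longrightarrow> (vadd M a b, f + g) \<in> r" by (rule *(3)[rule_format])
  show "(a, f) \<in> r \<Longrightarrow> (smul M c a, (\<lambda>x. c * f x)) \<in> r" by (rule *(4)[rule_format])
  show "(vzero M, f) \<in> r \<Longrightarrow> f = 0" by (rule *(5)[rule_format])
  show "(a, 0) \<in> r \<Longrightarrow> a = vzero M" by (rule *(6)[rule_format])
  show "(a, f) \<in> r \<Longrightarrow> f x \<noteq> 0 \<Longrightarrow> x \<in> fst ` r" by (rule *(7)[rule_format])
qed

lemma part_embed_extend:
  assumes r: "part_embed r" and a: "a \<in> Dom M" "a \<notin> fst ` r"
  shows "\<exists>r'. part_embed r' \<and> r \<subseteq> r' \<and> a \<in> fst ` r'"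
proof -
  note D = part_embedD[OF r]
  define d where "d c = (\<lambda>x. if x = a then c else 0)" for c :: 'k
  define r' where "r' = {(vadd M w (smul M c a), f + d c) |w f c. (w, f) \<in> r}"
  have memI: "(vadd M w (smul M c a), f + d c) \<in> r'" if "(w, f) \<in> r" for w f c
    using that by (auto simp: r'_def)
  have d0: "d 0 = 0" by (auto simp: d_def)
  have sub: "r \<subseteq> r'"
  proof
    fix p assume p: "p \<in> r"
    obtain w f where wf: "p = (w, f)" by (cases p)
    have "(vadd M w (smul M 0 a), f + d 0) = p"
      using a p D(2)[of w f] by (simp add: wf d0 zero_smul add_0_right)
    then show "p \<in> r'" using memI[of w f 0] p by (simp add: wf)
  qed
  have "(vadd M (vzero M) (smul M 1 a), 0 + d 1) \<in> r'" by (rule memI[OF D(1)])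
  then have amem: "(a, d 1) \<in> r'" using a by (simp add: one_smul add_0)
  have fa: "f a = 0" if "(w, f) \<in> r" for w f using D(7)[OF that] a by blast
  \<comment> \<open>A nonzero \<open>c\<close> would express \<open>a\<close> through
    \<open>w\<close> and thus put \<open>a\<close> into the domain of \<open>r\<close>.\<close>
  have nz: "c = 0" if wf: "(w, f) \<in> r" and z: "vadd M w (smul M c a) = vzero M" for w f c
  proof (rule ccontr)
    assume c: "c \<noteq> 0"
    have w: "w \<in> Dom M" by (rule D(2)[OF wf])
    have "smul M (- (1 / c)) w = vadd M (smul M (- (1 / c)) w) (smul M (1 / c) (vadd M w (smul M c a)))"
      unfolding z using w by (simp add: smul_zero add_0_right closed)
    also have "\<dots> = vadd M (smul M (- (1 / c)) w) (vadd M (smul M (1 / c) w) a)"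
      using w a c by (simp add: smul_add closed mult_smul[symmetric] one_smul)
    also have "\<dots> = vadd M (smul M (- (1 / c) + 1 / c) w) a"
      using w a by (simp only: add_assoc[symmetric] add_smul closed)
    also have "\<dots> = a" using w a by (simp add: zero_smul add_0)
    finally have "(a, (\<lambda>x. - (1 / c) * f x)) \<in> r" using D(4)[OF wf, of "- (1 / c)"] by simp
    then show False using a by force
  qed
  have "part_embed r'"
    unfolding part_embed_def
  proof (intro conjI allI impI)
    show "(vzero M, 0) \<in> r'" using sub D(1) by blast
    show "fst ` r' \<subseteq> Dom M" using a D(2) by (auto simp: r'_def intro!: closed)
  next
    fix b f b' g assume "(b, f) \<in> r'" "(b', g) \<in> r'"
    then obtain w h c w' h' c' where 1: "(w, h) \<in> r" "b = vadd M w (smul M c a)" "f = h + d c"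
      "(w', h') \<in> r" "b' = vadd M w' (smul M c' a)" "g = h' + d c'" by (auto simp: r'_def)
    have "vadd M b b' = vadd M (vadd M w w') (smul M (c + c') a)"
      using 1 a D(2) by (simp add: add_swap closed add_smul)
    moreover have "f + g = (h + h') + d (c + c')" using 1 by (auto simp: d_def fun_eq_iff)
    ultimately show "(vadd M b b', f + g) \<in> r'" using memI[OF D(3)[OF 1(1,4)], of "c + c'"] by simp
  next
    fix b f s assume "(b, f) \<in> r'"
    then obtain w h c where 1: "(w, h) \<in> r" "b = vadd M w (smul M c a)" "f = h + d c" by (auto simp: r'_def)
    have "smul M s b = vadd M (smul M s w) (smul M (s * c) a)"
      using 1 a D(2) by (simp add: smul_add mult_smul closed)
    moreover have "(\<lambda>x. s * f x) = (\<lambda>x. s * h x) + d (s * c)"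
      using 1 by (auto simp: d_def fun_eq_iff algebra_simps)
    ultimately show "(smul M s b, (\<lambda>x. s * f x)) \<in> r'" using memI[OF D(4)[OF 1(1)], of s "s * c"] by simp
  next
    fix f assume "(vzero M, f) \<in> r'"
    then obtain w h c where 1: "(w, h) \<in> r" "vzero M = vadd M w (smul M c a)" "f = h + d c" by (auto simp: r'_def)
    have "c = 0" by (rule nz[OF 1(1) 1(2)[symmetric]])
    then have "w = vzero M" using 1 a D(2)[OF 1(1)] by (simp add: zero_smul add_0_right)
    then show "f = 0" using D(5) 1 \<open>c = 0\<close> by (simp add: d0)
  next
    fix b assume "(b, 0) \<in> r'"
    then obtain w h c where 1: "(w, h) \<in> r" "b = vadd M w (smul M c a)" "0 = h + d c" by (auto simp: r'_def)
    have "(h + d c) a = 0" using 1(3) by (metis zero_fun_apply)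
    then have "c = 0" using fa[OF 1(1)] by (simp add: d_def)
    then have "w = vzero M" using 1 D(6) by (simp add: d0)
    then show "b = vzero M" using 1 a \<open>c = 0\<close> by (simp add: zero_smul add_0 closed)
  next
    fix b f x assume "(b, f) \<in> r'" "f x \<noteq> 0"
    then obtain w h c where 1: "(w, h) \<in> r" "f = h + d c" by (auto simp: r'_def)
    show "x \<in> fst ` r'"
    proof (cases "x = a")
      case True
      then show ?thesis using amem by force
    next
      case False
      then have "h x \<noteq> 0" using 1 \<open>f x \<noteq> 0\<close> by (simp add: d_def)
      then show ?thesis using D(7)[OF 1(1)] sub by blast
    qed
  qed
  moreover have "a \<in> fst ` r'" using amem by force
  ultimately show ?thesis using sub by blast
qed

lemma part_embed_maximal: "\<exists>r. part_embed r \<and> (\<forall>r'. part_embed r' \<longrightarrow> r \<subseteq> r' \<longrightarrow> r' = r)"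
proof -
  have "\<exists>r\<in>Collect part_embed. \<forall>r'\<in>Collect part_embed. r \<subseteq> r' \<longrightarrow> r' = r"
  proof (rule subset_Zorn_nonempty)
    have "part_embed {(vzero M, 0)}"
      unfolding part_embed_def using closed(1) by (auto simp: add_0 smul_zero fun_eq_iff)
    then show "Collect part_embed \<noteq> {}" by blast
    fix C assume ne: "C \<noteq> {}" and ch: "subset.chain (Collect part_embed) C"
    have pe: "part_embed r" if "r \<in> C" for r using ch that unfolding subset.chain_def by blast
    have cmp: "\<exists>r\<in>C. p \<in> r \<and> q \<in> r" if pq: "p \<in> \<Union>C" "q \<in> \<Union>C" for p q
    proof -
      from pq obtain r s where rs: "r \<in> C" "p \<in> r" "s \<in> C" "q \<in> s" by blast
      then have "r \<subseteq> s \<or> s \<subseteq> r" using ch unfolding subset.chain_def by blast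
      then show ?thesis using rs by blast
    qed
    have "part_embed (\<Union>C)"
      unfolding part_embed_def
    proof (intro conjI allI impI)
      show "(vzero M, 0) \<in> \<Union>C" using ne part_embedD(1)[OF pe] by blast
      show "fst ` \<Union>C \<subseteq> Dom M" using part_embedD(2)[OF pe] by auto
    next
      fix a f b g assume "(a, f) \<in> \<Union>C" "(b, g) \<in> \<Union>C"
      then obtain r where "r \<in> C" "(a, f) \<in> r" "(b, g) \<in> r" using cmp by blast
      then show "(vadd M a b, f + g) \<in> \<Union>C" using part_embedD(3)[OF pe] by blast
    next
      fix a f c assume "(a, f) \<in> \<Union>C"
      then show "(smul M c a, (\<lambda>x. c * f x)) \<in> \<Union>C" using part_embedD(4)[OF pe] by blast
    next
      fix f assume "(vzero M, f) \<in> \<Union>C"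
      then show "f = 0" using part_embedD(5)[OF pe] by blast
    next
      fix a assume "(a, 0) \<in> \<Union>C"
      then show "a = vzero M" using part_embedD(6)[OF pe] by blast
    next
      fix a f x assume "(a, f) \<in> \<Union>C" "f x \<noteq> 0"
      then show "x \<in> fst ` \<Union>C" using part_embedD(7)[OF pe] by blast
    qed
    then show "\<Union>C \<in> Collect part_embed" by simp
  qed
  then show ?thesis by blast
qed

text \<open>A maximal partial embedding is total, since otherwise it could be extended. The target
  is a type with group operations, which the carrier of a structure does not offer.\<close>

lemma embed_exists:
  "\<exists>e :: 'u \<Rightarrow> 'u \<Rightarrow> 'k. inj_on e (Dom M) \<and> e (vzero M) = 0 \<and>
     (\<forall>a\<in>Dom M. \<forall>b\<in>Dom M. e (vadd M a b) = e a + e b) \<and>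
     (\<forall>a\<in>Dom M. \<forall>c. e (smul M c a) = (\<lambda>x. c * e a x))"
proof -
  obtain r where r: "part_embed r" and max: "\<And>r'. part_embed r' \<Longrightarrow> r \<subseteq> r' \<Longrightarrow> r' = r"
    using part_embed_maximal by blast
  note D = part_embedD[OF r]
  have total: "a \<in> fst ` r" if aM: "a \<in> Dom M" for a
  proof (rule ccontr)
    assume n: "a \<notin> fst ` r"
    then obtain r' where "part_embed r'" "r \<subseteq> r'" "a \<in> fst ` r'"
      using part_embed_extend[OF r aM n] by blast
    with max n show False by blast
  qed
  have diff: "(vadd M a (smul M (- 1) b), f - g) \<in> r" if "(a, f) \<in> r" "(b, g) \<in> r" for a b f g
  proof -
    have eq: "f - g = f + (\<lambda>x. - 1 * g x)" by auto
    show ?thesis unfolding eq by (rule D(3)[OF that(1) D(4)[OF that(2)]])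
  qed
  have uq: "f = g" if "(a, f) \<in> r" "(a, g) \<in> r" for a f g
  proof -
    have "(vzero M, f - g) \<in> r" using diff[OF that] neg_add[OF D(2)[OF that(1)]] by simp
    then have "f - g = 0" by (rule D(5))
    then show ?thesis by simp
  qed
  have inj: "a = b" if "(a, f) \<in> r" "(b, f) \<in> r" for a b f
  proof -
    have ab: "a \<in> Dom M" "b \<in> Dom M" using D(2) that by blast+
    have z: "vadd M a (smul M (- 1) b) = vzero M" by (rule D(6)) (use diff[OF that] in simp)
    have "a = vadd M a (vadd M (smul M (- 1) b) b)"
      using ab neg_add[of b] by (simp add: add_comm[of "smul M (- 1) b" b] closed add_0_right)
    also have "\<dots> = vadd M (vadd M a (smul M (- 1) b)) b" using ab by (simp add: add_assoc closed)
    finally show ?thesis using z ab add_0 by simp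
  qed
  define e where "e a = (SOME f. (a, f) \<in> r)" for a
  have e: "(a, e a) \<in> r" if "a \<in> Dom M" for a
  proof -
    from total[OF that] obtain f where "(a, f) \<in> r" by force
    then show ?thesis unfolding e_def by (rule someI[of "\<lambda>f. (a, f) \<in> r"])
  qed
  show ?thesis
  proof (intro exI[of _ e] conjI ballI allI)
    show "inj_on e (Dom M)"
    proof (rule inj_onI)
      fix a b assume ab: "a \<in> Dom M" "b \<in> Dom M" "e a = e b"
      then show "a = b" using inj[OF e[OF ab(1)]] e[OF ab(2)] by simp
    qed
    show "e (vzero M) = 0" by (rule uq[OF e[OF closed(1)] D(1)])
    show "e (vadd M a b) = e a + e b" if "a \<in> Dom M" "b \<in> Dom M" for a b
      by (rule uq[OF e D(3)[OF e e]]) (use that in \<open>auto intro: closed\<close>)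
    show "e (smul M c a) = (\<lambda>x. c * e a x)" if "a \<in> Dom M" for a c
      by (rule uq[OF e D(4)[OF e]]) (use that in \<open>auto intro: closed\<close>)
  qed
qed

end

text \<open>A family of finite fibres not covered by finitely many linear terms would have an
  algebraic element outside the span in a model built from an ultrapower.\<close>

lemma finite_fibre_linear:
  fixes L :: "(('k::field_char_0, 'f) lfun, 'p) lang"
  assumes L: "sublang (mod_lang UNIV) L" and T: "is_theory L T"
    and vs: "\<forall>M\<in>Models TYPE(('u, 'k, 'f, 'p) univ) L T. is_vector_space M"
    and inf: "eliminates_ex_inf L (Models TYPE(('u, 'k, 'f, 'p) univ) L T)"
    and span: "dcl_acl_span L (Models TYPE(('u, 'k, 'f, 'p) univ) L T)"
    and N: "N \<in> Models TYPE(('u, 'k, 'f, 'p) univ) L T" and \<phi>: "wf_fm L \<phi>"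
  shows "\<exists>S. finite S \<and> (\<forall>t\<in>S. x \<notin> snd ` set t) \<and> (\<forall>v. range v \<subseteq> Dom N \<longrightarrow>
    finite (sols N \<phi> x v) \<longrightarrow> sols N \<phi> x v \<subseteq> (\<lambda>t. eval_tm N v (lin_tm t)) ` S)"
proof (rule ccontr)
  assume neg: "\<not> ?thesis"
  let ?K = "Models TYPE(('u, 'k, 'f, 'p) univ) L T"
  have strN: "is_struct L N" using N by (simp add: Models_def)
  \<comment> \<open>Eliminating the quantifier for infinitely many makes finiteness of the fibre a
    formula, and formulas pass to the Skolem hull.\<close>
  obtain \<psi> where \<psi>: "wf_fm L \<psi>" "fv \<psi> \<subseteq> fv \<phi> - {x}"
    "\<forall>M\<in>?K. \<forall>v. range v \<subseteq> Dom M \<longrightarrow> (sat M v \<psi> \<longleftrightarrow> infinite (sols M \<phi> x v))"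
    using inf[unfolded eliminates_ex_inf_def, rule_format, OF \<phi>, of x] by (elim exE conjE)
  \<comment> \<open>A counterexample to \<open>S\<close>: the value of \<open>w\<close> at
    \<open>x\<close> is a point of a finite fibre that no term in \<open>S\<close> reaches.\<close>
  define good where "good S w \<longleftrightarrow> range w \<subseteq> Dom N \<and> \<not> sat N w \<psi> \<and> sat N w \<phi> \<and>
    (\<forall>t\<in>S. w x \<noteq> eval_tm N w (lin_tm t))" for S w
  have ex: "\<exists>w. good S w" if S: "finite S" "\<forall>t\<in>S. x \<notin> snd ` set t" for S
  proof -
    have "\<not> (\<forall>v. range v \<subseteq> Dom N \<longrightarrow> finite (sols N \<phi> x v) \<longrightarrow>
        sols N \<phi> x v \<subseteq> (\<lambda>t. eval_tm N v (lin_tm t)) ` S)"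
    proof
      assume all: "\<forall>v. range v \<subseteq> Dom N \<longrightarrow> finite (sols N \<phi> x v) \<longrightarrow>
        sols N \<phi> x v \<subseteq> (\<lambda>t. eval_tm N v (lin_tm t)) ` S"
      show False by (rule notE[OF neg]) (intro exI[of _ S] conjI S all)
    qed
    then obtain v where v: "range v \<subseteq> Dom N" "finite (sols N \<phi> x v)"
      and "\<not> sols N \<phi> x v \<subseteq> (\<lambda>t. eval_tm N v (lin_tm t)) ` S" by (simp only: not_all not_imp) (elim exE conjE)
    then obtain a where a0: "a \<in> sols N \<phi> x v" "a \<notin> (\<lambda>t. eval_tm N v (lin_tm t)) ` S" by blast
    have a: "a \<in> Dom N" "sat N (v(x := a)) \<phi>" using a0 by (auto simp: sols_def)
    have "sat N (v(x := a)) \<psi> \<longleftrightarrow> sat N v \<psi>" by (rule sat_cong) (use \<psi>(2) in auto)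
    moreover have "\<not> sat N v \<psi>" using \<psi>(3)[rule_format, OF N v(1)] v(2) by simp
    moreover have "eval_tm N (v(x := a)) (lin_tm t) = eval_tm N v (lin_tm t)" if "t \<in> S" for t
      by (rule eval_tm_cong) (use S(2) that in \<open>auto simp: fv_lin_tm\<close>)
    ultimately have "good S (v(x := a))" using v a a0 by (auto simp: good_def)
    then show ?thesis by blast
  qed
  define TT where "TT = {t :: ('k \<times> nat) list. x \<notin> snd ` set t}"
  define w where "w S = (if \<exists>w. good S w then SOME w. good S w else (\<lambda>_. SOME a. a \<in> Dom N))" for S
  have w: "good S (w S)" if "finite S" "S \<subseteq> TT" for S
  proof -
    have "\<exists>w. good S w" using that by (intro ex) (auto simp: TT_def)
    then show ?thesis unfolding w_def by (simp add: someI_ex)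
  qed
  have wN: "range (w S) \<subseteq> Dom N" for S
  proof (cases "\<exists>w. good S w")
    case True
    then have "good S (w S)" unfolding w_def by (simp add: someI_ex)
    then show ?thesis by (simp add: good_def)
  next
    case False
    have "(SOME a. a \<in> Dom N) \<in> Dom N" using strN by (simp add: is_struct_def some_in_eq)
    then show ?thesis using False by (auto simp: w_def)
  qed
  \<comment> \<open>The ultrafilter lives on finite sets of terms and contains every
    \<open>Bt t\<close>. So at almost all indices the value at \<open>x\<close> differs from that of
    any given term in \<open>TT\<close>.\<close>
  define Bt where "Bt t = {S. finite S \<and> S \<subseteq> TT \<and> t \<in> S}" for t
  have "\<exists>U. ultra U \<and> insert {S. finite S \<and> S \<subseteq> TT} (Bt ` TT) \<subseteq> U"
  proof (rule ultra_exists)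
    fix F assume F: "finite F" "F \<subseteq> insert {S. finite S \<and> S \<subseteq> TT} (Bt ` TT)"
    have "finite (F - {{S. finite S \<and> S \<subseteq> TT}})" "F - {{S. finite S \<and> S \<subseteq> TT}} \<subseteq> Bt ` TT" using F by auto
    from finite_subset_image[OF this]
    obtain S where S: "S \<subseteq> TT" "finite S" "F - {{S. finite S \<and> S \<subseteq> TT}} = Bt ` S"
      by (elim exE conjE)
    have "S \<in> X" if X: "X \<in> F" for X
    proof (cases "X = {S. finite S \<and> S \<subseteq> TT}")
      case False
      then have "X \<in> Bt ` S" using X S(3) by blast
      then show ?thesis using S by (auto simp: Bt_def)
    qed (use S in auto)
    then show "\<Inter>F \<noteq> {}" by blast
  qed
  then obtain U where U0: "ultra U" "insert {S. finite S \<and> S \<subseteq> TT} (Bt ` TT) \<subseteq> U" by (elim exE conjE)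
  then have U: "ultra U" "{S. finite S \<and> S \<subseteq> TT} \<in> U" by simp_all
  have BtU: "Bt t \<in> U" if "t \<in> TT" for t using U0(2) that by blast
  interpret h: skolem_hull L N w U "Inr :: (('k, 'f) lfun, 'p) fm \<Rightarrow> ('u, 'k, 'f, 'p) univ"
    by unfold_locales (simp_all add: strN wN U(1))
  let ?H = "h.H"
  define v where "v j = h.cl (SV j)" for j
  have H: "?H \<in> ?K" by (rule h.H_Models[OF T N])
  interpret vspace ?H by unfold_locales (rule vs[rule_format, OF H])
  have vH: "range v \<subseteq> Dom ?H" by (auto simp: v_def h.H_def)
  have los: "sat ?H v \<theta> \<longleftrightarrow> {S. sat N (w S) \<theta>} \<in> U" if "wf_fm L \<theta>" for \<theta>
    unfolding v_def by (rule h.los_SV[OF that])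
  have "{S. sat N (w S) \<phi>} \<in> U"
    by (rule ultraD(3)[OF U(1,2)]) (use w in \<open>auto simp: good_def\<close>)
  then have s1: "sat ?H v \<phi>" using los[OF \<phi>] by simp
  have "{S. sat N (w S) (Neg \<psi>)} \<in> U"
    by (rule ultraD(3)[OF U(1,2)]) (use w in \<open>auto simp: good_def\<close>)
  then have "sat ?H v (Neg \<psi>)" using los[of "Neg \<psi>"] \<psi>(1) by simp
  then have "finite (sols ?H \<phi> x v)" using \<psi>(3)[rule_format, OF H vH] by simp
  moreover have "v x \<in> sols ?H \<phi> x v" using s1 vH by (auto simp: sols_def)
  ultimately have "v x \<in> acl L ?H (v ` (fv \<phi> - {x}))" unfolding acl_def using \<phi> by blast
  also have "\<dots> = vspan ?H (v ` (fv \<phi> - {x}))"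
  proof -
    have "v ` (fv \<phi> - {x}) \<subseteq> Dom ?H" using vH by blast
    then show ?thesis using span H unfolding dcl_acl_span_def by blast
  qed
  finally obtain t where t: "snd ` set t \<subseteq> fv \<phi> - {x}" "v x = eval_tm ?H v (lin_tm t)"
    using vspan_lin_tm[OF vH] by blast
  have tT: "t \<in> TT" using t(1) by (auto simp: TT_def)
  have wf: "wf_fm L (Eq (Var x) (lin_tm t))" using wf_lin_tm[OF L] by simp
  have "sat ?H v (Eq (Var x) (lin_tm t))" using t(2) by simp
  then have "{S. sat N (w S) (Eq (Var x) (lin_tm t))} \<in> U" using los[OF wf] by simp
  then have "{S. sat N (w S) (Eq (Var x) (lin_tm t))} \<inter> Bt t \<in> U" by (rule ultraD(2)[OF U(1) _ BtU[OF tT]])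
  moreover have "{S. sat N (w S) (Eq (Var x) (lin_tm t))} \<inter> Bt t = {}"
  proof -
    have "w S x \<noteq> eval_tm N (w S) (lin_tm t)" if "S \<in> Bt t" for S
      using w[of S] that by (auto simp: Bt_def good_def)
    then show ?thesis by auto
  qed
  ultimately show False using ultraD(1)[OF U(1)] by simp
qed

section \<open>The formulas of the expansion\<close>

fun subst_tm :: "(nat \<Rightarrow> 'f tm) \<Rightarrow> 'f tm \<Rightarrow> 'f tm" where
  "subst_tm \<tau> (Var i) = \<tau> i"
| "subst_tm \<tau> (Fn f ts) = Fn f (map (subst_tm \<tau>) ts)"

text \<open>A substitution on quantifier-free formulas only: quantified formulas are left alone.\<close>

fun subst_fm :: "(nat \<Rightarrow> 'f tm) \<Rightarrow> ('f, 'p) fm \<Rightarrow> ('f, 'p) fm" where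
  "subst_fm \<tau> (Eq s t) = Eq (subst_tm \<tau> s) (subst_tm \<tau> t)"
| "subst_fm \<tau> (Pred p ts) = Pred p (map (subst_tm \<tau>) ts)"
| "subst_fm \<tau> (Neg \<phi>) = Neg (subst_fm \<tau> \<phi>)"
| "subst_fm \<tau> (And \<phi> \<psi>) = And (subst_fm \<tau> \<phi>) (subst_fm \<tau> \<psi>)"
| "subst_fm \<tau> (Exi x \<phi>) = Exi x \<phi>"

lemma eval_subst_tm: "eval_tm M v (subst_tm \<tau> t) = eval_tm M (\<lambda>i. eval_tm M v (\<tau> i)) t"
proof (induction t)
  case (Fn f ts)
  then have "map (eval_tm M v) (map (subst_tm \<tau>) ts) = map (eval_tm M (\<lambda>i. eval_tm M v (\<tau> i))) ts"
    by simp
  then show ?case by (simp only: subst_tm.simps eval_tm.simps)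
qed simp

lemma sat_subst_fm: "qfree \<phi> \<Longrightarrow> sat M v (subst_fm \<tau> \<phi>) \<longleftrightarrow> sat M (\<lambda>i. eval_tm M v (\<tau> i)) \<phi>"
  by (induction \<phi>) (auto simp: eval_subst_tm comp_def)

lemma wf_subst_tm: "(\<And>i. wf_tm L (\<tau> i)) \<Longrightarrow> wf_tm L t \<Longrightarrow> wf_tm L (subst_tm \<tau> t)"
  by (induction t) auto

lemma wf_subst_fm: "(\<And>i. wf_tm L (\<tau> i)) \<Longrightarrow> wf_fm L \<phi> \<Longrightarrow> wf_fm L (subst_fm \<tau> \<phi>)"
  by (induction \<phi>) (auto simp: wf_subst_tm)

primrec disj :: "('f, 'p) fm list \<Rightarrow> ('f, 'p) fm" where
  "disj [] = Neg (Eq (Var 0) (Var 0))"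
| "disj (\<phi> # \<phi>s) = Neg (And (Neg \<phi>) (Neg (disj \<phi>s)))"

lemma sat_disj: "sat M v (disj \<phi>s) \<longleftrightarrow> (\<exists>\<phi>\<in>set \<phi>s. sat M v \<phi>)"
  by (induction \<phi>s) auto

lemma wf_disj: "(\<And>\<phi>. \<phi> \<in> set \<phi>s \<Longrightarrow> wf_fm L \<phi>) \<Longrightarrow> wf_fm L (disj \<phi>s)"
  by (induction \<phi>s) auto

text \<open>A common denominator turns a relation over the fraction field into one over
  \<open>R\<close>. This connects axiom (B), stated over the fraction field, with independence over
  \<open>R\<close> as used in the abstract argument.\<close>

lemma lin_indep_if_rind:
  assumes R: "is_subring R" and ls: "rind (*) R ls"
  shows "lin_indep (frac_field R) ls"
  unfolding lin_indep_def
proof (intro allI impI ballI)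
  fix qs q assume qs: "length qs = length ls \<and> set qs \<subseteq> frac_field R \<and> (\<Sum>i<length ls. qs ! i * ls ! i) = 0"
    and q: "q \<in> set qs"
  have "\<exists>s\<in>R. s \<noteq> 0 \<and> (\<forall>q\<in>set qs. s * q \<in> R)" if "set qs \<subseteq> frac_field R" for qs
    using that
  proof (induction qs)
    case Nil
    then show ?case using subring_1[OF R] by (intro bexI[of _ 1]) auto
  next
    case (Cons q qs)
    then obtain s where s: "s \<in> R" "s \<noteq> 0" "\<forall>q\<in>set qs. s * q \<in> R" by (auto simp: subset_iff)
    from Cons.prems obtain a b where ab: "q = a / b" "a \<in> R" "b \<in> R" "b \<noteq> 0"
      by (auto simp: frac_field_def)
    have "s * b * q = s * a" using ab(1,4) by simp
    then have 1: "s * b * q \<in> R" using subring_mult[OF R s(1) ab(2)] by (simp only:)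
    have 2: "s * b * p \<in> R" if "p \<in> set qs" for p
    proof -
      have "s * p \<in> R" using s(3) that by blast
      from subring_mult[OF R ab(3) this] show ?thesis by (simp only: mult.assoc mult.left_commute)
    qed
    have "\<forall>p\<in>set (q # qs). s * b * p \<in> R" using 1 2 by (simp only: list.set ball_simps) blast
    moreover have "s * b \<in> R" "s * b \<noteq> 0" using subring_mult[OF R s(1) ab(3)] s(2) ab(4) by simp_all
    ultimately show ?case by blast
  qed
  then obtain s where s: "s \<in> R" "s \<noteq> 0" "\<forall>q\<in>set qs. s * q \<in> R" using qs by blast
  have "(\<Sum>i<length ls. (s * qs ! i) * ls ! i) = s * (\<Sum>i<length ls. qs ! i * ls ! i)"
    by (simp add: sum_distrib_left mult.assoc)
  also have "\<dots> = 0" using qs by simp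
  finally have z: "(\<Sum>i<length ls. (s * qs ! i) * ls ! i) = 0" .
  obtain i where i: "i < length ls" "q = qs ! i" using q qs by (auto simp: in_set_conv_nth)
  have "\<forall>i<length ls. s * qs ! i \<in> R" using s(3) qs by simp
  then have "s * qs ! i = 0"
    using spec[OF ls[unfolded rind_def], of "\<lambda>i. s * qs ! i"] z i(1) by blast
  then show "q = 0" using i s by simp
qed

lemma vals_o: "v \<in> vals V \<Longrightarrow> d ` V \<subseteq> D \<Longrightarrow> range (d \<circ> v) \<subseteq> D"
  by (auto simp: vals_def)

text \<open>\<open>e\<close> realizes the vector space as a space of functions, where the operations of the type are
  available.\<close>

locale generic_pair =
  fixes L :: "(('k::field_char_0, 'f) lfun, 'p) lang" and R :: "'k set"
    and M :: "('u, ('k, 'f) gfun, ('k, 'f, 'p) grel) struct" and e :: "'u \<Rightarrow> 'u \<Rightarrow> 'k"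
  assumes R: "is_subring R" and L: "sublang (mod_lang UNIV) L"
    and vsN: "is_vector_space (reduct M)" and strN: "is_struct L (reduct M)"
    and e_inj: "inj_on e (Dom M)" and e_zero: "e (vzero (reduct M)) = 0"
    and e_add: "\<forall>a\<in>Dom M. \<forall>b\<in>Dom M. e (vadd (reduct M) a b) = e a + e b"
    and e_smul: "\<forall>a\<in>Dom M. \<forall>c. e (smul (reduct M) c a) = (\<lambda>x. c * e a x)"
    and QE: "wf_fm L \<phi> \<Longrightarrow> \<exists>\<psi>. wf_fm L \<psi> \<and> qfree \<psi> \<and>
      (\<forall>v. range v \<subseteq> Dom M \<longrightarrow> (sat (reduct M) v \<phi> \<longleftrightarrow> sat (reduct M) v \<psi>))"
    and ex_inf: "wf_fm L \<phi> \<Longrightarrow> \<exists>\<psi>. wf_fm L \<psi> \<and>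
      (\<forall>v. range v \<subseteq> Dom M \<longrightarrow> (sat (reduct M) v \<psi> \<longleftrightarrow> infinite (sols (reduct M) \<phi> x v)))"
    and fibre: "wf_fm L \<phi> \<Longrightarrow> \<exists>S. finite S \<and> (\<forall>t\<in>S. x \<notin> snd ` set t) \<and>
      (\<forall>v. range v \<subseteq> Dom M \<longrightarrow> finite (sols (reduct M) \<phi> x v) \<longrightarrow>
         sols (reduct M) \<phi> x v \<subseteq> (\<lambda>t. eval_tm (reduct M) v (lin_tm t)) ` S)"
    and nip: "wf_fm L \<phi> \<Longrightarrow> \<not> has_IP (reduct M) \<phi> X"
    and modul: "ax_module R M" and indep: "ax_indep R M" and density: "ax_density L R M"
    and extension: "ax_extension L M"
    and strM: "is_struct (lang_Gplus L R) M"
    and span: "lin_indep (frac_field R) ls \<Longrightarrow> a \<in> Dom M \<Longrightarrow> rl M (GSpan ls) [a] \<longleftrightarrow> a \<in> G_span M ls"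
    and coord: "lin_indep (frac_field R) ls \<Longrightarrow> i < length ls \<Longrightarrow> a \<in> Dom M \<Longrightarrow> b \<in> Dom M \<Longrightarrow>
      a = fn M (Coord ls i) [b] \<longleftrightarrow>
        (b \<in> G_span M ls \<and> (\<exists>xs. length xs = length ls \<and> set xs \<subseteq> G_of M \<and>
           b = lincomb (reduct M) ls xs \<and> xs ! i = a)) \<or>
        (b \<notin> G_span M ls \<and> a = vzero (reduct M))"
begin

section \<open>The model transported to a space of functions\<close>

abbreviation N where "N \<equiv> reduct M"

lemma Dom_N [simp]: "Dom N = Dom M" by (simp add: reduct_def)

sublocale N: vspace N by unfold_locales (rule vsN)

definition scl :: "'k \<Rightarrow> ('u \<Rightarrow> 'k) \<Rightarrow> 'u \<Rightarrow> 'k" where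
  "scl c f = (\<lambda>x. c * f x)"

definition V where "V = e ` Dom M"
definition G where "G = e ` G_of M"
definition d where "d = inv_into (Dom M) e"

lemma d_e [simp]: "a \<in> Dom M \<Longrightarrow> d (e a) = a"
  unfolding d_def by (rule inv_into_f_f[OF e_inj])

lemma e_d [simp]: "f \<in> V \<Longrightarrow> e (d f) = f"
  unfolding d_def V_def by (rule f_inv_into_f)

lemma e_V [simp]: "a \<in> Dom M \<Longrightarrow> e a \<in> V" by (simp add: V_def)

lemma d_Dom [simp]: "f \<in> V \<Longrightarrow> d f \<in> Dom M"
  unfolding d_def V_def by (rule inv_into_into)

lemma G_Dom: "g \<in> G_of M \<Longrightarrow> g \<in> Dom M" by (simp add: G_of_def)

lemma e_G_iff: "a \<in> Dom M \<Longrightarrow> e a \<in> G \<longleftrightarrow> a \<in> G_of M"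
  using e_inj G_Dom by (auto simp: G_def inj_on_def)

lemma d_G: "f \<in> G \<Longrightarrow> d f \<in> G_of M"
  by (auto simp: G_def G_Dom)

lemma val_Dom: "v \<in> vals V \<Longrightarrow> range (d \<circ> v) \<subseteq> Dom M"
  by (rule vals_o) auto

lemma val_app: "v \<in> vals V \<Longrightarrow> v i \<in> V" by (auto simp: vals_def)

lemma d_upd: "d \<circ> v(x := a) = (d \<circ> v)(x := d a)" by auto

lemma e_eq_iff: "a \<in> Dom M \<Longrightarrow> b \<in> Dom M \<Longrightarrow> e a = e b \<longleftrightarrow> a = b"
  using e_inj by (auto simp: inj_on_def)

sublocale vector_space scl
  by unfold_locales (auto simp: scl_def algebra_simps fun_eq_iff)

lemma e_lin: "v \<in> vals V \<Longrightarrow> e (eval_tm N (d \<circ> v) (lin_tm t)) = lin scl t v"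
proof (induction t)
  case Nil
  then show ?case by (simp add: e_zero)
next
  case (Cons p t)
  have "d (v (snd p)) \<in> Dom M" using val_app[OF Cons.prems] by simp
  then have "e (eval_tm N (d \<circ> v) (lin_tm (p # t))) =
      e (smul N (fst p) (d (v (snd p)))) + e (eval_tm N (d \<circ> v) (lin_tm t))"
    using e_add N.closed(3)[of _ "fst p"] N.eval_lin_Dom[of "d \<circ> v" t] val_Dom[OF Cons.prems] by simp
  also have "e (smul N (fst p) (d (v (snd p)))) = scl (fst p) (v (snd p))"
    using e_smul \<open>d (v (snd p)) \<in> Dom M\<close> val_app[OF Cons.prems] by (simp add: scl_def)
  finally show ?case using Cons.IH[OF Cons.prems] by (cases p) (simp add: lin_Cons)
qed

lemma eval_lin: "v \<in> vals V \<Longrightarrow> eval_tm N (d \<circ> v) (lin_tm t) = d (lin scl t v)"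
  using e_lin[of v t] N.eval_lin_Dom[of "d \<circ> v" t] val_Dom[of v] by (metis Dom_N d_e)

definition DS where "DS \<phi> = {v \<in> vals V. sat N (d \<circ> v) \<phi>}"
definition LD where "LD = {DS \<phi> |\<phi>. wf_fm L \<phi>}"

lemma fibre_sols:
  assumes "v \<in> vals V"
  shows "{a \<in> V. v(x := a) \<in> DS \<phi>} = e ` sols N \<phi> x (d \<circ> v)"
proof -
  have "v(x := a) \<in> DS \<phi> \<longleftrightarrow> sat N ((d \<circ> v)(x := d a)) \<phi>" if "a \<in> V" for a
    using assms that unfolding DS_def by (auto simp: d_upd vals_def)
  then have "{a \<in> V. v(x := a) \<in> DS \<phi>} = {a \<in> V. sat N ((d \<circ> v)(x := d a)) \<phi>}" by auto
  also have "\<dots> = e ` sols N \<phi> x (d \<circ> v)"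
  proof (intro equalityI subsetI)
    fix a assume "a \<in> {a \<in> V. sat N ((d \<circ> v)(x := d a)) \<phi>}"
    then have "d a \<in> sols N \<phi> x (d \<circ> v)" "a = e (d a)" by (auto simp: sols_def)
    then show "a \<in> e ` sols N \<phi> x (d \<circ> v)" by blast
  qed (auto simp: sols_def)
  finally show ?thesis .
qed

lemma finite_fibre_sols:
  assumes "v \<in> vals V"
  shows "finite {a \<in> V. v(x := a) \<in> DS \<phi>} \<longleftrightarrow> finite (sols N \<phi> x (d \<circ> v))"
  unfolding fibre_sols[OF assms]
  by (rule finite_image_iff) (rule inj_on_subset[OF e_inj], auto simp: sols_def)

lemma LD_I: "wf_fm L \<phi> \<Longrightarrow> DS \<phi> \<in> LD" by (auto simp: LD_def)

lemma wf_lin: "wf_tm L (lin_tm t)" by (rule wf_lin_tm[OF L])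

lemma e_lincomb:
  assumes "length as = length ls" "set as \<subseteq> Dom M"
  shows "lincomb N ls as \<in> Dom M \<and> e (lincomb N ls as) = (\<Sum>i<length ls. scl (ls ! i) (e (as ! i)))"
  using assms
proof (induction as ls rule: list_induct2)
  case Nil
  then show ?case using N.closed(1) by (simp add: lincomb_def e_zero)
next
  case (Cons a as l ls)
  have IH: "lincomb N ls as \<in> Dom M" "e (lincomb N ls as) = (\<Sum>i<length ls. scl (ls ! i) (e (as ! i)))"
    using Cons by auto
  have a: "a \<in> Dom M" "smul N l a \<in> Dom M" using Cons.prems N.closed(3)[of a l] by auto
  have eq: "lincomb N (l # ls) (a # as) = vadd N (smul N l a) (lincomb N ls as)" by (simp add: lincomb_def)
  have "e (lincomb N (l # ls) (a # as)) = scl l (e a) + (\<Sum>i<length ls. scl (ls ! i) (e (as ! i)))"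
    unfolding eq using e_add e_smul IH a by (simp add: scl_def)
  then show ?case
    using N.closed(2)[of "smul N l a" "lincomb N ls as"] IH a
    by (simp add: eq sum.lessThan_Suc_shift del: sum.lessThan_Suc)
qed

lemma nip_DS:
  assumes "wf_fm L \<phi>"
  shows "nip_set V (DS \<phi>)"
  unfolding nip_set_def
proof (rule allI, rule ccontr)
  fix X assume "\<nexists>n. \<not> shatters_val V (DS \<phi>) X n"
  then have sh: "shatters_val V (DS \<phi>) X n" for n by blast
  have "has_IP N \<phi> X"
    unfolding has_IP_def
  proof
    fix n :: nat
    obtain a b where ab: "\<And>i. range (a i) \<subseteq> V" "\<And>I. range (b I) \<subseteq> V"
      "\<And>i I. i < n \<Longrightarrow> I \<subseteq> {..<n} \<Longrightarrow> splice_val X (a i) (b I) \<in> DS \<phi> \<longleftrightarrow> i \<in> I"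
      using sh[of n] by (rule shatters_valE) (rule that; assumption)
    have o: "d \<circ> splice_val X (a i) (b I) = (\<lambda>z. if z \<in> X then (d \<circ> a i) z else (d \<circ> b I) z)" for i I
      by (auto simp: splice_val_def)
    have mem: "splice_val X (a i) (b I) \<in> vals V" for i I
      using range_splice_val[OF ab(1,2)] by (simp add: vals_def)
    show "\<exists>a b. (\<forall>i. range (a i) \<subseteq> Dom N) \<and> (\<forall>I. range (b I) \<subseteq> Dom N) \<and>
      (\<forall>i<n. \<forall>I\<subseteq>{..<n}. sat N (\<lambda>z. if z \<in> X then a i z else b I z) \<phi> \<longleftrightarrow> i \<in> I)"
    proof (intro exI[of _ "\<lambda>i. d \<circ> a i"] exI[of _ "\<lambda>I. d \<circ> b I"] conjI allI impI)
      show "range (d \<circ> a i) \<subseteq> Dom N" "range (d \<circ> b I) \<subseteq> Dom N" for i I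
        using val_Dom[of "a i"] val_Dom[of "b I"] ab by (auto simp: vals_def)
      show "sat N (\<lambda>z. if z \<in> X then (d \<circ> a i) z else (d \<circ> b I) z) \<phi> \<longleftrightarrow> i \<in> I"
        if "i < n" "I \<subseteq> {..<n}" for i I
        using ab(3)[OF that] mem unfolding DS_def o[symmetric] by simp
    qed
  qed
  with nip[OF assms] show False by blast
qed

text \<open>The finitely many sets to be avoided are merged into one formula \<open>\<psi>\<close>,
  a disjunction of equations for \<open>x\<close>, with their base points as additional parameters;
  co-density is then applied once.\<close>

lemma codens_DS:
  assumes \<phi>: "wf_fm L \<phi>" and v: "v \<in> vals V" and inf: "infinite {a \<in> V. v(x := a) \<in> DS \<phi>}"
    and B: "finite B" "fst ` B \<subseteq> V"
  shows "\<exists>a\<in>V. v(x := a) \<in> DS \<phi> \<and>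
        (\<forall>(b, cs)\<in>B. \<forall>gs. length gs = length cs \<and> set gs \<subseteq> G \<longrightarrow>
           a \<noteq> b + (\<Sum>i<length cs. scl (cs ! i) (gs ! i)))"
proof -
  obtain bs where bs: "set bs = B" using finite_list[OF B(1)] by blast
  obtain n0 where n0: "\<forall>i\<in>fv \<phi>. i < n0" using fv_bound .
  define n where "n = max n0 (Suc x)"
  define m where "m = length bs"
  define K where "K = Max (insert 0 ((\<lambda>p. length (snd p)) ` set bs))"
  define Z where "Z = {n + m..<n + m + K}"
  define t where "t j = (1, n + j) # map (\<lambda>i. (snd (bs ! j) ! i, n + m + i)) [0..<length (snd (bs ! j))]" for j
  define \<psi> :: "(('k, 'f) lfun, 'p) fm" where "\<psi> = disj (map (\<lambda>j. Eq (Var x) (lin_tm (t j))) [0..<m])"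
  define v' where "v' i = (if n \<le> i \<and> i < n + m then fst (bs ! (i - n)) else v i)" for i
  have v': "v' \<in> vals V"
    unfolding vals_def
  proof (intro CollectI subsetI)
    fix y assume "y \<in> range v'"
    then obtain i where i: "y = v' i" by blast
    show "y \<in> V"
    proof (cases "n \<le> i \<and> i < n + m")
      case True
      then have "bs ! (i - n) \<in> B" unfolding bs[symmetric] by (intro nth_mem) (auto simp: m_def)
      then show ?thesis using True i B(2) by (auto simp: v'_def)
    next
      case False
      then have "y = v i" using i by (auto simp: v'_def)
      then show ?thesis using val_app[OF v] by simp
    qed
  qed
  have K: "length (snd (bs ! j)) \<le> K" if "j < m" for j
    unfolding K_def using that by (intro Max_ge) (auto simp: m_def)
  have xt: "x \<notin> fv_tm (lin_tm (t j))" for j unfolding fv_lin_tm by (auto simp: t_def n_def)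
  have sols_\<phi>: "sols N \<phi> x (d \<circ> v') = sols N \<phi> x (d \<circ> v)"
  proof -
    have "sat N ((d \<circ> v')(x := a)) \<phi> \<longleftrightarrow> sat N ((d \<circ> v)(x := a)) \<phi>" for a
      by (rule sat_cong) (use n0 in \<open>force simp: v'_def n_def\<close>)
    then show ?thesis by (simp add: sols_def)
  qed
  have sols_\<psi>: "a \<in> sols N \<psi> x w \<longleftrightarrow> a \<in> Dom M \<and> (\<exists>j<m. a = eval_tm N w (lin_tm (t j)))" for a w
  proof -
    have "eval_tm N (w(x := a)) (lin_tm (t j)) = eval_tm N w (lin_tm (t j))" for j
      by (rule eval_tm_cong) (use xt in auto)
    then show ?thesis by (auto simp: sols_def \<psi>_def sat_disj)
  qed
  \<comment> \<open>For each choice of the other values \<open>\<psi>\<close> has at most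
    \<open>m\<close> solutions in \<open>x\<close>; \<open>Suc m\<close> is taken as the bound
    because the axiom wants a positive one.\<close>
  have "\<exists>a\<in>sols N \<phi> x (d \<circ> v'). \<forall>w. w ` Z \<subseteq> G_of M \<longrightarrow> a \<notin> sols N \<psi> x (override_on (d \<circ> v') w Z)"
  proof (rule extension[unfolded ax_extension_def, rule_format, of \<phi> \<psi> Z x "Suc m"], intro conjI allI impI)
    show "wf_fm L \<psi>" unfolding \<psi>_def by (rule wf_disj) (auto simp: wf_lin)
    show "x \<notin> Z" by (auto simp: Z_def n_def)
    show "fv \<phi> \<inter> Z = {}" using n0 by (force simp: Z_def n_def)
    show "range (d \<circ> v') \<subseteq> Dom M" by (rule val_Dom[OF v'])
    show "infinite (sols N \<phi> x (d \<circ> v'))" unfolding sols_\<phi> using inf finite_fibre_sols[OF v] by simp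
    fix w
    have "sols N \<psi> x (override_on (d \<circ> v') w Z) \<subseteq>
        (\<lambda>j. eval_tm N (override_on (d \<circ> v') w Z) (lin_tm (t j))) ` {..<m}" (is "?S \<subseteq> ?f ` _")
      using sols_\<psi> by auto
    then have "finite ?S \<and> card ?S \<le> card (?f ` {..<m})" by (meson card_mono finite_imageI finite_lessThan finite_subset)
    then show "finite ?S" "card ?S \<le> Suc m" using card_image_le[of "{..<m}" ?f] by auto
  qed (use \<phi> in \<open>auto simp: Z_def\<close>)
  then obtain a where a: "a \<in> sols N \<phi> x (d \<circ> v)"
    and av: "\<And>w. w ` Z \<subseteq> G_of M \<Longrightarrow> a \<notin> sols N \<psi> x (override_on (d \<circ> v') w Z)"
    unfolding sols_\<phi> by blast
  have aD: "a \<in> Dom M" using a by (simp add: sols_def)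
  show ?thesis
  proof (intro bexI[of _ "e a"] conjI)
    have "e a \<in> {a \<in> V. v(x := a) \<in> DS \<phi>}" unfolding fibre_sols[OF v] using a by blast
    then show "v(x := e a) \<in> DS \<phi>" by simp
    show "\<forall>(b, cs)\<in>B. \<forall>gs. length gs = length cs \<and> set gs \<subseteq> G \<longrightarrow>
           e a \<noteq> b + (\<Sum>i<length cs. scl (cs ! i) (gs ! i))"
    proof (clarify)
      fix b cs gs assume bcs: "(b, cs) \<in> B" and gs: "length gs = length cs" "set gs \<subseteq> G"
        and eq: "e a = b + (\<Sum>i<length cs. scl (cs ! i) (gs ! i))"
      obtain j where j: "j < m" "bs ! j = (b, cs)" using bcs bs by (auto simp: m_def in_set_conv_nth)
      define g where "g i = (if n + m \<le> i \<and> i < n + m + length cs then gs ! (i - (n + m)) else e (vzero N))" for i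
      have zG: "vzero N \<in> G_of M" using modul by (auto simp: ax_module_def proper_submodule_def)
      have g: "g i \<in> G" for i
        using gs zG by (auto simp: g_def G_def[symmetric] e_G_iff[OF N.closed(1)[simplified]] subset_iff)
      have GV: "G \<subseteq> V" using G_Dom by (auto simp: G_def V_def)
      have ov: "override_on (d \<circ> v') (d \<circ> g) Z = d \<circ> override_on v' g Z" by (auto simp: override_on_def)
      have oV: "override_on v' g Z \<in> vals V" using v' g GV by (auto simp: vals_def override_on_def)
      have "lin scl (t j) (override_on v' g Z) = scl 1 (override_on v' g Z (n + j)) +
          (\<Sum>i<length cs. scl (cs ! i) (override_on v' g Z (n + m + i)))"
        using j by (simp add: t_def lin_Cons)
          (simp add: lin_def interv_sum_list_conv_sum_set_nat atLeast0LessThan comp_def)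
      also have "(\<Sum>i<length cs. scl (cs ! i) (override_on v' g Z (n + m + i))) = (\<Sum>i<length cs. scl (cs ! i) (gs ! i))"
        using K[OF j(1)] j by (intro sum.cong) (auto simp: override_on_def Z_def g_def)
      also have "override_on v' g Z (n + j) = b"
        using j by (auto simp: override_on_def Z_def v'_def)
      finally have "lin scl (t j) (override_on v' g Z) = e a" by (simp only: eq scale_one)
      then have "a = eval_tm N (d \<circ> override_on v' g Z) (lin_tm (t j))"
        using eval_lin[OF oV] aD by simp
      then have "a \<in> sols N \<psi> x (override_on (d \<circ> v') (d \<circ> g) Z)"
        unfolding sols_\<psi> ov using aD j by blast
      moreover have "(d \<circ> g) ` Z \<subseteq> G_of M" using g d_G by auto
      ultimately show False using av by blast
    qed
  qed (use aD in simp)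
qed

sublocale gpair scl V G R LD
proof unfold_locales
  have sm: "proper_submodule R N (G_of M)" using modul by (simp add: ax_module_def)
  show "is_subring R" by (rule R)
  show "0 \<in> V" using e_V[of "vzero N"] N.closed(1) e_zero by simp
  show "a + b \<in> V" if "a \<in> V" "b \<in> V" for a b
  proof -
    have "a + b = e (vadd N (d a) (d b))" using e_add that by simp
    then show ?thesis using that N.closed(2)[of "d a" "d b"] by simp
  qed
  show "scl c a \<in> V" if "a \<in> V" for a c
  proof -
    have "scl c a = e (smul N c (d a))" using e_smul that by (simp add: scl_def)
    then show ?thesis using that N.closed(3)[of "d a" c] by simp
  qed
  show "G \<subseteq> V" using G_Dom by (auto simp: G_def V_def)
  show "0 \<in> G" using sm e_zero unfolding G_def proper_submodule_def by (metis imageI)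
  show "a + b \<in> G" if ab: "a \<in> G" "b \<in> G" for a b
  proof -
    obtain g h where gh: "g \<in> G_of M" "a = e g" "h \<in> G_of M" "b = e h" using ab by (auto simp: G_def)
    then have "a + b = e (vadd N g h)" using e_add G_Dom by simp
    moreover have "vadd N g h \<in> G_of M" using sm gh by (simp add: proper_submodule_def)
    ultimately show ?thesis by (simp add: G_def)
  qed
  show "scl r a \<in> G" if ra: "r \<in> R" "a \<in> G" for r a
  proof -
    obtain g where g: "g \<in> G_of M" "a = e g" using ra by (auto simp: G_def)
    then have "scl r a = e (smul N r g)" using e_smul G_Dom by (simp add: scl_def)
    moreover have "smul N r g \<in> G_of M" using sm g ra by (simp add: proper_submodule_def)
    ultimately show ?thesis by (simp add: G_def)
  qed
  show "gs i = 0"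
    if ls: "rind (*) R ls" and gs: "\<And>i. i < length ls \<Longrightarrow> gs i \<in> G"
      and z: "(\<Sum>i<length ls. scl (ls ! i) (gs i)) = 0" and i: "i < length ls" for ls gs i
  proof -
    let ?as = "map (\<lambda>i. d (gs i)) [0..<length ls]"
    have as: "length ?as = length ls" "set ?as \<subseteq> G_of M" using gs d_G by auto
    have GV: "G \<subseteq> V" using G_Dom by (auto simp: G_def V_def)
    have "set ?as \<subseteq> Dom M" using as G_Dom by blast
    from e_lincomb[OF as(1) this]
    have l: "lincomb N ls ?as \<in> Dom M" "e (lincomb N ls ?as) = (\<Sum>i<length ls. scl (ls ! i) (e (?as ! i)))" by auto
    have "(\<Sum>i<length ls. scl (ls ! i) (e (?as ! i))) = (\<Sum>i<length ls. scl (ls ! i) (gs i))"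
      by (rule sum.cong) (use gs GV in \<open>auto simp: subset_iff\<close>)
    then have "e (lincomb N ls ?as) = e (vzero N)" using l(2) z e_zero by simp
    then have "lincomb N ls ?as = vzero N" using e_eq_iff l(1) N.closed(1) by simp
    then have "\<forall>g\<in>set ?as. g = vzero N"
      using indep[unfolded ax_indep_def, rule_format, of ls ?as] lin_indep_if_rind[OF R ls] as by simp
    then have "d (gs i) = vzero N" using i by simp
    then have "e (d (gs i)) = 0" using e_zero by simp
    then show ?thesis using gs[OF i] GV by (simp add: subset_iff)
  qed
  show "\<Phi> \<subseteq> vals V" if "\<Phi> \<in> LD" for \<Phi> using that by (auto simp: LD_def DS_def)
  show "vals V - \<Phi> \<in> LD" if "\<Phi> \<in> LD" for \<Phi>
  proof -
    obtain \<phi> where \<phi>: "wf_fm L \<phi>" "\<Phi> = DS \<phi>" using \<open>\<Phi> \<in> LD\<close> by (auto simp: LD_def)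
    have "vals V - \<Phi> = DS (Neg \<phi>)" by (auto simp: \<phi> DS_def)
    then show ?thesis using LD_I[of "Neg \<phi>"] \<phi> by simp
  qed
  show "\<Phi> \<inter> \<Psi> \<in> LD" if \<Phi>\<Psi>: "\<Phi> \<in> LD" "\<Psi> \<in> LD" for \<Phi> \<Psi>
  proof -
    obtain \<phi> \<psi> where \<phi>: "wf_fm L \<phi>" "\<Phi> = DS \<phi>" "wf_fm L \<psi>" "\<Psi> = DS \<psi>" using \<Phi>\<Psi> by (auto simp: LD_def)
    have "\<Phi> \<inter> \<Psi> = DS (And \<phi> \<psi>)" by (auto simp: \<phi> DS_def)
    then show ?thesis using LD_I[of "And \<phi> \<psi>"] \<phi> by simp
  qed
  show "{v \<in> vals V. lin scl t v = 0} \<in> LD" for t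
  proof -
    have "lin scl t v = 0 \<longleftrightarrow> sat N (d \<circ> v) (Eq (lin_tm t) (lin_tm []))" if v: "v \<in> vals V" for v
    proof -
      have "eval_tm N (d \<circ> v) (lin_tm t) \<in> Dom M" using N.eval_lin_Dom[of "d \<circ> v" t] val_Dom[OF v] by simp
      then have "e (eval_tm N (d \<circ> v) (lin_tm t)) = e (vzero N) \<longleftrightarrow> eval_tm N (d \<circ> v) (lin_tm t) = vzero N"
        using e_eq_iff N.closed(1) by simp
      then show ?thesis using e_lin[OF v, of t] e_zero by simp
    qed
    then have "{v \<in> vals V. lin scl t v = 0} = DS (Eq (lin_tm t) (lin_tm []))" by (auto simp: DS_def)
    moreover have "wf_fm L (Eq (lin_tm t) (lin_tm []))" using wf_lin[of t] wf_lin[of "[]"] by simp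
    ultimately show ?thesis using LD_I by simp
  qed
  show "{v \<in> vals V. (\<lambda>i. lin scl (\<sigma> i) v) \<in> \<Phi>} \<in> LD" if "\<Phi> \<in> LD" for \<Phi> \<sigma>
  proof -
    obtain \<phi> where \<phi>: "wf_fm L \<phi>" "\<Phi> = DS \<phi>" using \<open>\<Phi> \<in> LD\<close> by (auto simp: LD_def)
    \<comment> \<open>Quantifier elimination makes the substitution of terms harmless: without bound
      variables nothing can be captured.\<close>
    obtain \<psi> where \<psi>: "wf_fm L \<psi>" "qfree \<psi>"
      "\<forall>v. range v \<subseteq> Dom M \<longrightarrow> (sat N v \<phi> \<longleftrightarrow> sat N v \<psi>)" using QE[OF \<phi>(1)] by (elim exE conjE)
    have "(\<lambda>i. lin scl (\<sigma> i) v) \<in> \<Phi> \<longleftrightarrow> sat N (d \<circ> v) (subst_fm (\<lambda>i. lin_tm (\<sigma> i)) \<psi>)"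
      if v: "v \<in> vals V" for v
    proof -
      have D: "eval_tm N (d \<circ> v) (lin_tm t) \<in> Dom M" for t
        using N.eval_lin_Dom[of "d \<circ> v" t] val_Dom[OF v] by simp
      have w: "(\<lambda>i. lin scl (\<sigma> i) v) \<in> vals V"
        unfolding vals_def e_lin[OF v, symmetric] using D by auto
      have "sat N (d \<circ> v) (subst_fm (\<lambda>i. lin_tm (\<sigma> i)) \<psi>) \<longleftrightarrow>
          sat N (d \<circ> (\<lambda>i. lin scl (\<sigma> i) v)) \<psi>"
        unfolding sat_subst_fm[OF \<psi>(2)] eval_lin[OF v] by (simp add: comp_def)
      also have "\<dots> \<longleftrightarrow> sat N (d \<circ> (\<lambda>i. lin scl (\<sigma> i) v)) \<phi>"
        using \<psi>(3)[rule_format, OF val_Dom[OF w]] by simp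
      finally show ?thesis using w by (simp add: \<phi> DS_def)
    qed
    then have "{v \<in> vals V. (\<lambda>i. lin scl (\<sigma> i) v) \<in> \<Phi>} = DS (subst_fm (\<lambda>i. lin_tm (\<sigma> i)) \<psi>)"
      by (auto simp: DS_def)
    moreover have "wf_fm L (subst_fm (\<lambda>i. lin_tm (\<sigma> i)) \<psi>)" by (rule wf_subst_fm[OF wf_lin \<psi>(1)])
    ultimately show ?thesis using LD_I by simp
  qed
  show "\<exists>N. dep V \<Phi> N" if "\<Phi> \<in> LD" for \<Phi>
  proof -
    obtain \<phi> where \<phi>: "wf_fm L \<phi>" "\<Phi> = DS \<phi>" using \<open>\<Phi> \<in> LD\<close> by (auto simp: LD_def)
    obtain n where n: "\<forall>i\<in>fv \<phi>. i < n" using fv_bound .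
    have "dep V \<Phi> n"
      unfolding dep_def
    proof (intro ballI impI)
      fix v w assume a: "v \<in> vals V" "w \<in> vals V" "\<forall>i<n. v i = w i" "v \<in> \<Phi>"
      have "sat N (d \<circ> v) \<phi> \<longleftrightarrow> sat N (d \<circ> w) \<phi>" by (rule sat_cong) (use a(3) n in simp)
      then show "w \<in> \<Phi>" using a by (simp add: \<phi> DS_def)
    qed
    then show ?thesis by blast
  qed
  show "{v \<in> vals V. infinite {a \<in> V. v(x := a) \<in> \<Phi>}} \<in> LD" if "\<Phi> \<in> LD" for \<Phi> x
  proof -
    obtain \<phi> where \<phi>: "wf_fm L \<phi>" "\<Phi> = DS \<phi>" using \<open>\<Phi> \<in> LD\<close> by (auto simp: LD_def)
    obtain \<psi> where \<psi>: "wf_fm L \<psi>"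
      "\<forall>v. range v \<subseteq> Dom M \<longrightarrow> (sat N v \<psi> \<longleftrightarrow> infinite (sols N \<phi> x v))" using ex_inf[OF \<phi>(1), of x] by (elim exE conjE)
    have "{v \<in> vals V. infinite {a \<in> V. v(x := a) \<in> \<Phi>}} = DS \<psi>"
      unfolding DS_def[of \<psi>]
    proof (intro Collect_cong conj_cong refl)
      fix v assume v: "v \<in> vals V"
      show "infinite {a \<in> V. v(x := a) \<in> \<Phi>} \<longleftrightarrow> sat N (d \<circ> v) \<psi>"
        using \<psi>(2)[rule_format, OF val_Dom[OF v]] finite_fibre_sols[OF v] by (simp add: \<phi>)
    qed
    then show ?thesis using LD_I[OF \<psi>(1)] by simp
  qed
  show "\<exists>T. finite T \<and> (\<forall>t\<in>T. x \<notin> snd ` set t) \<and> (\<forall>v\<in>vals V. finite {a \<in> V. v(x := a) \<in> \<Phi>} \<longrightarrow>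
      {a \<in> V. v(x := a) \<in> \<Phi>} \<subseteq> (\<lambda>t. lin scl t v) ` T)" if "\<Phi> \<in> LD" for \<Phi> x
  proof -
    obtain \<phi> where \<phi>: "wf_fm L \<phi>" "\<Phi> = DS \<phi>" using \<open>\<Phi> \<in> LD\<close> by (auto simp: LD_def)
    obtain S where S: "finite S" "\<forall>t\<in>S. x \<notin> snd ` set t"
      "\<forall>v. range v \<subseteq> Dom M \<longrightarrow> finite (sols N \<phi> x v) \<longrightarrow>
         sols N \<phi> x v \<subseteq> (\<lambda>t. eval_tm N v (lin_tm t)) ` S" using fibre[OF \<phi>(1), of x] by (elim exE conjE)
    have "{a \<in> V. v(x := a) \<in> \<Phi>} \<subseteq> (\<lambda>t. lin scl t v) ` S"
      if v: "v \<in> vals V" and f: "finite {a \<in> V. v(x := a) \<in> \<Phi>}" for v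
    proof -
      have "finite (sols N \<phi> x (d \<circ> v))" using f finite_fibre_sols[OF v] by (simp add: \<phi>)
      then have "sols N \<phi> x (d \<circ> v) \<subseteq> (\<lambda>t. eval_tm N (d \<circ> v) (lin_tm t)) ` S"
        using S(3) val_Dom[OF v] by blast
      then have "e ` sols N \<phi> x (d \<circ> v) \<subseteq> e ` (\<lambda>t. eval_tm N (d \<circ> v) (lin_tm t)) ` S" by (rule image_mono)
      then show ?thesis unfolding \<phi> fibre_sols[OF v] image_image e_lin[OF v] .
    qed
    with S(1,2) show ?thesis by blast
  qed
  show "nip_set V \<Phi>" if "\<Phi> \<in> LD" for \<Phi> using that nip_DS by (auto simp: LD_def)
  show "\<exists>g\<in>G. v(x := scl r g) \<in> \<Phi>"
    if \<Phi>: "\<Phi> \<in> LD" and v: "v \<in> vals V" and r: "r \<in> R" "r \<noteq> 0" and inf: "infinite {a \<in> V. v(x := a) \<in> \<Phi>}"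
    for \<Phi> v r x
  proof -
    obtain \<phi> where \<phi>: "wf_fm L \<phi>" "\<Phi> = DS \<phi>" using \<Phi> by (auto simp: LD_def)
    have "infinite (sols N \<phi> x (d \<circ> v))" using inf finite_fibre_sols[OF v] by (simp add: \<phi>)
    then obtain a where a: "a \<in> sols N \<phi> x (d \<circ> v)" "a \<in> smul N r ` G_of M"
      using density[unfolded ax_density_def, rule_format, of r \<phi> "d \<circ> v" x] r \<phi>(1) val_Dom[OF v] by auto
    then obtain g where g: "g \<in> G_of M" "a = smul N r g" by blast
    have "e a \<in> {a \<in> V. v(x := a) \<in> \<Phi>}" unfolding \<phi> fibre_sols[OF v] using a by blast
    moreover have "e a = scl r (e g)" using g e_smul G_Dom by (simp add: scl_def)
    ultimately show ?thesis using g by (auto simp: G_def)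
  qed
  show "\<exists>a\<in>V. v(x := a) \<in> \<Phi> \<and> (\<forall>(b, cs)\<in>B. \<forall>gs. length gs = length cs \<and> set gs \<subseteq> G \<longrightarrow>
           a \<noteq> b + (\<Sum>i<length cs. scl (cs ! i) (gs ! i)))"
    if \<Phi>: "\<Phi> \<in> LD" and "v \<in> vals V" "infinite {a \<in> V. v(x := a) \<in> \<Phi>}" "finite B" "fst ` B \<subseteq> V" for \<Phi> v x B
  proof -
    obtain \<phi> where "wf_fm L \<phi>" "\<Phi> = DS \<phi>" using \<Phi> by (auto simp: LD_def)
    then show ?thesis using codens_DS[of \<phi> v x B] that by simp
  qed
qed

end

section \<open>Terms, atoms and formulas of the expansion\<close>

definition updl :: "(nat \<Rightarrow> 'v) \<Rightarrow> nat \<Rightarrow> 'v list \<Rightarrow> nat \<Rightarrow> 'v" where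
  "updl v k as = (\<lambda>i. if k \<le> i \<and> i < k + length as then as ! (i - k) else v i)"

lemma updl_Nil [simp]: "updl v k [] = v"
  by (rule ext) (auto simp: updl_def)

lemma updl_Cons: "updl v k (a # as) = updl (v(k := a)) (Suc k) as"
proof
  fix i
  consider "i < k" | "i = k" | "k < i" by linarith
  then show "updl v k (a # as) i = updl (v(k := a)) (Suc k) as i"
    by cases (auto simp: updl_def nth_Cons' Suc_le_eq)
qed

lemma map_updl: "map (updl v k as) [k..<k + length as] = as"
  by (rule nth_equalityI) (auto simp: updl_def)

lemma wf_tm_mono:
  assumes "\<And>f n. fun_ar L f = Some n \<Longrightarrow> fun_ar L' f = Some n"
  shows "wf_tm L t \<Longrightarrow> wf_tm L' t"
  by (induction t) (auto simp: assms)

context generic_pair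
begin

abbreviation ev where "ev v t \<equiv> e (eval_tm M (d \<circ> v) t)"

text \<open>Terms of the expansion need not be linear forms, so \<open>NF_subst1\<close> does not
  apply to them and closure under their values is a property to be proved by induction.\<close>

definition T_closed where
  "T_closed t \<longleftrightarrow> (\<forall>S\<in>NF. \<forall>x. {v \<in> Val. v(x := ev v t) \<in> S} \<in> NF)"

lemma eval_M_Dom: "v \<in> Val \<Longrightarrow> wf_tm (lang_Gplus L R) t \<Longrightarrow> eval_tm M (d \<circ> v) t \<in> Dom M"
  by (rule eval_tm_Dom[OF strM val_Dom])

lemma ev_V: "v \<in> Val \<Longrightarrow> wf_tm (lang_Gplus L R) t \<Longrightarrow> ev v t \<in> V"
  by (rule e_V) (rule eval_M_Dom)

lemma Val_updl: "v \<in> Val \<Longrightarrow> set as \<subseteq> V \<Longrightarrow> updl v k as \<in> Val"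
  by (rule ValI) (auto simp: updl_def subset_iff)

text \<open>The values are written one at a time into consecutive variables from \<open>k\<close>
  on. The terms only use variables below \<open>k\<close>, so values written earlier do not disturb
  later ones.\<close>

lemma NF_updl:
  assumes "\<And>t. t \<in> set ts \<Longrightarrow> T_closed t \<and> wf_tm (lang_Gplus L R) t \<and> (\<forall>i\<in>fv_tm t. i < k)" "S \<in> NF"
  shows "{v \<in> Val. updl v k (map (ev v) ts) \<in> S} \<in> NF"
  using assms
proof (induction ts arbitrary: k)
  case Nil
  have "{v \<in> Val. v \<in> S} = S" using NF_sub[OF Nil.prems(2)] by blast
  then show ?case using Nil.prems(2) by simp
next
  case (Cons t ts)
  define S1 where "S1 = {w \<in> Val. updl w (Suc k) (map (ev w) ts) \<in> S}"
  have S1: "S1 \<in> NF" unfolding S1_def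
    by (rule Cons.IH) (use Cons.prems in \<open>auto intro: less_SucI\<close>)
  have t: "T_closed t" "wf_tm (lang_Gplus L R) t" using Cons.prems(1)[of t] by auto
  have "v(k := ev v t) \<in> S1 \<longleftrightarrow> updl v k (map (ev v) (t # ts)) \<in> S" if v: "v \<in> Val" for v
  proof -
    let ?w = "v(k := ev v t)"
    have m: "map (ev ?w) ts = map (ev v) ts"
    proof (rule map_cong[OF refl])
      fix s assume "s \<in> set ts"
      then have "\<forall>i\<in>fv_tm s. i < k" using Cons.prems(1)[of s] by simp
      then have "eval_tm M (d \<circ> ?w) s = eval_tm M (d \<circ> v) s" by (intro eval_tm_cong) auto
      then show "ev ?w s = ev v s" by simp
    qed
    have "?w \<in> Val" using v ev_V[OF v t(2)] by simp
    then show ?thesis unfolding S1_def mem_Collect_eq m list.map updl_Cons by simp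
  qed
  then have "{v \<in> Val. updl v k (map (ev v) (t # ts)) \<in> S} = {v \<in> Val. v(k := ev v t) \<in> S1}" by blast
  also have "\<dots> \<in> NF" using t(1) S1 unfolding T_closed_def by blast
  finally show ?case .
qed

lemma DS_NF: "wf_fm L \<phi> \<Longrightarrow> DS \<phi> \<in> NF"
  by (rule LD_NF[OF LD_I])

lemma in_Val_G: "v \<in> Val \<Longrightarrow> v x \<in> G \<longleftrightarrow> d (v x) \<in> G_of M"
  using e_G_iff[of "d (v x)"] Val_app[of v x] by simp

lemma NF_var_G: "{v \<in> Val. v x \<in> G} \<in> NF"
proof -
  have "{v \<in> Val. lf [(1, x)] v \<in> G} \<in> NF" by (intro BPP_NF PP_BPP PP_lf_G)
  then show ?thesis by simp
qed

lemma NF_lin: "{v \<in> Val. lf t v = 0} \<in> NF"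
  by (intro BPP_NF PP_BPP PP_lin)

lemma NF_var_eq: "{v \<in> Val. v x = v y} \<in> NF"
proof -
  have "{v \<in> Val. v x = v y} = {v \<in> Val. lf [(1, x), (- 1, y)] v = 0}" by (auto simp: lin_Cons)
  then show ?thesis using NF_lin by simp
qed

lemma NF_eq_lf: "{v \<in> Val. v x = lf t v} \<in> NF"
proof -
  have "lf ((- 1, x) # t) v = lf t v - v x" for v by (simp add: lin_Cons)
  then have "{v \<in> Val. v x = lf t v} = {v \<in> Val. lf ((- 1, x) # t) v = 0}" by auto
  then show ?thesis using NF_lin by simp
qed

definition dec :: "'k list \<Rightarrow> nat \<Rightarrow> ('k \<times> nat) list" where
  "dec ls k = map (\<lambda>j. (ls ! j, k + j)) [0..<length ls]"

lemma lf_dec: "lf (dec ls k) v = (\<Sum>j<length ls. scl (ls ! j) (v (k + j)))"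
  by (simp add: lin_def dec_def interv_sum_list_conv_sum_set_nat atLeast0LessThan comp_def)

text \<open>The coordinates \<open>xs\<close> in \<open>G\<close> become the variables from
  \<open>k\<close> on. The condition \<open>Q\<close> lets one argument serve both
  \<open>GSpan\<close>, where it is trivial, and \<open>Coord\<close>, where it fixes one
  coordinate.\<close>

lemma exGs_dec:
  assumes "z < k" "v \<in> Val" and S: "\<And>w. w \<in> Val \<Longrightarrow> w \<in> S \<longleftrightarrow> w z = lf (dec ls k) w \<and> Q w (map (\<lambda>j. d (w (k + j))) [0..<length ls])"
    and Q: "\<And>u xs. (\<And>i. i < k \<Longrightarrow> u i = v i) \<Longrightarrow> Q u xs \<longleftrightarrow> Q v xs"
  shows "v \<in> exGs {k..<k + length ls} S \<longleftrightarrow> (\<exists>xs. length xs = length ls \<and> set xs \<subseteq> G_of M \<and>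
    d (v z) = lincomb N ls xs \<and> Q v xs)"
proof
  assume "v \<in> exGs {k..<k + length ls} S"
  then obtain u where u: "\<forall>i\<in>{k..<k + length ls}. u i \<in> G" "override_on v u {k..<k + length ls} \<in> S"
    unfolding exGs_def by blast
  define w where "w = override_on v u {k..<k + length ls}"
  have w: "w \<in> Val" unfolding w_def using assms(2) u by (intro Val_override) auto
  define xs where "xs = map (\<lambda>j. d (w (k + j))) [0..<length ls]"
  have wG: "w (k + j) \<in> G" if "j < length ls" for j using u(1) that by (simp add: w_def override_on_def)
  have xs: "length xs = length ls" "set xs \<subseteq> G_of M" using wG d_G by (auto simp: xs_def)
  have "set xs \<subseteq> Dom M" using xs G_Dom by blast
  from e_lincomb[OF xs(1) this]
  have l: "lincomb N ls xs \<in> Dom M" "e (lincomb N ls xs) = (\<Sum>i<length ls. scl (ls ! i) (e (xs ! i)))" by auto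
  have "(\<Sum>i<length ls. scl (ls ! i) (e (xs ! i))) = lf (dec ls k) w"
    unfolding lf_dec by (rule sum.cong) (use wG G_V in \<open>auto simp: xs_def\<close>)
  moreover have "w z = v z" using assms(1) by (simp add: w_def override_on_def)
  moreover have "w z = lf (dec ls k) w" "Q w xs" using u(2) S[OF w] unfolding w_def[symmetric] xs_def by auto
  ultimately have "e (lincomb N ls xs) = v z" using l by simp
  then have "d (v z) = lincomb N ls xs" using l(1) d_e by metis
  moreover have "Q v xs" using Q[of w xs] \<open>Q w xs\<close> by (auto simp: w_def override_on_def)
  ultimately show "\<exists>xs. length xs = length ls \<and> set xs \<subseteq> G_of M \<and> d (v z) = lincomb N ls xs \<and> Q v xs"
    using xs by blast
next
  assume "\<exists>xs. length xs = length ls \<and> set xs \<subseteq> G_of M \<and> d (v z) = lincomb N ls xs \<and> Q v xs"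
  then obtain xs where xs: "length xs = length ls" "set xs \<subseteq> G_of M" "d (v z) = lincomb N ls xs" "Q v xs" by blast
  define u where "u i = e (xs ! (i - k))" for i
  define w where "w = override_on v u {k..<k + length ls}"
  have xD: "xs ! j \<in> G_of M" "xs ! j \<in> Dom M" if "j < length ls" for j
    using xs that G_Dom by (metis nth_mem subset_iff)+
  have u: "\<forall>i\<in>{k..<k + length ls}. u i \<in> G" using xD by (auto simp: u_def e_G_iff)
  have w: "w \<in> Val" unfolding w_def using assms(2) u by (intro Val_override) auto
  have wj: "w (k + j) = e (xs ! j)" if "j < length ls" for j using that by (simp add: w_def override_on_def u_def)
  have xs_eq: "map (\<lambda>j. d (w (k + j))) [0..<length ls] = xs"
    by (rule nth_equalityI) (use xs(1) wj xD in auto)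
  have "set xs \<subseteq> Dom M" using xs G_Dom by blast
  from e_lincomb[OF xs(1) this]
  have "e (lincomb N ls xs) = (\<Sum>i<length ls. scl (ls ! i) (e (xs ! i)))" by auto
  also have "\<dots> = lf (dec ls k) w" unfolding lf_dec by (rule sum.cong) (use wj in auto)
  finally have "w z = lf (dec ls k) w"
    using assms(1,2) xs(3) by (simp add: w_def override_on_def) (metis Val_app e_d)
  moreover have "Q w xs" using Q[of w xs] xs(4) by (auto simp: w_def override_on_def)
  ultimately have "w \<in> S" using S[OF w] by (simp add: xs_eq)
  then show "v \<in> exGs {k..<k + length ls} S" using assms(2) u unfolding exGs_def w_def by blast
qed

lemma NF_G_span: "{v \<in> Val. d (v z) \<in> G_span M ls} \<in> NF"
proof -
  define k where "k = Suc z"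
  have "{v \<in> Val. d (v z) \<in> G_span M ls} = exGs {k..<k + length ls} {v \<in> Val. v z = lf (dec ls k) v}"
  proof (intro equalityI subsetI)
    fix v assume "v \<in> {v \<in> Val. d (v z) \<in> G_span M ls}"
    then show "v \<in> exGs {k..<k + length ls} {v \<in> Val. v z = lf (dec ls k) v}"
      by (subst exGs_dec[where z = z and Q = "\<lambda>_ _. True"]) (auto simp: k_def G_span_def)
  next
    fix v assume v: "v \<in> exGs {k..<k + length ls} {v \<in> Val. v z = lf (dec ls k) v}"
    then have "v \<in> Val" using exGs_Val by blast
    with v show "v \<in> {v \<in> Val. d (v z) \<in> G_span M ls}"
      by (subst (asm) exGs_dec[where z = z and Q = "\<lambda>_ _. True"]) (auto simp: k_def G_span_def)
  qed
  then show ?thesis by (simp add: NF_exGs NF_eq_lf)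
qed

lemma NF_coord:
  assumes i: "i < length ls"
  shows "{v \<in> Val. \<exists>xs. length xs = length ls \<and> set xs \<subseteq> G_of M \<and>
    d (v z) = lincomb N ls xs \<and> xs ! i = d (v y)} \<in> NF"
proof -
  define k where "k = Suc (max z y)"
  let ?S = "{v \<in> Val. v z = lf (dec ls k) v} \<inter> {v \<in> Val. v (k + i) = v y}"
  have S: "w \<in> ?S \<longleftrightarrow> w z = lf (dec ls k) w \<and> map (\<lambda>j. d (w (k + j))) [0..<length ls] ! i = d (w y)"
    if "w \<in> Val" for w
  proof -
    have "d (w (k + i)) = d (w y) \<longleftrightarrow> w (k + i) = w y" using that by (metis Val_app e_d)
    then show ?thesis using that i by simp
  qed
  have "v \<in> exGs {k..<k + length ls} ?S \<longleftrightarrow> (\<exists>xs. length xs = length ls \<and> set xs \<subseteq> G_of M \<and>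
    d (v z) = lincomb N ls xs \<and> xs ! i = d (v y))" if "v \<in> Val" for v
  proof (rule exGs_dec[where Q = "\<lambda>w xs. xs ! i = d (w y)"])
    show "xs ! i = d (u y) \<longleftrightarrow> xs ! i = d (v y)" if "\<And>i. i < k \<Longrightarrow> u i = v i" for u xs
      using that[of y] by (simp add: k_def)
  qed (use that S in \<open>auto simp: k_def\<close>)
  then have "{v \<in> Val. \<exists>xs. length xs = length ls \<and> set xs \<subseteq> G_of M \<and>
    d (v z) = lincomb N ls xs \<and> xs ! i = d (v y)} = exGs {k..<k + length ls} ?S"
    using exGs_Val[of "{k..<k + length ls}" ?S] by blast
  also have "\<dots> \<in> NF" by (intro NF_exGs NF_Int NF_eq_lf NF_var_eq) simp
  finally show ?thesis .
qed

lemma NF_fun_graph: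
  assumes f: "fun_ar (lang_Gplus L R) f = Some (length zs)"
  shows "{v \<in> Val. d (v y) = fn M f (map (d \<circ> v) zs)} \<in> NF"
proof (cases f)
  case (GFun h)
  have "{v \<in> Val. d (v y) = fn M f (map (d \<circ> v) zs)} = DS (Eq (Var y) (Fn h (map Var zs)))"
    by (auto simp: DS_def GFun reduct_def comp_def)
  moreover have "wf_fm L (Eq (Var y) (Fn h (map Var zs)))"
    using f by (auto simp: lang_Gplus_def GFun)
  ultimately show ?thesis using DS_NF by simp
next
  case (Coord ls i)
  have li: "lin_indep (frac_field R) ls" "i < length ls" "length zs = 1"
    using f by (auto simp: lang_Gplus_def Coord split: if_splits)
  then obtain z where z: "zs = [z]" by (auto simp: length_Suc_conv)
  let ?A = "{v \<in> Val. \<exists>xs. length xs = length ls \<and> set xs \<subseteq> G_of M \<and> d (v z) = lincomb N ls xs \<and> xs ! i = d (v y)}"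
  let ?B = "{v \<in> Val. d (v z) \<in> G_span M ls}"
  have "d (v y) = fn M f (map (d \<circ> v) zs) \<longleftrightarrow> v \<in> (?B \<inter> ?A) \<union> ((Val - ?B) \<inter> {v \<in> Val. lf [(1, y)] v = 0})"
    if v: "v \<in> Val" for v
  proof -
    have D: "d (v y) \<in> Dom M" "d (v z) \<in> Dom M" using v by auto
    have "d (v y) = vzero N \<longleftrightarrow> v y = 0"
    proof
      assume "d (v y) = vzero N"
      then have "e (d (v y)) = 0" using e_zero by (simp only:)
      moreover have "e (d (v y)) = v y" using v by simp
      ultimately show "v y = 0" by (simp only:)
    next
      assume "v y = 0"
      moreover have "e (d (v y)) = v y" using v by simp
      ultimately have "e (d (v y)) = e (vzero N)" using e_zero by (simp only:)
      then show "d (v y) = vzero N" using e_eq_iff D N.closed(1) by simp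
    qed
    then show ?thesis using coord[OF li(1,2) D] v by (simp add: Coord z)
  qed
  then have "{v \<in> Val. d (v y) = fn M f (map (d \<circ> v) zs)} =
      (?B \<inter> ?A) \<union> ((Val - ?B) \<inter> {v \<in> Val. lf [(1, y)] v = 0})" by auto
  also have "\<dots> \<in> NF" by (intro NF_Un NF_Int NF_Compl NF_G_span NF_coord NF_lin li)
  finally show ?thesis .
qed

text \<open>In \<open>G\<close> as a structure the quantifiers range over \<open>G\<close>, so each
  of them is an instance of \<open>exG\<close>; the atoms are evaluated as in \<open>N\<close> and
  are thus formulas of \<open>L\<close>.\<close>

lemma NF_module:
  assumes "wf_fm (mod_lang R) \<phi>"
  shows "{v \<in> Val. sat (N\<lparr>Dom := G_of M\<rparr>) (d \<circ> v) \<phi>} \<in> NF"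
  using assms
proof (induction \<phi>)
  case (Eq s t)
  have ev: "eval_tm (N\<lparr>Dom := G_of M\<rparr>) v t = eval_tm N v t" for v and t :: "('k, 'f) lfun tm"
  proof (induction t)
    case (Fn f ts)
    then have "map (eval_tm (N\<lparr>Dom := G_of M\<rparr>) v) ts = map (eval_tm N v) ts" by simp
    then show ?case by (simp only: eval_tm.simps) simp
  qed simp
  have ar: "fun_ar L f = Some n" if "fun_ar (mod_lang R :: (('k, 'f) lfun, 'p) lang) f = Some n" for f n
    using that fun_ar_mod[OF L] by (auto simp: mod_lang_def split: lfun.splits if_splits)
  have "wf_tm L t" if "wf_tm (mod_lang R :: (('k, 'f) lfun, 'p) lang) t" for t
    using ar that by (rule wf_tm_mono)
  then have "wf_fm L (Eq s t)" using Eq by simp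
  moreover have "{v \<in> Val. sat (N\<lparr>Dom := G_of M\<rparr>) (d \<circ> v) (Eq s t)} = DS (Eq s t)"
    by (auto simp: DS_def ev)
  ultimately show ?case by (simp only: DS_NF)
next
  case (Pred p ts)
  then show ?case by (simp add: mod_lang_def)
next
  case (Neg \<phi>)
  have "{v \<in> Val. sat (N\<lparr>Dom := G_of M\<rparr>) (d \<circ> v) (Neg \<phi>)} =
    Val - {v \<in> Val. sat (N\<lparr>Dom := G_of M\<rparr>) (d \<circ> v) \<phi>}" by auto
  then show ?case using Neg NF_Compl by (simp only: wf_fm.simps)
next
  case (And \<phi> \<psi>)
  have "{v \<in> Val. sat (N\<lparr>Dom := G_of M\<rparr>) (d \<circ> v) (And \<phi> \<psi>)} =
    {v \<in> Val. sat (N\<lparr>Dom := G_of M\<rparr>) (d \<circ> v) \<phi>} \<inter> {v \<in> Val. sat (N\<lparr>Dom := G_of M\<rparr>) (d \<circ> v) \<psi>}" by auto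
  then show ?case using And NF_Int by (simp only: wf_fm.simps)
next
  case (Exi x \<phi>)
  have "{v \<in> Val. sat (N\<lparr>Dom := G_of M\<rparr>) (d \<circ> v) (Exi x \<phi>)} =
    exG x {v \<in> Val. sat (N\<lparr>Dom := G_of M\<rparr>) (d \<circ> v) \<phi>}"
  proof (intro equalityI subsetI)
    fix v assume "v \<in> {v \<in> Val. sat (N\<lparr>Dom := G_of M\<rparr>) (d \<circ> v) (Exi x \<phi>)}"
    then obtain a where v: "v \<in> Val" and a: "a \<in> G_of M" "sat (N\<lparr>Dom := G_of M\<rparr>) ((d \<circ> v)(x := a)) \<phi>" by auto
    have aD: "a \<in> Dom M" by (rule G_Dom[OF a(1)])
    have "e a \<in> G" using a aD by (simp add: e_G_iff)
    moreover have "d \<circ> v(x := e a) = (d \<circ> v)(x := a)" using aD by (simp add: d_upd)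
    ultimately show "v \<in> exG x {v \<in> Val. sat (N\<lparr>Dom := G_of M\<rparr>) (d \<circ> v) \<phi>}"
      using v a unfolding exG_def by (intro CollectI conjI bexI[of _ "e a"]) auto
  next
    fix v assume "v \<in> exG x {v \<in> Val. sat (N\<lparr>Dom := G_of M\<rparr>) (d \<circ> v) \<phi>}"
    then obtain g where v: "v \<in> Val" and g: "g \<in> G" "sat (N\<lparr>Dom := G_of M\<rparr>) (d \<circ> v(x := g)) \<phi>"
      unfolding exG_def by blast
    then show "v \<in> {v \<in> Val. sat (N\<lparr>Dom := G_of M\<rparr>) (d \<circ> v) (Exi x \<phi>)}"
      using d_G[OF g(1)] by (auto simp: d_upd)
  qed
  then show ?case using Exi NF_exG by (simp only: wf_fm.simps)
qed

lemma NF_rel: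
  assumes p: "rel_ar (lang_Gplus L R) p = Some (length zs)"
  shows "{v \<in> Val. rl M p (map (d \<circ> v) zs)} \<in> NF"
proof (cases p)
  case (GRel q)
  have "{v \<in> Val. rl M p (map (d \<circ> v) zs)} = DS (Pred q (map Var zs))"
    by (auto simp: DS_def GRel reduct_def comp_def)
  moreover have "wf_fm L (Pred q (map Var zs))"
    using p by (auto simp: lang_Gplus_def lang_G_def GRel)
  ultimately show ?thesis using DS_NF by simp
next
  case InG
  then have "length zs = Suc 0" using p by (simp add: lang_Gplus_def lang_G_def)
  then obtain z where z: "zs = [z]" by (auto simp: length_Suc_conv)
  have "{v \<in> Val. rl M p (map (d \<circ> v) zs)} = {v \<in> Val. v z \<in> G}"
    by (auto simp: in_Val_G z InG G_of_def)
  then show ?thesis using NF_var_G by simp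
next
  case (PMod n \<phi>)
  have \<phi>: "wf_fm (mod_lang R) \<phi>" "fv \<phi> \<subseteq> {..<n}" "n = length zs"
    using p by (auto simp: lang_Gplus_def lang_G_def PMod split: if_splits)
  \<comment> \<open>Sends the variables of \<open>\<phi>\<close> to the arguments \<open>zs\<close>;
    those from \<open>n\<close> on do not occur in \<open>\<phi>\<close> and go to variable
    0.\<close>
  define \<sigma> where "\<sigma> i = [(1 :: 'k, if i < n then zs ! i else 0)]" for i
  have lf\<sigma>: "lf (\<sigma> i) v = v (if i < n then zs ! i else 0)" for i v by (simp add: \<sigma>_def)
  let ?A = "{v \<in> Val. (\<lambda>i. lf (\<sigma> i) v) \<in> {v \<in> Val. sat (N\<lparr>Dom := G_of M\<rparr>) (d \<circ> v) \<phi>}}"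
  let ?B = "Val \<inter> \<Inter>((\<lambda>z. {v \<in> Val. lf [(1, z)] v \<in> G}) ` set zs)"
  have "{v \<in> Val. rl M p (map (d \<circ> v) zs)} = ?A \<inter> ?B"
  proof -
    have "rl M p (map (d \<circ> v) zs) \<longleftrightarrow> v \<in> ?A \<inter> ?B" if v: "v \<in> Val" for v
    proof -
      have "set (map (d \<circ> v) zs) \<subseteq> Dom M" using v by auto
      then have "rl M p (map (d \<circ> v) zs) \<longleftrightarrow> set (map (d \<circ> v) zs) \<subseteq> G_of M \<and>
          sat (N\<lparr>Dom := G_of M\<rparr>) (\<lambda>i. map (d \<circ> v) zs ! i) \<phi>"
        using conjunct2[OF modul[unfolded ax_module_def], rule_format, of \<phi> n "map (d \<circ> v) zs"] \<phi>
        unfolding PMod by (simp del: set_map)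
      moreover have "sat (N\<lparr>Dom := G_of M\<rparr>) (\<lambda>i. map (d \<circ> v) zs ! i) \<phi> \<longleftrightarrow>
          sat (N\<lparr>Dom := G_of M\<rparr>) (d \<circ> (\<lambda>i. lf (\<sigma> i) v)) \<phi>"
        by (rule sat_cong) (use \<phi> in \<open>auto simp: lf\<sigma>\<close>)
      moreover have "set (map (d \<circ> v) zs) \<subseteq> G_of M \<longleftrightarrow> v \<in> ?B"
        using v by (auto simp: in_Val_G)
      ultimately show ?thesis using v by auto
    qed
    then show ?thesis by auto
  qed
  moreover have "?A \<in> NF" by (rule NF_subst[OF NF_module[OF \<phi>(1)]])
  moreover have "?B \<in> NF" by (intro BPP_NF PP_BPP PP_Inter) (use PP_lf_G in blast)+
  ultimately show ?thesis by (simp add: NF_Int)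
next
  case (GSpan ls)
  have li: "lin_indep (frac_field R) ls" "length zs = 1"
    using p by (auto simp: lang_Gplus_def GSpan split: if_splits)
  then obtain z where z: "zs = [z]" by (auto simp: length_Suc_conv)
  have "{v \<in> Val. rl M p (map (d \<circ> v) zs)} = {v \<in> Val. d (v z) \<in> G_span M ls}"
    using span[OF li(1)] by (auto simp: GSpan z)
  then show ?thesis using NF_G_span by simp
qed

lemma map_ev:
  assumes "v \<in> Val" "\<And>t. t \<in> set ts \<Longrightarrow> wf_tm (lang_Gplus L R) t"
  shows "map (d \<circ> updl v k (map (ev v) ts)) [k..<k + length ts] = map (eval_tm M (d \<circ> v)) ts"
proof -
  have "map (d \<circ> updl v k (map (ev v) ts)) [k..<k + length ts] =
      map d (map (updl v k (map (ev v) ts)) [k..<k + length (map (ev v) ts)])" by simp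
  also have "\<dots> = map d (map (ev v) ts)" by (simp only: map_updl)
  also have "\<dots> = map (eval_tm M (d \<circ> v)) ts" using eval_M_Dom[OF assms] by simp
  finally show ?thesis .
qed

text \<open>A function application is replaced by the graph of the function, with the value as a new
  variable \<open>y\<close>. This costs one quantifier over \<open>V\<close>, under which
  \<open>NF\<close> is closed.\<close>

lemma T_closed: "wf_tm (lang_Gplus L R) t \<Longrightarrow> T_closed t"
proof (induction t)
  case (Var i)
  have "{v \<in> Val. v(x := ev v (Var i)) \<in> S} = {v \<in> Val. v(x := lf [(1, i)] v) \<in> S}" for x S by auto
  then show ?case unfolding T_closed_def by (simp only:) (intro ballI allI NF_subst1)
next
  case (Fn f ts)
  have ts: "wf_tm (lang_Gplus L R) t" if "t \<in> set ts" for t using Fn.prems that by simp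
  show ?case
    unfolding T_closed_def
  proof (intro ballI allI)
    fix S x assume S: "S \<in> NF"
    obtain k1 where k1: "dep V S k1" using NF_dep[OF S] by blast
    obtain k2 where k2: "\<forall>i\<in>fv_tm (Fn f ts). i < k2" using fv_tm_bound .
    define k where "k = max (Suc x) (max k1 k2)"
    have k: "dep V S k" "x < k" using dep_mono[OF k1] by (auto simp: k_def)
    have fvk: "i < k" if "t \<in> set ts" "i \<in> fv_tm t" for t i using k2 that by (auto simp: k_def less_max_iff_disj)
    define n where "n = length ts"
    define zs where "zs = [k..<k + n]"
    define y where "y = k + n"
    define S2 where "S2 = exV y ({w \<in> Val. d (w y) = fn M f (map (d \<circ> w) zs)} \<inter> {w \<in> Val. w(x := lf [(1, y)] w) \<in> S})"
    have "fun_ar (lang_Gplus L R) f = Some (length zs)" using Fn.prems by (simp add: zs_def n_def)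
    then have S2: "S2 \<in> NF" unfolding S2_def by (intro NF_exV NF_Int NF_fun_graph NF_subst1 S)
    have "updl v k (map (ev v) ts) \<in> S2 \<longleftrightarrow> v(x := ev v (Fn f ts)) \<in> S" if v: "v \<in> Val" for v
    proof -
      define w where "w = updl v k (map (ev v) ts)"
      define b where "b = fn M f (map (eval_tm M (d \<circ> v)) ts)"
      have w: "w \<in> Val" unfolding w_def using v ev_V[OF v ts] by (intro Val_updl) auto
      have bD: "b \<in> Dom M" using eval_M_Dom[OF v Fn.prems] by (simp add: b_def)
      have zs: "map (d \<circ> w(y := a)) zs = map (eval_tm M (d \<circ> v)) ts" for a
      proof -
        have "map (d \<circ> w(y := a)) zs = map (d \<circ> w) zs" by (rule map_cong) (auto simp: zs_def y_def)
        then show ?thesis using map_ev[OF v ts, of ts k] by (simp add: zs_def n_def w_def)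
      qed
      have agree: "(w(y := a))(x := a) \<in> S \<longleftrightarrow> v(x := a) \<in> S" if "a \<in> V" for a
        by (rule depD[OF k(1)]) (use v w that in \<open>auto simp: w_def updl_def y_def\<close>)
      have "w \<in> S2 \<longleftrightarrow> (\<exists>a\<in>V. d a = b \<and> v(x := a) \<in> S)"
        unfolding S2_def exV_def using w by (auto simp: zs b_def[symmetric] agree)
      also have "\<dots> \<longleftrightarrow> v(x := e b) \<in> S"
      proof
        assume "\<exists>a\<in>V. d a = b \<and> v(x := a) \<in> S"
        then show "v(x := e b) \<in> S" by auto
      next
        assume "v(x := e b) \<in> S"
        then show "\<exists>a\<in>V. d a = b \<and> v(x := a) \<in> S" using bD by (intro bexI[of _ "e b"]) auto
      qed
      finally show ?thesis by (simp add: w_def b_def)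
    qed
    then have "{v \<in> Val. v(x := ev v (Fn f ts)) \<in> S} = {v \<in> Val. updl v k (map (ev v) ts) \<in> S2}" by blast
    also have "\<dots> \<in> NF"
      by (rule NF_updl[OF _ S2]) (use Fn.IH ts fvk in auto)
    finally show "{v \<in> Val. v(x := ev v (Fn f ts)) \<in> S} \<in> NF" .
  qed
qed

text \<open>Writing the values of the terms into fresh variables reduces an atom to one whose
  arguments are consecutive variables.\<close>

lemma NF_atom:
  assumes ts: "\<And>t. t \<in> set ts \<Longrightarrow> wf_tm (lang_Gplus L R) t"
    and A: "\<And>k. {w \<in> Val. Q (map (d \<circ> w) [k..<k + length ts])} \<in> NF"
  shows "{v \<in> Val. Q (map (eval_tm M (d \<circ> v)) ts)} \<in> NF"
proof -
  have "finite (\<Union>t\<in>set ts. fv_tm t)" by (simp add: finite_fv_tm)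
  then obtain k where k: "\<forall>i\<in>(\<Union>t\<in>set ts. fv_tm t). i < k"
    unfolding finite_nat_set_iff_bounded by (elim exE)
  let ?A = "{w \<in> Val. Q (map (d \<circ> w) [k..<k + length ts])}"
  have "updl v k (map (ev v) ts) \<in> ?A \<longleftrightarrow> Q (map (eval_tm M (d \<circ> v)) ts)" if v: "v \<in> Val" for v
  proof -
    have "updl v k (map (ev v) ts) \<in> Val" using v ev_V[OF v ts] by (intro Val_updl) auto
    moreover have "map (d \<circ> updl v k (map (ev v) ts)) [k..<k + length ts] = map (eval_tm M (d \<circ> v)) ts"
      by (rule map_ev[OF v ts])
    ultimately show ?thesis by (simp only: mem_Collect_eq simp_thms)
  qed
  then have "{v \<in> Val. Q (map (eval_tm M (d \<circ> v)) ts)} = {v \<in> Val. updl v k (map (ev v) ts) \<in> ?A}" by blast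
  also have "\<dots> \<in> NF" by (rule NF_updl[OF _ A]) (use T_closed ts k in auto)
  finally show ?thesis .
qed

theorem NF_fm: "wf_fm (lang_Gplus L R) \<phi> \<Longrightarrow> {v \<in> Val. sat M (d \<circ> v) \<phi>} \<in> NF"
proof (induction \<phi>)
  case (Eq s t)
  have d_eq: "d (v i) = d (v j) \<longleftrightarrow> v i = v j" if "v \<in> Val" for v i j using that by (metis Val_app e_d)
  have "{v \<in> Val. (\<lambda>as. as ! 0 = as ! 1) (map (eval_tm M (d \<circ> v)) [s, t])} \<in> NF"
  proof (rule NF_atom)
    fix k
    have "[k..<k + length [s, t]] = [k, Suc k]" by (simp add: upt_rec)
    then have "{w \<in> Val. map (d \<circ> w) [k..<k + length [s, t]] ! 0 = map (d \<circ> w) [k..<k + length [s, t]] ! 1} =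
        {w \<in> Val. w k = w (Suc k)}" using d_eq by auto
    then show "{w \<in> Val. map (d \<circ> w) [k..<k + length [s, t]] ! 0 = map (d \<circ> w) [k..<k + length [s, t]] ! 1} \<in> NF"
      using NF_var_eq by simp
  qed (use Eq in auto)
  moreover have "{v \<in> Val. sat M (d \<circ> v) (Eq s t)} =
      {v \<in> Val. (\<lambda>as. as ! 0 = as ! 1) (map (eval_tm M (d \<circ> v)) [s, t])}" by simp
  ultimately show ?case by (simp only:)
next
  case (Pred p ts)
  have "{v \<in> Val. rl M p (map (eval_tm M (d \<circ> v)) ts)} \<in> NF"
  proof (rule NF_atom)
    show "{w \<in> Val. rl M p (map (d \<circ> w) [k..<k + length ts])} \<in> NF" for k
      by (rule NF_rel) (use Pred in simp)
  qed (use Pred in auto)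
  then show ?case by (simp only: sat.simps)
next
  case (Neg \<phi>)
  have "{v \<in> Val. sat M (d \<circ> v) (Neg \<phi>)} = Val - {v \<in> Val. sat M (d \<circ> v) \<phi>}" by auto
  then show ?case using Neg NF_Compl by (simp only: wf_fm.simps)
next
  case (And \<phi> \<psi>)
  have "{v \<in> Val. sat M (d \<circ> v) (And \<phi> \<psi>)} =
    {v \<in> Val. sat M (d \<circ> v) \<phi>} \<inter> {v \<in> Val. sat M (d \<circ> v) \<psi>}" by auto
  then show ?case using And NF_Int by (simp only: wf_fm.simps)
next
  case (Exi x \<phi>)
  have "{v \<in> Val. sat M (d \<circ> v) (Exi x \<phi>)} = exV x {v \<in> Val. sat M (d \<circ> v) \<phi>}"
  proof (intro equalityI subsetI)
    fix v assume "v \<in> {v \<in> Val. sat M (d \<circ> v) (Exi x \<phi>)}"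
    then obtain a where v: "v \<in> Val" and a: "a \<in> Dom M" "sat M ((d \<circ> v)(x := a)) \<phi>" by auto
    have "d \<circ> v(x := e a) = (d \<circ> v)(x := a)" using a by (simp add: d_upd)
    then show "v \<in> exV x {v \<in> Val. sat M (d \<circ> v) \<phi>}"
      using v a unfolding exV_def by (intro CollectI conjI bexI[of _ "e a"]) auto
  next
    fix v assume "v \<in> exV x {v \<in> Val. sat M (d \<circ> v) \<phi>}"
    then obtain a where v: "v \<in> Val" and a: "a \<in> V" "sat M (d \<circ> v(x := a)) \<phi>"
      unfolding exV_def by blast
    then show "v \<in> {v \<in> Val. sat M (d \<circ> v) (Exi x \<phi>)}"
      using d_Dom[OF a(1)] by (auto simp: d_upd)
  qed
  then show ?case using Exi NF_exV by (simp only: wf_fm.simps)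
qed

theorem no_IP:
  assumes "wf_fm (lang_Gplus L R) \<phi>"
  shows "\<not> has_IP M \<phi> X"
proof
  assume IP: "has_IP M \<phi> X"
  let ?S = "{v \<in> Val. sat M (d \<circ> v) \<phi>}"
  obtain n where n: "\<not> shatters_val V ?S X n"
    using NF_nip[OF NF_fm[OF assms]] unfolding nip_set_def by blast
  from spec[OF IP[unfolded has_IP_def], of n] obtain a b where ab: "\<forall>i. range (a i) \<subseteq> Dom M" "\<forall>I. range (b I) \<subseteq> Dom M"
    "\<forall>i<n. \<forall>I. I \<subseteq> {..<n} \<longrightarrow> (sat M (\<lambda>z. if z \<in> X then a i z else b I z) \<phi> \<longleftrightarrow> i \<in> I)"
    by (elim exE conjE)
  have "shatters_val V ?S X n"
    unfolding shatters_val_def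
  proof (intro exI[of _ "\<lambda>i. e \<circ> a i"] exI[of _ "\<lambda>I. e \<circ> b I"] conjI allI impI)
    show r: "range (e \<circ> a i) \<subseteq> V" "range (e \<circ> b I) \<subseteq> V" for i I
      using ab(1)[rule_format, of i] ab(2)[rule_format, of I] by (auto simp: V_def)
    fix i I assume iI: "i < n" "I \<subseteq> {..<n}"
    have "d \<circ> splice_val X (e \<circ> a i) (e \<circ> b I) = (\<lambda>z. if z \<in> X then a i z else b I z)"
    proof
      fix z
      have "a i z \<in> Dom M" "b I z \<in> Dom M" using ab(1)[rule_format, of i] ab(2)[rule_format, of I] by auto
      then show "(d \<circ> splice_val X (e \<circ> a i) (e \<circ> b I)) z = (if z \<in> X then a i z else b I z)"
        by (simp add: splice_val_def)
    qed
    then show "splice_val X (e \<circ> a i) (e \<circ> b I) \<in> ?S \<longleftrightarrow> i \<in> I"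
      using ab(3) iI Val_splice[OF r] by simp
  qed
  with n show False by blast
qed

end

theorem proposition4p2:
  fixes R :: "'k::field_char_0 set"
    and L :: "(('k, 'f) lfun, 'p) lang"
    and T :: "(('k, 'f) lfun, 'p) fm set"
  assumes "is_subring R"
    and "sublang (mod_lang UNIV) L"
    and "is_theory L T"
    and "\<forall>M\<in>Models TYPE(('u, 'k, 'f, 'p) univ) L T. is_vector_space M"
    and "has_QE L (Models TYPE(('u, 'k, 'f, 'p) univ) L T)"
    and "eliminates_ex_inf L (Models TYPE(('u, 'k, 'f, 'p) univ) L T)"
    and "dcl_acl_span L (Models TYPE(('u, 'k, 'f, 'p) univ) L T)"
    and "NIP L (Models TYPE(('u, 'k, 'f, 'p) univ) L T)"
  shows "NIP (lang_Gplus L R) (TGplus_models TYPE(('u, 'k, 'f, 'p) univ) L T R)"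
  unfolding NIP_def
proof (intro ballI allI impI)
  fix M :: "(('u, 'k, 'f, 'p) univ, ('k, 'f) gfun, ('k, 'f, 'p) grel) struct"
    and \<phi> :: "(('k, 'f) gfun, ('k, 'f, 'p) grel) fm" and X :: "nat set"
  assume M: "M \<in> TGplus_models TYPE(('u, 'k, 'f, 'p) univ) L T R" and \<phi>: "wf_fm (lang_Gplus L R) \<phi>"
  let ?K = "Models TYPE(('u, 'k, 'f, 'p) univ) L T"
  let ?N = "reduct M"
  have TG: "M \<in> TG_models TYPE(('u, 'k, 'f, 'p) univ) L T R" using M by (simp add: TGplus_models_def)
  then have N: "?N \<in> ?K" by (simp add: TG_models_def)
  have Dom: "Dom ?N = Dom M" by (simp add: reduct_def)
  have vs: "is_vector_space ?N" using assms(4) N by blast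
  interpret vspace ?N by unfold_locales (rule vs)
  obtain e :: "('u, 'k, 'f, 'p) univ \<Rightarrow> ('u, 'k, 'f, 'p) univ \<Rightarrow> 'k" where e: "inj_on e (Dom M)" "e (vzero ?N) = 0"
    "\<forall>a\<in>Dom M. \<forall>b\<in>Dom M. e (vadd ?N a b) = e a + e b"
    "\<forall>a\<in>Dom M. \<forall>c. e (smul ?N c a) = (\<lambda>x. c * e a x)"
    using embed_exists unfolding Dom by (elim exE conjE)
  interpret generic_pair L R M e
  proof
    show "is_subring R" "sublang (mod_lang UNIV) L" by (rule assms)+
    show "is_vector_space ?N" by (rule vs)
    show "is_struct L ?N" using N by (simp add: Models_def)
    show "inj_on e (Dom M)" "e (vzero ?N) = 0"
      "\<forall>a\<in>Dom M. \<forall>b\<in>Dom M. e (vadd ?N a b) = e a + e b"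
      "\<forall>a\<in>Dom M. \<forall>c. e (smul ?N c a) = (\<lambda>x. c * e a x)" by (rule e)+
    fix \<phi> :: "(('k, 'f) lfun, 'p) fm" assume \<phi>: "wf_fm L \<phi>"
    obtain \<psi> where \<psi>: "wf_fm L \<psi>" "qfree \<psi>"
      "\<forall>M\<in>?K. \<forall>v. range v \<subseteq> Dom M \<longrightarrow> (sat M v \<phi> \<longleftrightarrow> sat M v \<psi>)"
      using assms(5)[unfolded has_QE_def, rule_format, OF \<phi>] by (elim exE conjE)
    show "\<exists>\<psi>. wf_fm L \<psi> \<and> qfree \<psi> \<and> (\<forall>v. range v \<subseteq> Dom M \<longrightarrow> (sat ?N v \<phi> \<longleftrightarrow> sat ?N v \<psi>))"
      using \<psi>(1,2) bspec[OF \<psi>(3) N] unfolding Dom by (intro exI[of _ \<psi>] conjI)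
    fix x
    obtain \<chi> where \<chi>: "wf_fm L \<chi>"
      "\<forall>M\<in>?K. \<forall>v. range v \<subseteq> Dom M \<longrightarrow> (sat M v \<chi> \<longleftrightarrow> infinite (sols M \<phi> x v))"
      using assms(6)[unfolded eliminates_ex_inf_def, rule_format, OF \<phi>, of x] by (elim exE conjE)
    show "\<exists>\<psi>. wf_fm L \<psi> \<and> (\<forall>v. range v \<subseteq> Dom M \<longrightarrow> (sat ?N v \<psi> \<longleftrightarrow> infinite (sols ?N \<phi> x v)))"
      using \<chi>(1) bspec[OF \<chi>(2) N] unfolding Dom by (intro exI[of _ \<chi>] conjI)
    show "\<exists>S. finite S \<and> (\<forall>t\<in>S. x \<notin> snd ` set t) \<and> (\<forall>v. range v \<subseteq> Dom M \<longrightarrow> finite (sols ?N \<phi> x v) \<longrightarrow>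
         sols ?N \<phi> x v \<subseteq> (\<lambda>t. eval_tm ?N v (lin_tm t)) ` S)"
      using finite_fibre_linear[OF assms(2,3,4,6,7) N \<phi>, of x] unfolding Dom .
    show "\<not> has_IP ?N \<phi> X" for X using assms(8) N \<phi> unfolding NIP_def by blast
  next
    show "ax_module R M" "ax_indep R M" "ax_density L R M" "ax_extension L M"
      using TG by (simp_all add: TG_models_def)
    show "is_struct (lang_Gplus L R) M" using M by (simp add: TGplus_models_def)
    fix ls :: "'k list" and a
    assume ls: "lin_indep (frac_field R) ls" and a: "a \<in> Dom M"
    have *: "\<forall>ls. lin_indep (frac_field R) ls \<longrightarrow>
           (\<forall>a\<in>Dom M. rl M (GSpan ls) [a] \<longleftrightarrow> a \<in> G_span M ls) \<and>
           (\<forall>i<length ls. \<forall>x\<in>Dom M. \<forall>y\<in>Dom M.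
              x = fn M (Coord ls i) [y] \<longleftrightarrow>
                (y \<in> G_span M ls \<and>
                   (\<exists>xs. length xs = length ls \<and> set xs \<subseteq> G_of M \<and>
                         y = lincomb ?N ls xs \<and> xs ! i = x)) \<or>
                (y \<notin> G_span M ls \<and> x = vzero ?N))"
      using M unfolding TGplus_models_def by (elim CollectE conjE)
    note ** = *[rule_format, OF ls]
    show "rl M (GSpan ls) [a] \<longleftrightarrow> a \<in> G_span M ls" by (rule bspec[OF conjunct1[OF **] a])
    fix i b assume i: "i < length ls" and b: "b \<in> Dom M"
    show "a = fn M (Coord ls i) [b] \<longleftrightarrow>
        (b \<in> G_span M ls \<and> (\<exists>xs. length xs = length ls \<and> set xs \<subseteq> G_of M \<and>
           b = lincomb ?N ls xs \<and> xs ! i = a)) \<or>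
        (b \<notin> G_span M ls \<and> a = vzero ?N)"
      by (rule conjunct2[OF **, rule_format, OF i a b])
  qed
  show "\<not> has_IP M \<phi> X" by (rule no_IP[OF \<phi>])
qed

end
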